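(* Let $\mathbf{Z}_1,\ldots,\mathbf{Z}_n$ be a random sample from the distribution of a random matrix $\mathbf{Z}\in\mathbb{R}^{p\times q}$ having finite eighth moments, whose components $z_{kl}$ are mutually independent with $\mathrm{E}(z_{kl})=0$ and $\mathrm{var}(z_{kl})=1$, and such that, with $\beta_{kl}=\mathrm{E}(z_{kl}^4)$, the row averages $\bar\beta_{1\cdot},\ldots,\bar\beta_{p\cdot}$ are distinct and the column averages $\bar\beta_{\cdot1},\ldots,\bar\beta_{\cdot q}$ are distinct. Assume that $\boldsymbol{\Omega}_L=\mathbf{I}_p$ and $\boldsymbol{\Omega}_R=\mathbf{I}_q$ (so that the observed matrices are $\mathbf{X}_i=\mathbf{Z}_i$), and that the left and right standardization matrices $\bar{\mathbf{S}}_L^{-1/2}$ and $\bar{\mathbf{S}}_R^{-1/2}$ are chosen to be symmetric. Let $N\in\{0,1\}$, and let $\hat{\boldsymbol{\Gamma}}=(\hat\gamma_{kk'})$ be a sequence of left MFOBI estimates (based on $\bar{\mathbf{B}}_L^N$) with $\hat{\boldsymbol{\Gamma}}\to_P\mathbf{I}_p$. Then the limiting distribution of $\sqrt n\,\mathrm{vec}(\hat{\boldsymbol{\Gamma}}-\mathbf{I}_p)$ as $n\to\infty$ is multivariate normal with mean vector $\mathbf{0}_{p^2}$ and the following asymptotic variances: $$ASV(\hat\gamma_{kk})=\frac{\bar\beta_{k\cdot}-1}{4q},$$ $$ASV(\hat\gamma_{kk'})=\frac{\bar\omega_{k\cdot}+\bar\omega_{k'\cdot}-\bar\beta_{k\cdot}^2+2\delta_{kk'}+(q-1)\bar\beta_{k\cdot}+(q-7)\bar\beta_{k'\cdot}+c_N}{q(\bar\beta_{k\cdot}-\bar\beta_{k'\cdot})^2},\qquad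 k\neq k',$$ where $c_0=\sum_{m\neq k,k'}\bar\beta_{m\cdot}+pq-2p-4q+15$ and $c_1=q\sum_{m\neq k,k'}\bar\beta_{m\cdot}-pq+11$.
   Context: Left MFOBI estimate. Observed i.i.d. matrices are $\mathbf{X}_i=\boldsymbol{\Omega}_L\mathbf{Z}_i\boldsymbol{\Omega}_R^\top$; here $\mathbf{X}_i=\mathbf{Z}_i$. Let $\tilde{\mathbf{X}}_i=\mathbf{X}_i-\bar{\mathbf{X}}$ with $\bar{\mathbf X}=\frac1n\sum_i\mathbf X_i$, $\bar{\mathbf{S}}_L=\frac1{nq}\sum_i\tilde{\mathbf{X}}_i\tilde{\mathbf{X}}_i^\top$, $\bar{\mathbf{S}}_R=\frac1{np}\sum_i\tilde{\mathbf{X}}_i^\top\tilde{\mathbf{X}}_i$ (positive definite with probability tending to 1), and $\mathbf{Y}_i=\bar{\mathbf{S}}_L^{-1/2}\tilde{\mathbf{X}}_i(\bar{\mathbf{S}}_R^{-1/2})^\top$, with the symmetric inverse square roots. Define $$\bar{\mathbf{B}}_L^0=\frac1{nq}\sum_{i=1}^n\mathbf{Y}_i\mathbf{Y}_i^\top\mathbf{Y}_i\mathbf{Y}_i^\top,\qquad\bar{\mathbf{B}}_L^1=\frac1{nq}\sum_{i=1}^n\|\mathbf{Y}_i\|_F^2\,\mathbf{Y}_i\mathbf{Y}_i^\top.$$ A left MFOBI estimate is any $\hat{\boldsymbol{\Gamma}}=\hat{\mathbf{W}}_L^\top\bar{\mathbf{S}}_L^{-1/2}$, where $\hat{\mathbf{W}}_L$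 is an orthogonal matrix whose columns are eigenvectors of $\bar{\mathbf{B}}_L^N$ (in any order and with any signs); under the stated assumptions a sequence of such estimates with $\hat{\boldsymbol{\Gamma}}\to_P\mathbf{I}_p$ exists. Moment notation: $\beta_{kl}=\mathrm{E}(z_{kl}^4)$, $\omega_{kl}=\mathrm{var}(z_{kl}^3)$, $\bar\beta_{k\cdot}=\frac1q\sum_l\beta_{kl}$, $\bar\beta_{\cdot l}=\frac1p\sum_k\beta_{kl}$, $\bar\omega_{k\cdot}=\frac1q\sum_l\omega_{kl}$, and $\delta_{kk'}=\frac1q\sum_l\beta_{kl}\beta_{k'l}-\bar\beta_{k\cdot}\bar\beta_{k'\cdot}$. $ASV(\hat\gamma_{kk'})$ denotes the variance of the corresponding component of the limiting normal distribution of $\sqrt n\,\mathrm{vec}(\hat{\boldsymbol{\Gamma}}-\mathbf{I}_p)$. *)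

theory Defs
  imports "HOL-Probability.Probability"
begin

definition pos_def :: "real^'n^'n \<Rightarrow> bool" where
  "pos_def A \<longleftrightarrow> transpose A = A \<and> (\<forall>x. x \<noteq> 0 \<longrightarrow> 0 < x \<bullet> (A *v x))"

definition pos_semidef :: "real^'n^'n \<Rightarrow> bool" where
  "pos_semidef A \<longleftrightarrow> transpose A = A \<and> (\<forall>x. 0 \<le> x \<bullet> (A *v x))"

text \<open>The symmetric inverse square root follows the usual convention: it is the symmetric
  positive definite square root of the inverse, which is unique if \<open>S\<close> is positive definite.
  For other \<open>S\<close> the value is unspecified.\<close>

definition inv_sqrt :: "real^'n^'n \<Rightarrow> real^'n^'n" where
  "inv_sqrt S = (THE R. pos_def R \<and> R ** R = matrix_inv S)"

definition eigenvector :: "real^'n^'n \<Rightarrow> real^'n \<Rightarrow> bool" where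
  "eigenvector A v \<longleftrightarrow> v \<noteq> 0 \<and> (\<exists>c. A *v v = c *\<^sub>R v)"

text \<open>The entries of a matrix as one vector. The coordinates are indexed by pairs (row, column)
  rather than by an initial segment of the naturals, so no stacking order is involved.\<close>

definition vec_mat :: "real^'n^'m \<Rightarrow> real^('m \<times> 'n)" where
  "vec_mat A = (\<chi> i. A $ fst i $ snd i)"

text \<open>A sample of size \<open>n\<close> consists of the first \<open>n\<close> terms \<open>X 0, \<dots>, X (n - 1)\<close> of a sequence of
  \<open>p \<times> q\<close> matrices, where \<open>p = CARD('p)\<close> and \<open>q = CARD('q)\<close>.\<close>

definition sample_mean :: "(nat \<Rightarrow> real^'q^'p) \<Rightarrow> nat \<Rightarrow> real^'q^'p" where
  "sample_mean X n = (1 / real n) *\<^sub>R (\<Sum>i<n. X i)"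

definition centered :: "(nat \<Rightarrow> real^'q^'p) \<Rightarrow> nat \<Rightarrow> nat \<Rightarrow> real^'q^'p" where
  "centered X n i = X i - sample_mean X n"

definition S_L :: "(nat \<Rightarrow> real^'q^'p) \<Rightarrow> nat \<Rightarrow> real^'p^'p" where
  "S_L X n = (1 / (real n * real CARD('q))) *\<^sub>R
     (\<Sum>i<n. centered X n i ** transpose (centered X n i))"

definition S_R :: "(nat \<Rightarrow> real^'q^'p) \<Rightarrow> nat \<Rightarrow> real^'q^'q" where
  "S_R X n = (1 / (real n * real CARD('p))) *\<^sub>R
     (\<Sum>i<n. transpose (centered X n i) ** centered X n i)"

definition standardized :: "(nat \<Rightarrow> real^'q^'p) \<Rightarrow> nat \<Rightarrow> nat \<Rightarrow> real^'q^'p" where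
  "standardized X n i =
     inv_sqrt (S_L X n) ** centered X n i ** transpose (inv_sqrt (S_R X n))"

definition B_L0 :: "(nat \<Rightarrow> real^'q^'p) \<Rightarrow> nat \<Rightarrow> real^'p^'p" where
  "B_L0 X n = (1 / (real n * real CARD('q))) *\<^sub>R
     (\<Sum>i<n. let Y = standardized X n i in Y ** transpose Y ** Y ** transpose Y)"

text \<open>The norm of the type \<open>real^'q^'p\<close> is the Frobenius norm.\<close>

definition B_L1 :: "(nat \<Rightarrow> real^'q^'p) \<Rightarrow> nat \<Rightarrow> real^'p^'p" where
  "B_L1 X n = (1 / (real n * real CARD('q))) *\<^sub>R
     (\<Sum>i<n. let Y = standardized X n i in (norm Y)\<^sup>2 *\<^sub>R (Y ** transpose Y))"

definition B_L :: "nat \<Rightarrow> (nat \<Rightarrow> real^'q^'p) \<Rightarrow> nat \<Rightarrow> real^'p^'p" where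
  "B_L N X n = (if N = 0 then B_L0 X n else B_L1 X n)"

definition left_mfobi_estimate ::
  "nat \<Rightarrow> (nat \<Rightarrow> real^'q^'p) \<Rightarrow> nat \<Rightarrow> real^'p^'p \<Rightarrow> bool" where
  "left_mfobi_estimate N X n G \<longleftrightarrow>
     (\<exists>W. orthogonal_matrix W \<and> (\<forall>j. eigenvector (B_L N X n) (column j W)) \<and>
          G = transpose W ** inv_sqrt (S_L X n))"

definition fourth_moment :: "'a measure \<Rightarrow> ('a \<Rightarrow> real^'q^'p) \<Rightarrow> 'p \<Rightarrow> 'q \<Rightarrow> real" where
  "fourth_moment M Z k l = prob_space.expectation M (\<lambda>x. (Z x $ k $ l) ^ 4)"

definition var_cube :: "'a measure \<Rightarrow> ('a \<Rightarrow> real^'q^'p) \<Rightarrow> 'p \<Rightarrow> 'q \<Rightarrow> real" where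
  "var_cube M Z k l = prob_space.variance M (\<lambda>x. (Z x $ k $ l) ^ 3)"

definition row_avg :: "('p::finite \<Rightarrow> 'q::finite \<Rightarrow> real) \<Rightarrow> 'p \<Rightarrow> real" where
  "row_avg a k = (\<Sum>l\<in>UNIV. a k l) / real CARD('q)"

definition col_avg :: "('p::finite \<Rightarrow> 'q::finite \<Rightarrow> real) \<Rightarrow> 'q \<Rightarrow> real" where
  "col_avg a l = (\<Sum>k\<in>UNIV. a k l) / real CARD('p)"

definition row_cov :: "('p::finite \<Rightarrow> 'q::finite \<Rightarrow> real) \<Rightarrow> 'p \<Rightarrow> 'p \<Rightarrow> real" where
  "row_cov a k k' = (\<Sum>l\<in>UNIV. a k l * a k' l) / real CARD('q) - row_avg a k * row_avg a k'"

definition conv_in_prob ::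
  "'a measure \<Rightarrow> (nat \<Rightarrow> 'a \<Rightarrow> 'b::metric_space) \<Rightarrow> 'b \<Rightarrow> bool" where
  "conv_in_prob M X c \<longleftrightarrow>
     (\<forall>\<epsilon>>0. (\<lambda>n. measure M {x \<in> space M. dist (X n x) c > \<epsilon>}) \<longlonglongrightarrow> 0)"

text \<open>The library's \<^const>\<open>weak_conv_m\<close> only covers measures on the real line.\<close>

definition weak_limit ::
  "(nat \<Rightarrow> 'b::topological_space measure) \<Rightarrow> 'b measure \<Rightarrow> bool" where
  "weak_limit \<mu>s \<mu> \<longleftrightarrow>
     (\<forall>f :: 'b \<Rightarrow> real. continuous_on UNIV f \<and> bounded (range f) \<longrightarrow>
        (\<lambda>n. integral\<^sup>L (\<mu>s n) f) \<longlonglongrightarrow> integral\<^sup>L \<mu> f)"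

definition normal_law :: "real \<Rightarrow> real \<Rightarrow> real measure" where
  "normal_law m v =
     (if v = 0 then return borel m else density lborel (normal_density m (sqrt v)))"

text \<open>The covariance matrix may be singular, so the distribution is determined by the normality of
  all linear functionals and not by a density.\<close>

definition multivariate_normal ::
  "real^'n \<Rightarrow> real^'n^'n \<Rightarrow> (real^'n) measure \<Rightarrow> bool" where
  "multivariate_normal m C \<mu> \<longleftrightarrow>
     prob_space \<mu> \<and> sets \<mu> = sets borel \<and> pos_semidef C \<and>
     (\<forall>t. distr \<mu> borel (\<lambda>x. t \<bullet> x) = normal_law (t \<bullet> m) (t \<bullet> (C *v t)))"

end

theory Submission
  imports Defs
begin

text \<open>An estimator is asymptotically linear if it equals \<open>c + (1/n) \<Sum>\<^sub>i g (Z\<^sub>i) + o\<^sub>P (n\<^sup>-\<^sup>1\<^sup>/\<^sup>2)\<close>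
  with a centered, square-integrable influence function \<open>g\<close>. The pairs \<open>(c, g)\<close> add and multiply like
  dual numbers, so the influence functions of the standardized fourth sample moments, and hence of
  \<open>B\<^sub>L\<^sup>N\<close>, follow from those of the raw sample moments and from the derivative \<open>- 1/2\<close> of the inverse
  square root at the identity. Writing \<open>\<Gamma> = U R\<close> with \<open>R\<close> the inverse square root of \<open>S\<^sub>L\<close> and with
  orthonormal eigenvectors of \<open>B\<^sub>L\<^sup>N\<close> as rows of \<open>U\<close>, first-order perturbation of the eigenvectors gives
  the influence function of \<open>\<Gamma>\<close>; its off-diagonal entries are sums of orthogonal products of centered
  functions of single entries of \<open>Z\<close>, from which the variances are read off. Normality comes from the
  one-dimensional central limit theorem applied to all linear combinations.\<close>

section \<open>Inverse square roots near the identity\<close>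

text \<open>The orthogonal matrix \<open>W\<close> is given only existentially, for each sample
  separately, with free order and signs and without measurability, so it is never followed along the
  sequence. Since R R S = 1 for S near the identity, U = \<Gamma> R S can be computed from the
  estimate itself; it tends to the identity because \<Gamma> does, and with probability tending to 1
  it is the transpose of an admissible \<open>W\<close>. Consistency of \<Gamma> thus settles order
  and signs. For the same reason limits are taken along a filter that asks only for measurable
  events on which a property holds, so that intermediate quantities need no measurability proof. The
  asymptotic variances are second moments of polynomials of degree four in the entries. A Hoeffding
  decomposition avoids expanding these squares: summands that depend on different sets of entries
  are orthogonal, and mixed terms survive only between the functions of the two entries of rows k
  and k' in one column.\<close>

lemma norm_sq_matrix: "(norm (A :: real^'n^'m))\<^sup>2 = (\<Sum>i\<in>UNIV. \<Sum>j\<in>UNIV. (A $ i $ j)\<^sup>2)"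
  by (simp add: norm_vec_def L2_set_def sum_nonneg real_sqrt_pow2)

lemma norm_transpose_real: "norm (transpose A) = norm (A :: real^'n^'m)"
proof -
  have "(norm (transpose A))\<^sup>2 = (norm A)\<^sup>2"
    unfolding norm_sq_matrix by (subst sum.swap) (simp add: transpose_def)
  then show ?thesis by simp
qed

lemma norm_matrix_vector_mult_le: "norm (A *v x) \<le> norm (A :: real^'n^'m) * norm x"
proof -
  have "(norm (A *v x))\<^sup>2 = (\<Sum>i\<in>UNIV. (A $ i \<bullet> x)\<^sup>2)"
    by (simp add: norm_vec_def L2_set_def sum_nonneg real_sqrt_pow2 matrix_vector_mult_def inner_vec_def)
  also have "\<dots> \<le> (\<Sum>i\<in>UNIV. (norm (A $ i))\<^sup>2 * (norm x)\<^sup>2)"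
    by (intro sum_mono) (metis Cauchy_Schwarz_ineq power2_norm_eq_inner)
  also have "\<dots> = (norm A * norm x)\<^sup>2"
    by (simp add: norm_vec_def[of A] L2_set_def sum_nonneg real_sqrt_pow2 sum_distrib_right power_mult_distrib)
  finally show ?thesis
    by (meson mult_nonneg_nonneg norm_ge_zero power2_le_imp_le)
qed

text \<open>Row i of A B is the transpose of B applied to row i of A, so the bound for matrix-vector
  products can be summed over the rows.\<close>

lemma norm_matrix_mult_le: "norm (A ** B) \<le> norm (A :: real^'n^'m) * norm (B :: real^'k^'n)"
proof -
  have row: "(A ** B) $ i = transpose B *v (A $ i)" for i
    by (simp add: vec_eq_iff matrix_matrix_mult_def matrix_vector_mult_def transpose_def mult.commute)
  have "(norm (A ** B))\<^sup>2 = (\<Sum>i\<in>UNIV. (norm (transpose B *v (A $ i)))\<^sup>2)"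
    by (simp add: norm_vec_def[of "A ** B"] L2_set_def sum_nonneg real_sqrt_pow2 row)
  also have "\<dots> \<le> (\<Sum>i\<in>UNIV. (norm B * norm (A $ i))\<^sup>2)"
    by (intro sum_mono power_mono) (metis norm_matrix_vector_mult_le norm_transpose_real, simp)
  also have "\<dots> = (norm A * norm B)\<^sup>2"
    by (simp add: norm_vec_def[of A] L2_set_def sum_nonneg real_sqrt_pow2 sum_distrib_left power_mult_distrib mult.commute)
  finally show ?thesis
    by (meson mult_nonneg_nonneg norm_ge_zero power2_le_imp_le)
qed

lemma matrix_sub_ldistrib: "A ** (B - C) = A ** B - A ** (C :: real^'k^'n)" for A :: "real^'n^'m"
  by (simp add: matrix_matrix_mult_def vec_eq_iff sum_subtractf right_diff_distrib)

lemma matrix_sub_rdistrib: "(A - B) ** C = A ** C - B ** (C :: real^'k^'n)" for A :: "real^'n^'m"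
  by (simp add: matrix_matrix_mult_def vec_eq_iff sum_subtractf left_diff_distrib)

lemma matrix_add_rdistrib: "(A + B) ** C = A ** C + B ** (C :: real^'k^'n)" for A :: "real^'n^'m"
  by (simp add: matrix_matrix_mult_def vec_eq_iff sum.distrib distrib_right)

lemma transpose_eq_iff: "transpose A = A \<longleftrightarrow> (\<forall>i j. A $ i $ j = A $ j $ i)"
  by (auto simp: transpose_def vec_eq_iff)

text \<open>By Cauchy-Schwarz the quadratic form of S - 1 is smaller in modulus than the squared
  norm of x, which is the quadratic form of the identity.\<close>

lemma pos_def_near_one:
  assumes "transpose S = S" "norm (S - mat 1 :: real^'n^'n) < 1"
  shows "pos_def S"
  unfolding pos_def_def
proof (intro conjI allI impI)
  fix x :: "real^'n" assume "x \<noteq> 0"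
  have "\<bar>x \<bullet> ((S - mat 1) *v x)\<bar> \<le> norm x * norm ((S - mat 1) *v x)"
    by (rule Cauchy_Schwarz_ineq2)
  also have "\<dots> \<le> norm (S - mat 1) * (norm x)\<^sup>2"
    using mult_left_mono[OF norm_matrix_vector_mult_le[of "S - mat 1" x], of "norm x"]
    by (simp add: power2_eq_square algebra_simps)
  also have "\<dots> < 1 * (norm x)\<^sup>2"
    using assms(2) \<open>x \<noteq> 0\<close> by (intro mult_strict_right_mono) auto
  finally show "0 < x \<bullet> (S *v x)"
    by (simp add: matrix_vector_mult_diff_rdistrib inner_diff_right power2_norm_eq_inner[symmetric] abs_less_iff)
qed fact

lemma pos_def_invertible: "pos_def S \<Longrightarrow> invertible S"
  unfolding pos_def_def invertible_left_inverse matrix_left_invertible_ker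
  by (metis inner_zero_right less_irrefl)

text \<open>If $R^2 = R'^2$ and $D = R - R'$ then $R D + D R' = 0$; tested on the columns and rows of $D$
  this is a vanishing sum of nonnegative quadratic forms.\<close>

lemma pos_def_sqrt_unique:
  fixes R R' :: "real^'n^'n"
  assumes "pos_def R" "pos_def R'" "R ** R = R' ** R'"
  shows "R = R'"
proof -
  define D where "D = R - R'"
  have sym: "transpose R = R" "transpose R' = R'" using assms by (auto simp: pos_def_def)
  have "R ** D + D ** R' = 0"
    unfolding D_def using assms(3) by (simp add: matrix_sub_ldistrib matrix_sub_rdistrib)
  then have z: "(R ** D + D ** R') $ i $ j = 0" for i j by simp
  have nn: "0 \<le> x \<bullet> (R *v x)" "0 \<le> x \<bullet> (R' *v x)" for x
    using assms(1,2) unfolding pos_def_def by (metis inner_zero_left less_eq_real_def)+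
  have "(\<Sum>i\<in>UNIV. \<Sum>j\<in>UNIV. D $ i $ j * (R ** D) $ i $ j) = (\<Sum>j\<in>UNIV. column j D \<bullet> (R *v column j D))"
    by (subst sum.swap) (simp add: inner_vec_def matrix_matrix_mult_def matrix_vector_mult_def column_def)
  moreover have "(\<Sum>i\<in>UNIV. \<Sum>j\<in>UNIV. D $ i $ j * (D ** R') $ i $ j) = (\<Sum>i\<in>UNIV. D $ i \<bullet> (R' *v (D $ i)))"
  proof -
    have "(D ** R') $ i $ j = (R' *v (D $ i)) $ j" for i j
    proof -
      have "R' $ k $ j = R' $ j $ k" for k
        using sym(2) unfolding transpose_eq_iff by blast
      then show ?thesis
        unfolding matrix_matrix_mult_def matrix_vector_mult_def by (simp add: mult.commute del: mult_cancel_right)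
    qed
    then show ?thesis by (simp add: inner_vec_def)
  qed
  moreover have "(\<Sum>i\<in>UNIV. \<Sum>j\<in>UNIV. D $ i $ j * (R ** D) $ i $ j) +
      (\<Sum>i\<in>UNIV. \<Sum>j\<in>UNIV. D $ i $ j * (D ** R') $ i $ j) = 0"
    using z by (simp add: sum.distrib[symmetric] distrib_left[symmetric])
  ultimately have "(\<Sum>j\<in>UNIV. column j D \<bullet> (R *v column j D)) + (\<Sum>i\<in>UNIV. D $ i \<bullet> (R' *v (D $ i))) = 0"
    by simp
  then have "(\<Sum>j\<in>UNIV. column j D \<bullet> (R *v column j D)) = 0"
    using sum_nonneg[of UNIV "\<lambda>j. column j D \<bullet> (R *v column j D)"]
      sum_nonneg[of UNIV "\<lambda>i. D $ i \<bullet> (R' *v (D $ i))"] nn by fastforce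
  then have "column j D \<bullet> (R *v column j D) = 0" for j
    using nn by (subst (asm) sum_nonneg_eq_0_iff) auto
  then have "column j D = 0" for j
    using assms(1) unfolding pos_def_def by (metis less_irrefl)
  then have "D = 0" by (simp add: vec_eq_iff column_def)
  then show ?thesis by (simp add: D_def)
qed

lemma inv_sqrt_eqI:
  assumes "pos_def R" "R ** R = matrix_inv S"
  shows "inv_sqrt S = R"
  unfolding inv_sqrt_def
proof (rule the_equality)
  fix R' assume "pos_def R' \<and> R' ** R' = matrix_inv S"
  then show "R' = R" using assms by (metis pos_def_sqrt_unique)
qed (use assms in blast)

text \<open>The equation says that 1 + H is a square root of 1 + E. It is the fixed point equation
  of H |-> (E - H H) / 2, and Banach's theorem applies on the symmetric matrices of norm at most
  1/2: the map stays there because (1/3 + 1/4) / 2 <= 1/2, and it contracts by the factor 1/2.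
  Symmetry of H comes from the closedness of that set.\<close>

lemma sqrt_near_one:
  fixes E :: "real^'n^'n"
  assumes "transpose E = E" "norm E \<le> 1/3"
  obtains H where "transpose H = H" "norm H \<le> 1/2" "H + H + H ** H = E"
proof -
  define s where "s = {H :: real^'n^'n. transpose H = H \<and> norm H \<le> 1/2}"
  define f where "f H = (1/2) *\<^sub>R (E - H ** H)" for H
  have "closed {H :: real^'n^'n. transpose H = H}"
    unfolding transpose_def by (intro closed_Collect_eq continuous_intros continuous_on_vec_lambda)
  moreover have "s = {H. transpose H = H} \<inter> cball 0 (1/2)"
    by (auto simp: s_def)
  ultimately have "Topological_Spaces.complete s" by (simp add: complete_eq_closed closed_Int)
  moreover have "s \<noteq> {}"
    by (auto simp: s_def transpose_def vec_eq_iff intro!: exI[of _ 0])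
  moreover have "f ` s \<subseteq> s"
  proof
    fix K assume "K \<in> f ` s"
    then obtain H where H: "H \<in> s" "K = f H" by auto
    have "norm (H ** H) \<le> 1/2 * (1/2)"
      using norm_matrix_mult_le[of H H] mult_mono[of "norm H" "1/2" "norm H" "1/2"] H by (auto simp: s_def)
    then have "norm (E - H ** H) \<le> 1/3 + 1/4" using assms(2) norm_triangle_ineq4[of E "H ** H"] by simp
    then have "norm K \<le> 1/2" by (simp add: H f_def)
    moreover have "transpose K = K"
    proof -
      have "transpose (H ** H) = H ** H" using H by (simp add: s_def matrix_transpose_mul)
      then show ?thesis using assms(1) by (simp add: transpose_eq_iff H f_def)
    qed
    ultimately show "K \<in> s" by (simp add: s_def)
  qed
  moreover have "dist (f H) (f K) \<le> 1/2 * dist H K" if "H \<in> s" "K \<in> s" for H K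
  proof -
    have "f H - f K = (1/2) *\<^sub>R (K ** (K - H) + (K - H) ** H)"
      by (simp add: f_def matrix_sub_ldistrib matrix_sub_rdistrib algebra_simps)
    then have "norm (f H - f K) \<le> 1/2 * (norm (K ** (K - H)) + norm ((K - H) ** H))"
      using norm_triangle_ineq[of "K ** (K - H)" "(K - H) ** H"] by simp
    also have "\<dots> \<le> 1/2 * (1/2 * norm (K - H) + norm (K - H) * (1/2))"
      using that by (intro mult_left_mono add_mono order_trans[OF norm_matrix_mult_le] mult_right_mono)
        (auto simp: s_def)
    finally show ?thesis by (simp add: dist_norm norm_minus_commute)
  qed
  ultimately obtain H where H: "H \<in> s" "f H = H"
    using Banach_fix[of s "1/2" f] by auto
  have "2 *\<^sub>R H = E - H ** H" using arg_cong[OF H(2), of "\<lambda>x. 2 *\<^sub>R x"] by (simp add: f_def)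
  then have "H + H + H ** H = E" by (simp add: scaleR_2 algebra_simps)
  with H show ?thesis by (intro that) (auto simp: s_def)
qed

lemma inv_sqrt_near_one:
  fixes S :: "real^'n^'n"
  assumes sym: "transpose S = S" and near: "norm (S - mat 1) \<le> 1/4"
  shows "pos_def S"
    and "inv_sqrt S ** (inv_sqrt S ** S) = mat 1"
    and "norm (inv_sqrt S - mat 1) \<le> norm (S - mat 1)"
    and "norm (inv_sqrt S - mat 1 + (1/2) *\<^sub>R (S - mat 1)) \<le> 2 * (norm (S - mat 1))\<^sup>2"
proof -
  define E where "E = S - mat 1"
  show pd: "pos_def S" using assms by (intro pos_def_near_one) auto
  define P where "P = matrix_inv S"
  have inv: "S ** P = mat 1" "P ** S = mat 1"
    using someI_ex[OF pos_def_invertible[OF pd, unfolded invertible_def]] by (auto simp: P_def matrix_inv_def)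
  have symP: "transpose P = P"
  proof -
    have "transpose P ** S = mat 1"
      using arg_cong[OF inv(1), of transpose] by (simp add: matrix_transpose_mul sym)
    then show ?thesis by (metis inv(1) matrix_mul_assoc matrix_mul_lid matrix_mul_rid)
  qed
  define F where "F = P - mat 1"
  have symF: "transpose F = F"
    using symP unfolding F_def by (simp add: transpose_eq_iff mat_def)
  have FE: "F + E = - (F ** E)"
    unfolding F_def E_def using inv by (simp add: matrix_sub_ldistrib matrix_sub_rdistrib)
  have "F = - (F ** E) - E" using FE by (simp add: algebra_simps)
  then have "norm F \<le> norm (F ** E) + norm E" by (metis norm_minus_cancel norm_triangle_ineq4)
  also have "norm (F ** E) \<le> norm F * (1/4)"
    by (intro order_trans[OF norm_matrix_mult_le] mult_left_mono) (use near in \<open>auto simp: E_def\<close>)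
  finally have nF: "norm F \<le> 4/3 * norm E" by simp
  then have "norm F \<le> 1/3" using near by (simp add: E_def)
  then obtain H where H: "transpose H = H" "norm H \<le> 1/2" "H + H + H ** H = F"
    using sqrt_near_one[OF symF] by blast
  define R where "R = mat 1 + H"
  have RR: "R ** R = P"
  proof -
    have "R ** R = mat 1 + (H + H + H ** H)"
      by (simp add: R_def matrix_add_ldistrib matrix_add_rdistrib)
    then show ?thesis unfolding H(3) F_def by simp
  qed
  have "transpose R = R"
    using H(1) unfolding R_def by (simp add: transpose_eq_iff mat_def)
  then have "pos_def R" using H(2) by (intro pos_def_near_one) (auto simp: R_def)
  then have R: "inv_sqrt S = R" using RR by (intro inv_sqrt_eqI) (auto simp: P_def)
  show "inv_sqrt S ** (inv_sqrt S ** S) = mat 1"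
    using RR inv by (simp add: R matrix_mul_assoc)
  have HH: "norm (H ** H) \<le> norm H * norm H" by (rule norm_matrix_mult_le)
  have H2: "2 *\<^sub>R H = F - H ** H" using H(3) by (simp add: scaleR_2 algebra_simps)
  have "2 * norm H = norm (2 *\<^sub>R H)" by simp
  also have "\<dots> \<le> norm F + norm (H ** H)"
    unfolding H2 by (rule norm_triangle_ineq4)
  also have "norm (H ** H) \<le> norm H * (1/2)"
    using HH H(2) mult_left_mono[OF H(2), of "norm H"] by simp
  finally have nH: "norm H \<le> norm E" using nF norm_ge_zero[of E] by linarith
  then show "norm (inv_sqrt S - mat 1) \<le> norm (S - mat 1)" by (simp add: R R_def E_def)
  have "2 *\<^sub>R (H + (1/2) *\<^sub>R E) = (F + E) - H ** H" using H2 by (simp add: scaleR_add_right)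
  then have "2 * norm (H + (1/2) *\<^sub>R E) = norm ((F + E) - H ** H)"
    by (metis norm_scaleR abs_numeral)
  also have "\<dots> \<le> norm (F ** E) + norm (H ** H)"
    unfolding FE by (metis norm_minus_cancel norm_triangle_ineq4)
  also have "\<dots> \<le> norm F * norm E + norm H * norm H"
    using norm_matrix_mult_le[of F E] HH by simp
  also have "\<dots> \<le> (4/3 * norm E) * norm E + norm E * norm E"
    using nF nH by (intro add_mono mult_mono) auto
  finally have "norm (H + (1/2) *\<^sub>R E) \<le> 2 * (norm E * norm E)"
    using zero_le_square[of "norm E"] by linarith
  then show "norm (inv_sqrt S - mat 1 + (1/2) *\<^sub>R (S - mat 1)) \<le> 2 * (norm (S - mat 1))\<^sup>2"
    unfolding R R_def E_def[symmetric] power2_eq_square by simp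
qed

section \<open>Convergence in probability and asymptotic linearity\<close>

text \<open>The property P is controlled from inside by a measurable event, so P itself may be
  non-measurable. The exceptional probability is a parameter because the bounds in
  \<open>tight_seq\<close> depend on it.\<close>

definition eventually_up_to :: "'a measure \<Rightarrow> real \<Rightarrow> (nat \<times> 'a \<Rightarrow> bool) \<Rightarrow> bool" where
  "eventually_up_to M \<eta> P \<longleftrightarrow> (\<forall>\<^sub>F n in sequentially.
     \<exists>E\<in>sets M. measure M (space M - E) \<le> \<eta> \<and> (\<forall>x\<in>E. P (n, x)))"

text \<open>The filter of properties whose probability tends to 1: convergence in probability is
  convergence along it, so the calculus of limits and continuous mappings applies.\<close>

definition in_prob :: "'a measure \<Rightarrow> (nat \<times> 'a) filter" where
  "in_prob M = Abs_filter (\<lambda>P. \<forall>\<eta>>0. eventually_up_to M \<eta> P)"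

text \<open>Boundedness in probability, O_P(1). The bound K may depend on \<eta>, hence this is not
  one property that holds eventually along \<open>in_prob\<close>.\<close>

definition tight_seq :: "'a measure \<Rightarrow> (nat \<times> 'a \<Rightarrow> real) \<Rightarrow> bool" where
  "tight_seq M f \<longleftrightarrow> (\<forall>\<eta>>0. \<exists>K. eventually_up_to M \<eta> (\<lambda>w. \<bar>f w\<bar> \<le> K))"

lemma eventually_up_to_mono:
  assumes "eventually_up_to M \<eta> P" "\<And>w. P w \<Longrightarrow> Q w"
  shows "eventually_up_to M \<eta> Q"
  using assms(1) unfolding eventually_up_to_def by (rule eventually_mono) (use assms(2) in blast)

context prob_space
begin

lemma eventually_up_to_sequentially:
  assumes "eventually (\<lambda>n. \<forall>x\<in>space M. P (n, x)) sequentially" "0 < \<eta>"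
  shows "eventually_up_to M \<eta> P"
  unfolding eventually_up_to_def
  using assms(1) by (rule eventually_mono) (use assms(2) in \<open>auto intro!: bexI[of _ "space M"]\<close>)

text \<open>Exceptional probabilities add by the union bound; halving \<eta> then turns this into
  the intersection law of the filter \<open>in_prob\<close>.\<close>

lemma eventually_up_to_conj:
  assumes "eventually_up_to M a P" "eventually_up_to M b Q"
  shows "eventually_up_to M (a + b) (\<lambda>w. P w \<and> Q w)"
  using assms unfolding eventually_up_to_def
proof eventually_elim
  case (elim n)
  then obtain E F where EF: "E \<in> sets M" "F \<in> sets M" "prob (space M - E) \<le> a" "prob (space M - F) \<le> b"
    "\<forall>x\<in>E. P (n, x)" "\<forall>x\<in>F. Q (n, x)" by blast
  have "prob (space M - E \<inter> F) \<le> prob ((space M - E) \<union> (space M - F))"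
    using EF by (intro finite_measure_mono) auto
  also have "\<dots> \<le> prob (space M - E) + prob (space M - F)"
    using EF by (intro measure_Un_le) auto
  finally show ?case using EF by (intro bexI[of _ "E \<inter> F"]) auto
qed

lemma eventually_in_prob:
  "eventually P (in_prob M) \<longleftrightarrow> (\<forall>\<eta>>0. eventually_up_to M \<eta> P)"
  unfolding in_prob_def
proof (rule eventually_Abs_filter, rule is_filter.intro, goal_cases)
  case 1
  show ?case by (simp add: eventually_up_to_sequentially)
next
  case (2 P Q)
  show ?case
  proof (intro allI impI)
    fix \<eta> :: real assume "0 < \<eta>"
    then show "eventually_up_to M \<eta> (\<lambda>w. P w \<and> Q w)"
      using 2 eventually_up_to_conj[of "\<eta>/2" P "\<eta>/2" Q] by simp
  qed
next
  case (3 P Q)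
  then show ?case using eventually_up_to_mono by blast
qed

lemma eventually_in_prob_sequentially:
  assumes "eventually P sequentially"
  shows "\<forall>\<^sub>F w in in_prob M. P (fst w)"
  unfolding eventually_in_prob
  using assms by (auto intro!: eventually_up_to_sequentially elim: eventually_mono)

lemma eventually_in_prob_AE:
  assumes "\<And>n. AE x in M. P n x"
  shows "\<forall>\<^sub>F w in in_prob M. P (fst w) (snd w)"
  unfolding eventually_in_prob eventually_up_to_def
proof (intro allI impI always_eventually)
  fix \<eta> :: real and n :: nat assume "0 < \<eta>"
  obtain N where N: "{x \<in> space M. \<not> P n x} \<subseteq> N" "emeasure M N = 0" "N \<in> sets M"
    using AE_E[OF assms[of n]] by metis
  then have "prob N = 0" by (simp add: measure_def)
  moreover have "space M - (space M - N) = N" using N sets.sets_into_space by fastforce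
  ultimately show "\<exists>E\<in>sets M. prob (space M - E) \<le> \<eta> \<and> (\<forall>x\<in>E. P (fst (n, x)) (snd (n, x)))"
    using N \<open>0 < \<eta>\<close> by (intro bexI[of _ "space M - N"]) auto
qed

lemma tendsto_in_probI:
  fixes f :: "nat \<Rightarrow> 'a \<Rightarrow> 'b :: {second_countable_topology, metric_space}"
  assumes "conv_in_prob M f c" and [measurable]: "\<And>n. f n \<in> borel_measurable M"
  shows "((\<lambda>w. f (fst w) (snd w)) \<longlongrightarrow> c) (in_prob M)"
  unfolding tendsto_iff eventually_in_prob eventually_up_to_def
proof (intro allI impI)
  fix e \<eta> :: real assume "0 < e" "0 < \<eta>"
  \<comment> \<open>The radius is halved because the complement of this event gives only a
    non-strict inequality, whereas the filter limit asks for a distance strictly below e.\<close>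
  have "(\<lambda>n. prob {x \<in> space M. dist (f n x) c > e/2}) \<longlonglongrightarrow> 0"
    using assms(1) \<open>0 < e\<close> unfolding conv_in_prob_def by (meson half_gt_zero)
  then have "\<forall>\<^sub>F n in sequentially. prob {x \<in> space M. dist (f n x) c > e/2} < \<eta>"
    using \<open>0 < \<eta>\<close> by (rule order_tendstoD)
  then show "\<forall>\<^sub>F n in sequentially. \<exists>E\<in>sets M. prob (space M - E) \<le> \<eta> \<and>
      (\<forall>x\<in>E. dist (f (fst (n, x)) (snd (n, x))) c < e)"
  proof eventually_elim
    case (elim n)
    have "space M - {x\<in>space M. dist (f n x) c \<le> e/2} = {x \<in> space M. dist (f n x) c > e/2}"
      by auto
    then show ?case using elim \<open>0 < e\<close>
      by (intro bexI[of _ "{x\<in>space M. dist (f n x) c \<le> e/2}"]) auto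
  qed
qed

text \<open>Slutsky's rule O_P(1) o_P(1) = o_P(1), the source of nearly all negligible remainders
  below. Half of \<eta> is spent on bounding f, half on making g small relative to that
  bound.\<close>

lemma tight_mult_tendsto_0:
  assumes f: "tight_seq M f" and g: "(g \<longlongrightarrow> 0) (in_prob M)"
  shows "((\<lambda>w. f w * g w) \<longlongrightarrow> (0::real)) (in_prob M)"
  unfolding tendsto_iff eventually_in_prob
proof (intro allI impI)
  fix e \<eta> :: real assume e: "0 < e" and "0 < \<eta>"
  then have \<eta>: "0 < \<eta>/2" by simp
  then obtain K where K: "eventually_up_to M (\<eta>/2) (\<lambda>w. \<bar>f w\<bar> \<le> K)"
    using f unfolding tight_seq_def by blast
  \<comment> \<open>1 + |K| is a positive bound even if K is zero or negative.\<close>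
  have "0 < e / (1 + \<bar>K\<bar>)" using e by simp
  then have "eventually_up_to M (\<eta>/2) (\<lambda>w. dist (g w) 0 < e / (1 + \<bar>K\<bar>))"
    using g \<eta> unfolding tendsto_iff eventually_in_prob by blast
  from eventually_up_to_conj[OF K this]
  have "eventually_up_to M \<eta> (\<lambda>w. \<bar>f w\<bar> \<le> K \<and> dist (g w) 0 < e / (1 + \<bar>K\<bar>))" by simp
  then show "eventually_up_to M \<eta> (\<lambda>w. dist (f w * g w) 0 < e)"
  proof (rule eventually_up_to_mono)
    fix w assume *: "\<bar>f w\<bar> \<le> K \<and> dist (g w) 0 < e / (1 + \<bar>K\<bar>)"
    then have "\<bar>f w\<bar> * \<bar>g w\<bar> \<le> (1 + \<bar>K\<bar>) * \<bar>g w\<bar>" by (intro mult_right_mono) auto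
    also have "\<dots> < (1 + \<bar>K\<bar>) * (e / (1 + \<bar>K\<bar>))" using * by (intro mult_strict_left_mono) auto
    finally show "dist (f w * g w) 0 < e" by (simp add: abs_mult)
  qed
qed

lemma tight_seq_close:
  assumes f: "tight_seq M f" and g: "((\<lambda>w. g w - f w) \<longlongrightarrow> (0::real)) (in_prob M)"
  shows "tight_seq M g"
  unfolding tight_seq_def
proof (intro allI impI)
  fix \<eta> :: real assume "0 < \<eta>"
  then have \<eta>: "0 < \<eta>/2" by simp
  then obtain K where K: "eventually_up_to M (\<eta>/2) (\<lambda>w. \<bar>f w\<bar> \<le> K)"
    using f unfolding tight_seq_def by blast
  have "eventually_up_to M (\<eta>/2) (\<lambda>w. dist (g w - f w) 0 < 1)"
    using g \<eta> zero_less_one unfolding tendsto_iff eventually_in_prob by blast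
  from eventually_up_to_conj[OF K this]
  have "eventually_up_to M \<eta> (\<lambda>w. \<bar>f w\<bar> \<le> K \<and> dist (g w - f w) 0 < 1)" by simp
  then have "eventually_up_to M \<eta> (\<lambda>w. \<bar>g w\<bar> \<le> K + 1)"
    by (rule eventually_up_to_mono) auto
  then show "\<exists>K. eventually_up_to M \<eta> (\<lambda>w. \<bar>g w\<bar> \<le> K)" ..
qed

lemma tight_seq_abs_add:
  assumes "tight_seq M f" "tight_seq M g"
  shows "tight_seq M (\<lambda>w. \<bar>f w\<bar> + \<bar>g w\<bar>)"
  unfolding tight_seq_def
proof (intro allI impI)
  fix \<eta> :: real assume "0 < \<eta>"
  then have \<eta>: "0 < \<eta>/2" by simp
  obtain K L where "eventually_up_to M (\<eta>/2) (\<lambda>w. \<bar>f w\<bar> \<le> K)" "eventually_up_to M (\<eta>/2) (\<lambda>w. \<bar>g w\<bar> \<le> L)"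
    using assms \<eta> unfolding tight_seq_def by meson
  from eventually_up_to_conj[OF this]
  have "eventually_up_to M \<eta> (\<lambda>w. \<bar>f w\<bar> \<le> K \<and> \<bar>g w\<bar> \<le> L)" by simp
  then have "eventually_up_to M \<eta> (\<lambda>w. \<bar>\<bar>f w\<bar> + \<bar>g w\<bar>\<bar> \<le> K + L)"
    by (rule eventually_up_to_mono) auto
  then show "\<exists>K. eventually_up_to M \<eta> (\<lambda>w. \<bar>\<bar>f w\<bar> + \<bar>g w\<bar>\<bar> \<le> K)" ..
qed

lemma tight_seq_sum_abs:
  assumes "finite I" "\<And>i. i \<in> I \<Longrightarrow> tight_seq M (f i)"
  shows "tight_seq M (\<lambda>w. \<Sum>i\<in>I. \<bar>f i w\<bar>)"
  using assms
proof (induction I)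
  case empty
  show ?case unfolding tight_seq_def by (auto intro!: exI[of _ 0] eventually_up_to_sequentially)
next
  case (insert i I)
  then have "tight_seq M (\<lambda>w. \<bar>f i w\<bar> + \<bar>\<Sum>i\<in>I. \<bar>f i w\<bar>\<bar>)"
    by (intro tight_seq_abs_add) auto
  then show ?case using insert.hyps by (simp add: sum_nonneg)
qed

lemma tight_seq_mono:
  assumes "tight_seq M g" "\<And>w. \<bar>f w\<bar> \<le> \<bar>g w\<bar>"
  shows "tight_seq M f"
  unfolding tight_seq_def
proof (intro allI impI)
  fix \<eta> :: real assume "0 < \<eta>"
  then obtain K where "eventually_up_to M \<eta> (\<lambda>w. \<bar>g w\<bar> \<le> K)"
    using assms(1) unfolding tight_seq_def by blast
  then have "eventually_up_to M \<eta> (\<lambda>w. \<bar>f w\<bar> \<le> K)"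
    by (rule eventually_up_to_mono) (rule order_trans[OF assms(2)])
  then show "\<exists>K. eventually_up_to M \<eta> (\<lambda>w. \<bar>f w\<bar> \<le> K)" ..
qed

end

section \<open>Averages over an i.i.d. sample\<close>

locale iid_sample = prob_space M for M :: "'a measure" +
  fixes Z :: "'a \<Rightarrow> 'b :: {second_countable_topology, t2_space}" and Zs :: "nat \<Rightarrow> 'a \<Rightarrow> 'b"
  assumes Z_measurable [measurable]: "Z \<in> borel_measurable M"
    and indep: "indep_vars (\<lambda>_. borel) Zs UNIV"
    and distr_eq: "distr M borel (Zs i) = distr M borel Z"
begin

lemma Zs_measurable [measurable]: "Zs i \<in> borel_measurable M"
  using indep by (auto simp: indep_vars_def)

definition avg :: "('b \<Rightarrow> real) \<Rightarrow> nat \<times> 'a \<Rightarrow> real" where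
  "avg g = (\<lambda>(n, x). (\<Sum>i<n. g (Zs i x)) / real n)"

definition L2_fun :: "('b \<Rightarrow> real) \<Rightarrow> bool" where
  "L2_fun g \<longleftrightarrow> g \<in> borel_measurable borel \<and> integrable M (\<lambda>x. (g (Z x))\<^sup>2)"

definition influence :: "('b \<Rightarrow> real) \<Rightarrow> bool" where
  "influence g \<longleftrightarrow> L2_fun g \<and> expectation (\<lambda>x. g (Z x)) = 0"

definition asym_linear :: "(nat \<times> 'a \<Rightarrow> real) \<Rightarrow> real \<Rightarrow> ('b \<Rightarrow> real) \<Rightarrow> bool" where
  "asym_linear f c g \<longleftrightarrow> influence g \<and>
     ((\<lambda>w. sqrt (fst w) * (f w - c - avg g w)) \<longlongrightarrow> 0) (in_prob M)"

lemma avg_add: "avg (\<lambda>z. g z + h z) w = avg g w + avg h w"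
  by (simp add: avg_def split_beta sum.distrib add_divide_distrib)

lemma avg_cmult: "avg (\<lambda>z. c * g z) w = c * avg g w"
  by (simp add: avg_def split_beta sum_distrib_left)

lemma avg_diff: "avg (\<lambda>z. g z - h z) w = avg g w - avg h w"
  by (simp add: avg_def split_beta sum_subtractf diff_divide_distrib)

lemma avg_0: "avg (\<lambda>z. 0) w = 0"
  by (simp add: avg_def split_beta)

lemma L2_fun_integrable:
  assumes "L2_fun g"
  shows "integrable M (\<lambda>x. g (Z x))"
  using assms by (auto simp: L2_fun_def intro: square_integrable_imp_integrable[rotated])

lemma L2_fun_mult_integrable:
  assumes "L2_fun g" "L2_fun h"
  shows "integrable M (\<lambda>x. g (Z x) * h (Z x))"
proof (rule Bochner_Integration.integrable_bound)
  have [measurable]: "g \<in> borel_measurable borel" "h \<in> borel_measurable borel"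
    using assms by (auto simp: L2_fun_def)
  show "integrable M (\<lambda>x. (g (Z x))\<^sup>2 + (h (Z x))\<^sup>2)" using assms by (auto simp: L2_fun_def)
  show "AE x in M. norm (g (Z x) * h (Z x)) \<le> norm ((g (Z x))\<^sup>2 + (h (Z x))\<^sup>2)"
  proof (intro AE_I2)
    fix x
    have "2 * (\<bar>g (Z x)\<bar> * \<bar>h (Z x)\<bar>) \<le> (g (Z x))\<^sup>2 + (h (Z x))\<^sup>2"
      using sum_squares_bound[of "\<bar>g (Z x)\<bar>" "\<bar>h (Z x)\<bar>"] by simp
    moreover have "0 \<le> \<bar>g (Z x)\<bar> * \<bar>h (Z x)\<bar>" by simp
    ultimately have "\<bar>g (Z x)\<bar> * \<bar>h (Z x)\<bar> \<le> (g (Z x))\<^sup>2 + (h (Z x))\<^sup>2" by linarith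
    then show "norm (g (Z x) * h (Z x)) \<le> norm ((g (Z x))\<^sup>2 + (h (Z x))\<^sup>2)"
      by (simp add: abs_mult)
  qed
qed (use assms in \<open>auto simp: L2_fun_def\<close>)

lemma L2_fun_const [simp]: "L2_fun (\<lambda>z. c)"
  by (simp add: L2_fun_def)

lemma L2_fun_add:
  assumes "L2_fun g" "L2_fun h"
  shows "L2_fun (\<lambda>z. g z + h z)"
  using assms L2_fun_mult_integrable[OF assms]
  by (auto simp: L2_fun_def power2_sum mult.assoc)

lemma L2_fun_cmult: "L2_fun g \<Longrightarrow> L2_fun (\<lambda>z. c * g z)"
  by (auto simp: L2_fun_def power_mult_distrib)

lemma L2_fun_diff: "L2_fun g \<Longrightarrow> L2_fun h \<Longrightarrow> L2_fun (\<lambda>z. g z - h z)"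
  using L2_fun_add[OF _ L2_fun_cmult[of h "-1"]] by simp

lemma L2_fun_sum: "(\<And>i. i \<in> I \<Longrightarrow> L2_fun (g i)) \<Longrightarrow> L2_fun (\<lambda>z. \<Sum>i\<in>I. g i z)"
  by (induction I rule: infinite_finite_induct) (auto intro: L2_fun_add)

lemma influence_L2: "influence g \<Longrightarrow> L2_fun g"
  by (simp add: influence_def)

lemma influence_0 [simp]: "influence (\<lambda>z. 0)"
  by (simp add: influence_def)

lemma influence_add: "influence g \<Longrightarrow> influence h \<Longrightarrow> influence (\<lambda>z. g z + h z)"
  by (auto simp: influence_def L2_fun_add L2_fun_integrable)

lemma influence_cmult: "influence g \<Longrightarrow> influence (\<lambda>z. c * g z)"
  by (auto simp: influence_def L2_fun_cmult)

lemma influence_sum: "(\<And>i. i \<in> I \<Longrightarrow> influence (g i)) \<Longrightarrow> influence (\<lambda>z. \<Sum>i\<in>I. g i z)"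
  by (induction I rule: infinite_finite_induct) (auto intro: influence_add)

lemma influence_centered: "L2_fun g \<Longrightarrow> influence (\<lambda>z. g z - expectation (\<lambda>x. g (Z x)))"
  by (auto simp: influence_def L2_fun_diff L2_fun_integrable prob_space)

lemma integrable_Zs_iff: "g \<in> borel_measurable borel \<Longrightarrow> integrable M (\<lambda>x. g (Zs i x)) \<longleftrightarrow> integrable M (\<lambda>x. g (Z x))"
  for g :: "'b \<Rightarrow> real"
  using integrable_distr_eq[of "Zs i" M borel g] integrable_distr_eq[of Z M borel g] by (simp add: distr_eq)

lemma expectation_Zs: "g \<in> borel_measurable borel \<Longrightarrow> expectation (\<lambda>x. g (Zs i x)) = expectation (\<lambda>x. g (Z x))"
  for g :: "'b \<Rightarrow> real"
  using integral_distr[of "Zs i" M borel g] integral_distr[of Z M borel g] by (simp add: distr_eq)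

text \<open>Independence and centering remove the mixed terms of the double sum and leave n copies
  of the second moment.\<close>

lemma
  assumes "influence g"
  shows integrable_sum_sq: "integrable M (\<lambda>x. (\<Sum>i<n. g (Zs i x))\<^sup>2)"
    and expectation_sum_sq:
      "expectation (\<lambda>x. (\<Sum>i<n. g (Zs i x))\<^sup>2) = real n * expectation (\<lambda>x. (g (Z x))\<^sup>2)"
proof -
  have g [measurable]: "g \<in> borel_measurable borel" and sq: "integrable M (\<lambda>x. (g (Z x))\<^sup>2)"
    and L2: "L2_fun g" and E0: "expectation (\<lambda>x. g (Z x)) = 0"
    using assms by (auto simp: influence_def L2_fun_def)
  have iv: "indep_vars (\<lambda>_. borel) (\<lambda>i x. g (Zs i x)) UNIV"
    by (rule indep_vars_compose2[OF indep]) simp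
  have int: "integrable M (\<lambda>x. g (Zs i x))" for i
    using L2_fun_integrable[OF L2] integrable_Zs_iff[OF g] by blast
  have sqi: "integrable M (\<lambda>x. (g (Zs i x))\<^sup>2)" "expectation (\<lambda>x. (g (Zs i x))\<^sup>2) = expectation (\<lambda>x. (g (Z x))\<^sup>2)" for i
    using sq integrable_Zs_iff[of "\<lambda>z. (g z)\<^sup>2"] expectation_Zs[of "\<lambda>z. (g z)\<^sup>2"] by auto
  have pair: "integrable M (\<lambda>x. g (Zs i x) * g (Zs j x))"
    "expectation (\<lambda>x. g (Zs i x) * g (Zs j x)) = (if i = j then expectation (\<lambda>x. (g (Z x))\<^sup>2) else 0)" for i j
  proof -
    have "integrable M (\<lambda>x. g (Zs i x) * g (Zs j x)) \<and>
      expectation (\<lambda>x. g (Zs i x) * g (Zs j x)) = (if i = j then expectation (\<lambda>x. (g (Z x))\<^sup>2) else 0)"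
    proof (cases "i = j")
      case True then show ?thesis using sqi by (simp add: power2_eq_square)
    next
      case False
      have iv2: "indep_vars (\<lambda>_. borel) (\<lambda>i x. g (Zs i x)) {i, j}"
        using indep_vars_subset[OF iv] by auto
      show ?thesis
        using indep_vars_integrable[OF _ iv2] indep_vars_lebesgue_integral[OF _ iv2] False int E0 expectation_Zs[OF g]
        by auto
    qed
    then show "integrable M (\<lambda>x. g (Zs i x) * g (Zs j x))"
    "expectation (\<lambda>x. g (Zs i x) * g (Zs j x)) = (if i = j then expectation (\<lambda>x. (g (Z x))\<^sup>2) else 0)" by auto
  qed
  have eq: "(\<Sum>i<n. g (Zs i x))\<^sup>2 = (\<Sum>i<n. \<Sum>j<n. g (Zs i x) * g (Zs j x))" for x
    by (simp add: power2_eq_square sum_product)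
  show "integrable M (\<lambda>x. (\<Sum>i<n. g (Zs i x))\<^sup>2)"
    unfolding eq by (intro Bochner_Integration.integrable_sum pair)
  show "expectation (\<lambda>x. (\<Sum>i<n. g (Zs i x))\<^sup>2) = real n * expectation (\<lambda>x. (g (Z x))\<^sup>2)"
    unfolding eq using pair by (simp add: Bochner_Integration.integral_sum)
qed

text \<open>Chebyshev's inequality: for n > 0 the second moment of sqrt n times the average is V,
  whatever n is, so one K serves all sample sizes.\<close>

lemma tight_avg:
  assumes "influence g"
  shows "tight_seq M (\<lambda>w. sqrt (fst w) * avg g w)"
  unfolding tight_seq_def
proof (intro allI impI)
  fix \<eta> :: real assume \<eta>: "0 < \<eta>"
  define V where "V = expectation (\<lambda>x. (g (Z x))\<^sup>2)"
  have V: "0 \<le> V" by (simp add: V_def)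
  \<comment> \<open>V + 1 in place of V keeps K positive when g vanishes almost surely, and V
    divided by the square of K is still at most \<eta>.\<close>
  define K where "K = sqrt ((V + 1) / \<eta>)"
  have K: "0 < K" "K\<^sup>2 = (V + 1) / \<eta>" using V \<eta> by (auto simp: K_def)
  have [measurable]: "g \<in> borel_measurable borel" using assms by (auto simp: influence_def L2_fun_def)
  have "\<forall>\<^sub>F n in sequentially. 0 < n" by (rule eventually_gt_at_top)
  then have "eventually_up_to M \<eta> (\<lambda>w. \<bar>sqrt (fst w) * avg g w\<bar> \<le> K)"
    unfolding eventually_up_to_def
  proof eventually_elim
    case (elim n)
    let ?f = "\<lambda>x. sqrt n * avg g (n, x)"
    have f2: "(?f x)\<^sup>2 = (\<Sum>i<n. g (Zs i x))\<^sup>2 / n" for x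
      using elim by (simp add: avg_def power_mult_distrib power_divide) (simp add: power2_eq_square)
    have [measurable]: "?f \<in> borel_measurable M" by (simp add: avg_def)
    have "\<P>(x in M. (?f x)\<^sup>2 \<ge> K\<^sup>2) \<le> expectation (\<lambda>x. (?f x)\<^sup>2) / K\<^sup>2"
      using zero_less_power[OF K(1), of 2] integrable_sum_sq[OF assms]
      by (intro integral_Markov_inequality_measure[where A="{}"]) (auto simp: f2)
    also have "expectation (\<lambda>x. (?f x)\<^sup>2) = V"
      using elim by (simp add: f2 expectation_sum_sq[OF assms] V_def)
    also have "V / K\<^sup>2 \<le> \<eta>" using \<eta> V unfolding K(2) by (simp add: divide_simps mult_left_mono)
    finally have P: "\<P>(x in M. (?f x)\<^sup>2 \<ge> K\<^sup>2) \<le> \<eta>" .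
    have "prob (space M - {x\<in>space M. \<bar>?f x\<bar> \<le> K}) \<le> \<P>(x in M. (?f x)\<^sup>2 \<ge> K\<^sup>2)"
    proof (rule finite_measure_mono)
      show "space M - {x \<in> space M. \<bar>?f x\<bar> \<le> K} \<subseteq> {x \<in> space M. (?f x)\<^sup>2 \<ge> K\<^sup>2}"
        using K(1) power_mono[of K "\<bar>_\<bar>" 2] by force
    qed measurable
    then show ?case using P by (intro bexI[of _ "{x\<in>space M. \<bar>?f x\<bar> \<le> K}"]) auto
  qed
  then show "\<exists>K. eventually_up_to M \<eta> (\<lambda>w. \<bar>sqrt (fst w) * avg g w\<bar> \<le> K)" ..
qed

section \<open>Calculus of asymptotically linear sequences\<close>

lemma asym_linear_influence: "asym_linear f c g \<Longrightarrow> influence g"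
  by (simp add: asym_linear_def)

lemma asym_linear_tight:
  assumes "asym_linear f c g"
  shows "tight_seq M (\<lambda>w. sqrt (fst w) * (f w - c))"
  using assms by (intro tight_seq_close[OF tight_avg[of g]]) (auto simp: asym_linear_def algebra_simps)

lemma tendsto_inverse_sqrt_in_prob: "((\<lambda>w. 1 / sqrt (real (fst w))) \<longlongrightarrow> 0) (in_prob M)"
proof -
  have "((\<lambda>n. 1 / sqrt (real n)) \<longlongrightarrow> 0) sequentially" by real_asymp
  moreover have "filterlim fst sequentially (in_prob M)"
    unfolding filterlim_iff using eventually_in_prob_sequentially by auto
  ultimately show ?thesis by (rule filterlim_compose)
qed

lemma in_prob_pos: "\<forall>\<^sub>F w in in_prob M. 0 < fst w"
  by (rule eventually_in_prob_sequentially) (rule eventually_gt_at_top)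

text \<open>The deviation from c is an O_P(1) term multiplied by 1 / sqrt n.\<close>

lemma asym_linear_tendsto:
  assumes "asym_linear f c g"
  shows "(f \<longlongrightarrow> c) (in_prob M)"
proof -
  have "((\<lambda>w. sqrt (fst w) * (f w - c) * (1 / sqrt (real (fst w)))) \<longlongrightarrow> 0) (in_prob M)"
    by (intro tight_mult_tendsto_0 asym_linear_tight[OF assms] tendsto_inverse_sqrt_in_prob)
  then have "((\<lambda>w. f w - c) \<longlongrightarrow> 0) (in_prob M)"
    by (rule Lim_transform_eventually) (use in_prob_pos in eventually_elim, auto)
  then show ?thesis by (rule LIM_zero_cancel)
qed

lemma asym_linear_close:
  assumes "asym_linear f c g" "((\<lambda>w. sqrt (fst w) * (f' w - f w)) \<longlongrightarrow> 0) (in_prob M)"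
  shows "asym_linear f' c g"
  using assms tendsto_add[of "\<lambda>w. sqrt (fst w) * (f w - c - avg g w)" 0 "in_prob M", OF _ assms(2)]
  by (auto simp: asym_linear_def algebra_simps)

lemma asym_linear_cong:
  assumes "asym_linear f c g" "\<forall>\<^sub>F w in in_prob M. f' w = f w"
  shows "asym_linear f' c g"
  using assms(2) by (intro asym_linear_close[OF assms(1)] tendsto_eventually) (auto elim: eventually_mono)

lemma asym_linear_const: "asym_linear (\<lambda>w. c) c (\<lambda>z. 0)"
  by (simp add: asym_linear_def avg_0)

lemma asym_linear_add:
  assumes "asym_linear f c g" "asym_linear f' c' g'"
  shows "asym_linear (\<lambda>w. f w + f' w) (c + c') (\<lambda>z. g z + g' z)"
  using assms tendsto_add[of "\<lambda>w. sqrt (fst w) * (f w - c - avg g w)" 0 "in_prob M"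
      "\<lambda>w. sqrt (fst w) * (f' w - c' - avg g' w)" 0]
  by (auto simp: asym_linear_def algebra_simps avg_add influence_add)

lemma asym_linear_sum:
  assumes "\<And>i. i \<in> I \<Longrightarrow> asym_linear (f i) (c i) (g i)"
  shows "asym_linear (\<lambda>w. \<Sum>i\<in>I. f i w) (\<Sum>i\<in>I. c i) (\<lambda>z. \<Sum>i\<in>I. g i z)"
  using assms by (induction I rule: infinite_finite_induct) (auto intro: asym_linear_add asym_linear_const)

lemma asym_linear_cmult:
  assumes "asym_linear f c g"
  shows "asym_linear (\<lambda>w. a * f w) (a * c) (\<lambda>z. a * g z)"
proof -
  have "((\<lambda>w. a * (sqrt (fst w) * (f w - c - avg g w))) \<longlongrightarrow> 0) (in_prob M)"
    using assms by (intro tendsto_mult_right_zero) (auto simp: asym_linear_def)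
  then show ?thesis
    using assms by (auto simp: asym_linear_def algebra_simps avg_cmult influence_cmult)
qed

text \<open>The product differs from its linearization c f' + c' f - c c' by (f - c) (f' - c'),
  which after scaling by sqrt n is O_P(1) times o_P(1).\<close>

lemma asym_linear_mult:
  assumes f: "asym_linear f c g" and f': "asym_linear f' c' g'"
  shows "asym_linear (\<lambda>w. f w * f' w) (c * c') (\<lambda>z. c * g' z + c' * g z)"
proof -
  have "asym_linear (\<lambda>w. c * f' w + c' * f w + (- (c * c'))) (c * c' + c' * c + (- (c * c'))) (\<lambda>z. (c * g' z + c' * g z) + 0)"
    by (intro asym_linear_add asym_linear_cmult f f' asym_linear_const)
  then have *: "asym_linear (\<lambda>w. c * f' w + c' * f w - c * c') (c * c') (\<lambda>z. c * g' z + c' * g z)"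
    by (simp add: mult.commute)
  have "((\<lambda>w. sqrt (fst w) * (f w - c) * (f' w - c')) \<longlongrightarrow> 0) (in_prob M)"
    by (intro tight_mult_tendsto_0 asym_linear_tight[OF f] LIM_zero asym_linear_tendsto[OF f'])
  then show ?thesis by (intro asym_linear_close[OF *]) (simp add: algebra_simps)
qed

text \<open>The source of all influence functions below. For n > 0 the expansion has no remainder; n
  = 0 is set apart because there the division by zero makes every average 0.\<close>

lemma asym_linear_avg:
  assumes "L2_fun g"
  shows "asym_linear (avg g) (expectation (\<lambda>x. g (Z x))) (\<lambda>z. g z - expectation (\<lambda>x. g (Z x)))"
proof -
  have "\<forall>\<^sub>F w in in_prob M. avg g w - expectation (\<lambda>x. g (Z x)) - avg (\<lambda>z. g z - expectation (\<lambda>x. g (Z x))) w = 0"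
    using in_prob_pos by eventually_elim (auto simp: avg_diff, auto simp: avg_def split_beta)
  then show ?thesis
    unfolding asym_linear_def
    by (intro conjI influence_centered assms tendsto_eventually) (auto elim: eventually_mono)
qed

end

section \<open>Weak convergence from trigonometric test functions\<close>

text \<open>The phase admits sines and gives closure under products by the product-to-sum formula;
  frequency 0 gives the constants. The result is an algebra in which every term depends on a single
  linear functional of x.\<close>

inductive trig_sum :: "(real^'n \<Rightarrow> real) \<Rightarrow> bool" where
  cos: "trig_sum (\<lambda>x. a * cos (t \<bullet> x + c))"
| add: "trig_sum f \<Longrightarrow> trig_sum g \<Longrightarrow> trig_sum (\<lambda>x. f x + g x)"

lemma trig_sum_const: "trig_sum (\<lambda>x. c)"
  using trig_sum.cos[of c 0 0] by simp

lemma trig_sum_mult_cos: "trig_sum g \<Longrightarrow> trig_sum (\<lambda>x. a * cos (t \<bullet> x + c) * g x)"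
proof (induction rule: trig_sum.induct)
  case (cos b s d)
  have "a * cos (t \<bullet> x + c) * (b * cos (s \<bullet> x + d)) =
     (a * b / 2) * cos ((t - s) \<bullet> x + (c - d)) + (a * b / 2) * cos ((t + s) \<bullet> x + (c + d))" for x
  proof -
    have "a * cos (t \<bullet> x + c) * (b * cos (s \<bullet> x + d)) = a * b * (cos (t \<bullet> x + c) * cos (s \<bullet> x + d))"
      by simp
    also have "\<dots> = a * b * ((cos (t \<bullet> x + c - (s \<bullet> x + d)) + cos (t \<bullet> x + c + (s \<bullet> x + d))) / 2)"
      by (simp only: cos_times_cos)
    also have "t \<bullet> x + c - (s \<bullet> x + d) = (t - s) \<bullet> x + (c - d)" by (simp add: inner_diff_left)
    also have "t \<bullet> x + c + (s \<bullet> x + d) = (t + s) \<bullet> x + (c + d)" by (simp add: inner_add_left)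
    finally show ?thesis by (simp add: field_simps)
  qed
  then show ?case by (simp only: trig_sum.intros)
next
  case (add f g)
  then show ?case using trig_sum.add[OF add.IH] by (simp add: distrib_left)
qed

lemma trig_sum_mult: "trig_sum f \<Longrightarrow> trig_sum g \<Longrightarrow> trig_sum (\<lambda>x. f x * g x)"
proof (induction rule: trig_sum.induct)
  case (cos a t c)
  then show ?case by (rule trig_sum_mult_cos)
next
  case (add f g)
  then show ?case using trig_sum.add[of "\<lambda>x. f x * _ x" "\<lambda>x. g x * _ x"] by (simp add: distrib_right)
qed

lemma trig_sum_continuous: "trig_sum f \<Longrightarrow> continuous_on UNIV f"
  by (induction rule: trig_sum.induct) (auto intro!: continuous_intros)

text \<open>After the substitution $y_i = \sin (x_i / K)$ a polynomial approximation on the cube $[-1,1]^n$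
  becomes a trigonometric one that is bounded on the whole space.\<close>

lemma trig_sum_approx:
  fixes f :: "real^'n \<Rightarrow> real"
  assumes f: "continuous_on UNIV f" and B: "\<And>x. \<bar>f x\<bar> \<le> B" and "0 < K" "0 < \<epsilon>"
  obtains T where "trig_sum T" "\<And>x. \<bar>T x\<bar> \<le> B + \<epsilon>" "\<And>x. norm x \<le> K \<Longrightarrow> \<bar>f x - T x\<bar> \<le> \<epsilon>"
proof -
  define s where "s x = (\<chi> i. sin (x $ i / K))" for x :: "real^'n"
  define S where "S = cbox (- 1) (1 :: real^'n)"
  have S: "y \<in> S \<longleftrightarrow> (\<forall>i. - 1 \<le> y $ i \<and> y $ i \<le> 1)" for y
    by (simp add: S_def mem_box_cart)
  have sS: "s x \<in> S" for x by (simp add: S s_def)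
  \<comment> \<open>Composition with K arcsin undoes the substitution, so that \<phi> after s agrees
    with f wherever norm x <= K.\<close>
  define \<phi> where "\<phi> y = f (\<chi> i. K * arcsin (y $ i))" for y
  have \<phi>: "continuous_on S \<phi>"
    unfolding \<phi>_def
    by (rule continuous_on_compose2[OF f]) (auto intro!: continuous_intros continuous_on_vec_lambda simp: S)
  \<comment> \<open>The approximating algebra: continuous functions on the cube that become
    trigonometric sums after composition with s. The coordinates belong to it because sin u = cos (u
    - pi/2), and they separate points.\<close>
  define P where "P g \<longleftrightarrow> continuous_on UNIV g \<and> trig_sum (\<lambda>x. g (s x))" for g :: "real^'n \<Rightarrow> real"
  have "\<exists>g. P g \<and> (\<forall>y\<in>S. \<bar>\<phi> y - g y\<bar> < \<epsilon>)"
  proof (rule Stone_Weierstrass_HOL)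
    show "compact S" by (simp add: S_def)
    show "P (\<lambda>x. c)" for c by (simp add: P_def trig_sum_const)
    show "continuous_on S g" if "P g" for g using that continuous_on_subset P_def by blast
    show "P (\<lambda>x. g x + h x)" if "P g \<and> P h" for g h
      using that by (auto simp: P_def intro!: continuous_intros trig_sum.add)
    show "P (\<lambda>x. g x * h x)" if "P g \<and> P h" for g h
      using that by (auto simp: P_def intro!: continuous_intros trig_sum_mult)
    show "\<exists>g. P g \<and> g x \<noteq> g y" if xy: "x \<in> S \<and> y \<in> S \<and> x \<noteq> y" for x y
    proof -
      obtain i where i: "x $ i \<noteq> y $ i" using xy by (auto simp: vec_eq_iff)
      have "s x $ i = 1 * cos (axis i (1/K) \<bullet> x + (- pi/2))" for x
        by (simp add: s_def inner_axis' cos_diff)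
      then have "P (\<lambda>x. x $ i)"
        unfolding P_def using trig_sum.cos[of 1 "axis i (1/K)" "- pi/2"] by (auto intro!: continuous_intros)
      with i show ?thesis by blast
    qed
  qed (use \<phi> \<open>0 < \<epsilon>\<close> in auto)
  then obtain g where g: "P g" "\<And>y. y \<in> S \<Longrightarrow> \<bar>\<phi> y - g y\<bar> < \<epsilon>" by blast
  show ?thesis
  proof
    show "trig_sum (\<lambda>x. g (s x))" using g by (simp add: P_def)
    fix x
    \<comment> \<open>Since s x lies in the cube for every x, the approximation is bounded on the
      whole space and not only on the ball.\<close>
    have b: "\<bar>\<phi> (s x)\<bar> \<le> B" unfolding \<phi>_def by (rule B)
    show "\<bar>g (s x)\<bar> \<le> B + \<epsilon>"
      using b g(2)[OF sS[of x]] by linarith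
    show "\<bar>f x - g (s x)\<bar> \<le> \<epsilon>" if "norm x \<le> K"
    proof -
      have "K * arcsin (s x $ i) = x $ i" for i
      proof -
        have "\<bar>x $ i\<bar> \<le> K" using component_le_norm_cart[of x i] that by linarith
        \<comment> \<open>The angle has modulus at most 1 < pi/2, where arcsin inverts sin.\<close>
        then have "\<bar>x $ i / K\<bar> \<le> 1" using \<open>0 < K\<close> by simp
        then have "- (pi/2) \<le> x $ i / K" "x $ i / K \<le> pi/2" using pi_gt3 by linarith+
        then show ?thesis using \<open>0 < K\<close> by (simp add: s_def arcsin_sin)
      qed
      then have "\<phi> (s x) = f x" by (simp add: \<phi>_def)
      then show ?thesis using g(2)[OF sS[of x]] by simp
    qed
  qed
qed

lemma (in prob_space) integral_diff_le_on_event: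
  fixes f g :: "'a \<Rightarrow> real"
  assumes [measurable]: "f \<in> borel_measurable M" "g \<in> borel_measurable M" "E \<in> sets M"
    and f: "\<And>x. \<bar>f x\<bar> \<le> B" and g: "\<And>x. \<bar>g x\<bar> \<le> B'"
    and E: "prob (space M - E) \<le> \<eta>" "\<And>x. x \<in> E \<Longrightarrow> \<bar>f x - g x\<bar> \<le> \<epsilon>" and "0 \<le> \<epsilon>"
  shows "\<bar>expectation f - expectation g\<bar> \<le> \<epsilon> + (B + B') * \<eta>"
proof -
  have BB: "0 \<le> B + B'" using f[of undefined] g[of undefined] by linarith
  have int: "integrable M f" "integrable M g"
    using f g by (auto intro: integrable_const_bound[of _ B] integrable_const_bound[of _ B'])
  have ind: "integrable M (indicator (space M - E) :: 'a \<Rightarrow> real)"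
    by (rule integrable_const_bound[of _ 1]) auto
  have "\<bar>expectation f - expectation g\<bar> = \<bar>expectation (\<lambda>x. f x - g x)\<bar>"
    using int by simp
  also have "\<dots> \<le> expectation (\<lambda>x. \<bar>f x - g x\<bar>)"
    using integral_norm_bound[of M "\<lambda>x. f x - g x"] by simp
  also have "\<dots> \<le> expectation (\<lambda>x. \<epsilon> + (B + B') * indicator (space M - E) x)"
  proof (rule integral_mono)
    fix x assume x: "x \<in> space M"
    show "\<bar>f x - g x\<bar> \<le> \<epsilon> + (B + B') * indicator (space M - E) x"
    proof (cases "x \<in> E")
      case True then show ?thesis using E by simp
    next
      case False
      have "\<bar>f x - g x\<bar> \<le> B + B'" using f[of x] g[of x] by linarith
      then show ?thesis using False x \<open>0 \<le> \<epsilon>\<close> by simp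
    qed
  qed (use int ind in simp_all)
  also have "\<dots> = \<epsilon> + (B + B') * prob (space M - E)"
    using ind by (simp add: prob_space)
  also have "\<dots> \<le> \<epsilon> + (B + B') * \<eta>" using E BB by (simp add: mult_left_mono)
  finally show ?thesis .
qed

lemma (in prob_space) norm_tight:
  fixes V :: "'a \<Rightarrow> 'b :: euclidean_space"
  assumes [measurable]: "V \<in> borel_measurable M" and "0 < \<eta>"
  obtains K where "prob {x \<in> space M. norm (V x) > K} \<le> \<eta>"
proof -
  have "(\<lambda>k. prob {x \<in> space M. norm (V x) \<le> real k}) \<longlonglongrightarrow> prob (\<Union>k. {x \<in> space M. norm (V x) \<le> real k})"
    by (rule finite_Lim_measure_incseq) (auto simp: incseq_def)
  also have "(\<Union>k. {x \<in> space M. norm (V x) \<le> real k}) = space M"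
    using real_arch_simple by blast
  finally have "(\<lambda>k. prob {x \<in> space M. norm (V x) \<le> real k}) \<longlonglongrightarrow> 1" by (simp add: prob_space)
  then have "\<forall>\<^sub>F k in sequentially. 1 - \<eta> < prob {x \<in> space M. norm (V x) \<le> real k}"
    using \<open>0 < \<eta>\<close> by (intro order_tendstoD) auto
  then obtain k where k: "1 - \<eta> < prob {x \<in> space M. norm (V x) \<le> real k}"
    using eventually_happens'[OF sequentially_bot] by blast
  have "prob (space M - {x \<in> space M. norm (V x) \<le> real k}) = 1 - prob {x \<in> space M. norm (V x) \<le> real k}"
    by (rule prob_compl) measurable
  also have "space M - {x \<in> space M. norm (V x) \<le> real k} = {x \<in> space M. norm (V x) > real k}" by auto
  finally show ?thesis using k that[of "real k"] by simp
qed

text \<open>Convergence for cosines extends linearly to every \<open>trig_sum\<close>. A bounded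
  continuous f is exchanged for such a T both under the law of \<open>V n\<close> and under \<mu>:
  on a large ball T is close to f, and outside it both are bounded while tightness makes the
  probability small.\<close>

lemma (in prob_space) weak_limit_of_cos:
  fixes V :: "nat \<Rightarrow> 'a \<Rightarrow> real^'n"
  assumes [measurable]: "\<And>n. V n \<in> borel_measurable M"
    and \<mu>: "prob_space \<mu>" and sets_\<mu>: "sets \<mu> = sets borel"
    and tight: "tight_seq M (\<lambda>(n, x). norm (V n x))"
    and cos: "\<And>t c. (\<lambda>n. expectation (\<lambda>x. cos (t \<bullet> V n x + c))) \<longlonglongrightarrow> (\<integral>x. cos (t \<bullet> x + c) \<partial>\<mu>)"
  shows "weak_limit (\<lambda>n. distr M borel (V n)) \<mu>"
  unfolding weak_limit_def
proof (intro allI impI)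
  interpret \<mu>: prob_space \<mu> by fact
  note sets_\<mu>[measurable_cong]
  have trig: "(\<lambda>n. expectation (\<lambda>x. T (V n x))) \<longlonglongrightarrow> integral\<^sup>L \<mu> T \<and>
      (\<forall>n. integrable M (\<lambda>x. T (V n x))) \<and> integrable \<mu> T" if "trig_sum T" for T
    using that
  proof (induction rule: trig_sum.induct)
    case (cos a t c)
    have "\<bar>cos y\<bar> \<le> 1" for y :: real by simp
    then have "integrable M (\<lambda>x. a * cos (t \<bullet> V n x + c))" "integrable \<mu> (\<lambda>x. a * cos (t \<bullet> x + c))" for n
      by (auto intro!: integrable_mult_right integrable_const_bound[where B=1] \<mu>.integrable_const_bound[where B=1])
    then show ?case using tendsto_mult_left[OF assms(5), of a] by simp
  next
    case (add f g)
    then show ?case by (auto intro!: tendsto_add)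
  qed
  fix f :: "real^'n \<Rightarrow> real" assume "continuous_on UNIV f \<and> bounded (range f)"
  then obtain B where f: "continuous_on UNIV f" and B: "\<And>x. \<bar>f x\<bar> \<le> B"
    unfolding bounded_iff by auto
  have [measurable]: "f \<in> borel_measurable borel"
    by (rule borel_measurable_continuous_onI) fact
  have "0 \<le> B" using B[of undefined] by linarith
  show "(\<lambda>n. integral\<^sup>L (distr M borel (V n)) f) \<longlonglongrightarrow> integral\<^sup>L \<mu> f"
    unfolding LIMSEQ_def
  proof (intro allI impI)
    fix r :: real assume "0 < r"
    \<comment> \<open>With \<epsilon> and \<eta> below, each exchange of f for T costs at most r/8 +
      r/8; together with r/4 for the limit of T the total stays below r. The cap \<epsilon> \<le> 1
      bounds T by B + 1, so that \<eta> can be fixed before T is known.\<close>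
    define \<epsilon> where "\<epsilon> = min 1 (r/8)"
    have \<epsilon>: "0 < \<epsilon>" "\<epsilon> \<le> 1" "\<epsilon> \<le> r/8" using \<open>0 < r\<close> by (auto simp: \<epsilon>_def)
    define \<eta> where "\<eta> = r / (8 * (2 * B + 1))"
    have \<eta>: "0 < \<eta>" using \<open>0 < r\<close> \<open>0 \<le> B\<close> by (simp add: \<eta>_def)
    have "(2 * B + 1) * \<eta> = r/8" using \<open>0 \<le> B\<close> by (simp add: \<eta>_def field_simps)
    moreover have "(B + (B + \<epsilon>)) * \<eta> \<le> (2 * B + 1) * \<eta>"
      using \<eta> \<epsilon> by (intro mult_right_mono) auto
    ultimately have small: "\<epsilon> + (B + (B + \<epsilon>)) * \<eta> \<le> r/4" using \<epsilon> by linarith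
    obtain K1 where K1: "\<forall>\<^sub>F n in sequentially. \<exists>E\<in>sets M. prob (space M - E) \<le> \<eta> \<and> (\<forall>x\<in>E. norm (V n x) \<le> K1)"
      using tight \<eta> unfolding tight_seq_def eventually_up_to_def by auto
    obtain K2 where K2: "\<mu>.prob {x \<in> space \<mu>. norm x > K2} \<le> \<eta>"
      using \<mu>.norm_tight[of "\<lambda>x. x" \<eta>] \<eta> by auto
    define K where "K = max 1 (max K1 K2)"
    have "0 < K" by (simp add: K_def)
    then obtain T where T: "trig_sum T" "\<And>x. \<bar>T x\<bar> \<le> B + \<epsilon>" "\<And>x. norm x \<le> K \<Longrightarrow> \<bar>f x - T x\<bar> \<le> \<epsilon>"
      using trig_sum_approx[OF f B _ \<epsilon>(1)] by metis
    have [measurable]: "T \<in> borel_measurable borel"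
      by (rule borel_measurable_continuous_onI) (rule trig_sum_continuous[OF T(1)])
    have lim: "\<bar>integral\<^sup>L \<mu> f - integral\<^sup>L \<mu> T\<bar> \<le> \<epsilon> + (B + (B + \<epsilon>)) * \<eta>"
    proof (rule \<mu>.integral_diff_le_on_event[where E="{x \<in> space \<mu>. norm x \<le> K2}"])
      have "space \<mu> - {x \<in> space \<mu>. norm x \<le> K2} = {x \<in> space \<mu>. norm x > K2}" by auto
      then show "\<mu>.prob (space \<mu> - {x \<in> space \<mu>. norm x \<le> K2}) \<le> \<eta>" using K2 by simp
    qed (use B T \<epsilon> in \<open>auto simp: K_def\<close>)
    have "\<forall>\<^sub>F n in sequentially. \<bar>expectation (\<lambda>x. T (V n x)) - integral\<^sup>L \<mu> T\<bar> < r/4"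
      using trig[OF T(1)] \<open>0 < r\<close> unfolding tendsto_iff dist_real_def by (metis divide_pos_pos zero_less_numeral)
    with K1 have "\<forall>\<^sub>F n in sequentially. dist (integral\<^sup>L (distr M borel (V n)) f) (integral\<^sup>L \<mu> f) < r"
    proof eventually_elim
      case (elim n)
      then obtain E where E: "E \<in> sets M" "prob (space M - E) \<le> \<eta>" "\<forall>x\<in>E. norm (V n x) \<le> K1" by blast
      have "\<bar>expectation (\<lambda>x. f (V n x)) - expectation (\<lambda>x. T (V n x))\<bar> \<le> \<epsilon> + (B + (B + \<epsilon>)) * \<eta>"
        by (rule integral_diff_le_on_event[where E=E]) (use B T \<epsilon> E in \<open>auto simp: K_def\<close>)
      then have "\<bar>expectation (\<lambda>x. f (V n x)) - integral\<^sup>L \<mu> f\<bar> < r"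
        using lim small elim(2) by arith
      then show ?case by (simp add: integral_distr dist_real_def)
    qed
    then show "\<exists>no. \<forall>n\<ge>no. dist (integral\<^sup>L (distr M borel (V n)) f) (integral\<^sup>L \<mu> f) < r"
      unfolding eventually_sequentially .
  qed
qed

section \<open>The multivariate normal distribution\<close>

lemma inner_axis_matrix_mult: "axis i 1 \<bullet> ((C :: real^'n^'m) *v axis j 1) = C $ i $ j"
  by (simp add: inner_axis' matrix_vector_mult_basis column_def)

lemma sum_rank_one_quadratic: "t \<bullet> ((\<chi> i j. \<Sum>k\<in>I. a k $ i * a k $ j) *v t) = (\<Sum>k\<in>I. (t \<bullet> a k)\<^sup>2)"
  for t :: "real^'n"
proof -
  have "t \<bullet> ((\<chi> i j. \<Sum>k\<in>I. a k $ i * a k $ j) *v t) = (\<Sum>i\<in>UNIV. \<Sum>j\<in>UNIV. \<Sum>k\<in>I. (t $ i * a k $ i) * (t $ j * a k $ j))"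
    by (simp add: inner_vec_def matrix_vector_mult_def sum_distrib_left sum_distrib_right mult_ac)
  also have "\<dots> = (\<Sum>i\<in>UNIV. \<Sum>k\<in>I. \<Sum>j\<in>UNIV. (t $ i * a k $ i) * (t $ j * a k $ j))"
    by (intro sum.cong refl sum.swap)
  also have "\<dots> = (\<Sum>k\<in>I. \<Sum>i\<in>UNIV. \<Sum>j\<in>UNIV. (t $ i * a k $ i) * (t $ j * a k $ j))"
    by (rule sum.swap)
  also have "\<dots> = (\<Sum>k\<in>I. (t \<bullet> a k)\<^sup>2)"
    by (simp add: inner_vec_def power2_eq_square sum_product)
  finally show ?thesis .
qed

text \<open>One step of the Cholesky decomposition.\<close>

lemma pos_semidef_eliminate:
  fixes C :: "real^'n^'n" and k :: 'n
  assumes C: "pos_semidef C"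
  defines "C' \<equiv> (\<chi> i j. C $ i $ j - C $ k $ i * C $ k $ j / C $ k $ k)"
  shows "pos_semidef C'" "0 \<le> C $ k $ k" "C' $ k $ j = 0" "C' $ j $ k = 0"
proof -
  have sym: "C $ i $ j = C $ j $ i" for i j
    using C unfolding pos_semidef_def transpose_def vec_eq_iff by (metis vec_lambda_beta)
  have nn: "0 \<le> x \<bullet> (C *v x)" for x using C by (simp add: pos_semidef_def)
  show d: "0 \<le> C $ k $ k" using nn[of "axis k 1"] by (simp add: inner_axis_matrix_mult)
  \<comment> \<open>The quadratic form at x + s e_k, seen as a polynomial in s; nonnegativity for
    all s carries the whole argument.\<close>
  have quad: "0 \<le> x \<bullet> (C *v x) + 2 * s * (C $ k \<bullet> x) + s\<^sup>2 * C $ k $ k" for x s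
  proof -
    have Ck: "axis k 1 \<bullet> (C *v x) = C $ k \<bullet> x" for x
      by (simp add: inner_axis' matrix_vector_mult_def) (simp add: inner_vec_def)
    have "x \<bullet> (C *v axis k 1) = C $ k \<bullet> x"
      by (simp add: matrix_vector_mult_basis column_def inner_vec_def sym[of _ k] mult.commute)
    then have "(x + s *\<^sub>R axis k 1) \<bullet> (C *v (x + s *\<^sub>R axis k 1)) =
      x \<bullet> (C *v x) + s * (C $ k \<bullet> x) + (s * (C $ k \<bullet> x) + s * (s * C $ k $ k))"
      by (simp add: matrix_vector_right_distrib inner_add_left inner_add_right Ck inner_axis_matrix_mult
        matrix_vector_mult_scaleR del: inner_scaleR_right, simp add: inner_axis_matrix_mult Ck)
    then show ?thesis using nn[of "x + s *\<^sub>R axis k 1"] by (simp add: power2_eq_square algebra_simps)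
  qed
  \<comment> \<open>With a zero pivot the polynomial is linear in s, so a nonzero slope would make
    it negative somewhere. Hence the division by zero in \<open>C'\<close> is harmless: it subtracts
    0 from a matrix whose row k is already 0.\<close>
  have row0: "C $ k $ j = 0" if "C $ k $ k = 0" for j
  proof (rule ccontr)
    assume n0: "C $ k $ j \<noteq> 0"
    have "C $ k \<bullet> axis j 1 = C $ k $ j" by (simp add: inner_axis)
    then have "0 \<le> C $ j $ j + 2 * s * C $ k $ j" for s
      using quad[of "axis j 1" s] that by (simp add: inner_axis_matrix_mult)
    \<comment> \<open>This s gives the expression the value -1.\<close>
    from this[of "- (C $ j $ j + 1) / (2 * C $ k $ j)"] show False using n0 by (simp add: field_simps)
  qed
  show z: "C' $ k $ j = 0" for j
    using row0[of j] by (cases "C $ k $ k = 0") (auto simp: C'_def)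
  show "C' $ j $ k = 0"
    using row0[of j] sym[of j k] by (cases "C $ k $ k = 0") (auto simp: C'_def)
  show "pos_semidef C'"
    unfolding pos_semidef_def
  proof (intro conjI allI)
    show "transpose C' = C'"
      by (simp add: vec_eq_iff transpose_def C'_def sym[of _ _] mult.commute)
    fix x
    have "x \<bullet> (C' *v x) = x \<bullet> (C *v x) - (C $ k \<bullet> x)\<^sup>2 / C $ k $ k"
    proof -
      have "x \<bullet> (C' *v x) = (\<Sum>i\<in>UNIV. \<Sum>j\<in>UNIV. x $ i * C $ i $ j * x $ j - (C $ k $ i * x $ i) * (C $ k $ j * x $ j) / C $ k $ k)"
        by (simp add: inner_vec_def matrix_vector_mult_def C'_def sum_distrib_left algebra_simps)
      also have "\<dots> = x \<bullet> (C *v x) - (C $ k \<bullet> x)\<^sup>2 / C $ k $ k"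
      proof -
        have "(C $ k \<bullet> x)\<^sup>2 / C $ k $ k = (\<Sum>i\<in>UNIV. \<Sum>j\<in>UNIV. (C $ k $ i * x $ i) * (C $ k $ j * x $ j) / C $ k $ k)"
          by (simp add: inner_vec_def power2_eq_square sum_product sum_divide_distrib)
        then show ?thesis
          by (simp add: inner_vec_def[of x] matrix_vector_mult_def sum_subtractf sum_distrib_left mult.assoc)
      qed
      finally show ?thesis .
    qed
    also have "\<dots> \<ge> 0"
    proof (cases "C $ k $ k = 0")
      case True then show ?thesis using nn by simp
    next
      case False
      \<comment> \<open>This s minimizes the polynomial, and the minimum is the quadratic form of
        \<open>C'\<close>.\<close>
      then show ?thesis using quad[of x "- (C $ k \<bullet> x) / C $ k $ k"]
        by (simp add: power2_eq_square field_simps)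
    qed
    finally show "0 \<le> x \<bullet> (C' *v x)" .
  qed
qed

text \<open>The dimension is fixed by the type, so the induction runs over a set I of indices
  outside of which C vanishes: eliminating k leaves a matrix supported on the smaller set, and the
  removed part is the rank-one matrix of b. For a zero pivot, 1 / 0 = 0 makes b = 0, as it should
  be.\<close>

lemma pos_semidef_rank_one_sum:
  fixes C :: "real^'n^'n"
  assumes "finite I" "pos_semidef C" "\<And>i j. C $ i $ j \<noteq> 0 \<Longrightarrow> i \<in> I \<and> j \<in> I"
  shows "\<exists>a. C = (\<chi> i j. \<Sum>k\<in>I. a k $ i * (a k :: real^'n) $ j)"
  using assms
proof (induction I arbitrary: C)
  case empty
  then show ?case by (auto simp: vec_eq_iff)
next
  case (insert k I)
  define C' where "C' = (\<chi> i j. C $ i $ j - C $ k $ i * C $ k $ j / C $ k $ k)"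
  note C' = pos_semidef_eliminate[OF insert.prems(1), of k, folded C'_def]
  have sym: "C $ i $ j = C $ j $ i" for i j
    using insert.prems(1) unfolding pos_semidef_def transpose_def vec_eq_iff by (metis vec_lambda_beta)
  have "i \<in> I \<and> j \<in> I" if "C' $ i $ j \<noteq> 0" for i j
  proof -
    have "i \<noteq> k" "j \<noteq> k" using C'(3,4) that by auto
    moreover have "i \<in> insert k I \<and> j \<in> insert k I"
    proof (rule ccontr)
      assume "\<not> (i \<in> insert k I \<and> j \<in> insert k I)"
      then have "C $ i $ j = 0" "C $ k $ i = 0 \<or> C $ k $ j = 0" using insert.prems(2) by blast+
      then show False using that by (auto simp: C'_def)
    qed
    ultimately show ?thesis by auto
  qed
  then obtain a where a: "C' = (\<chi> i j. \<Sum>k\<in>I. a k $ i * (a k :: real^'n) $ j)"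
    using insert.IH[OF C'(1)] by blast
  define b where "b = (1 / sqrt (C $ k $ k)) *\<^sub>R C $ k"
  have "C $ i $ j = (\<Sum>l\<in>insert k I. (a(k := b)) l $ i * (a(k := b)) l $ j)" for i j
  proof -
    have "b $ i * b $ j = C $ k $ i * C $ k $ j / C $ k $ k"
      using C'(2) by (simp add: b_def)
    moreover have "(\<Sum>l\<in>I. (a(k := b)) l $ i * (a(k := b)) l $ j) = C' $ i $ j"
      using insert.hyps by (auto simp: a intro!: sum.cong)
    ultimately show ?thesis using insert.hyps by (simp add: C'_def)
  qed
  then show ?case by (intro exI[of _ "a(k := b)"]) (simp add: vec_eq_iff)
qed

lemma std_normal_product_linear:
  fixes c :: "'i::finite \<Rightarrow> real"
  defines "Q \<equiv> (\<Pi>\<^sub>M i\<in>(UNIV :: 'i set). std_normal_distribution)"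
  shows "distr Q borel (\<lambda>\<xi>. \<Sum>i\<in>UNIV. c i * \<xi> i) = normal_law 0 (\<Sum>i\<in>UNIV. (c i)\<^sup>2)"
proof -
  interpret N: prob_space std_normal_distribution by (rule real_dist_normal_dist[THEN real_distribution.axioms(1)])
  interpret product_prob_space "\<lambda>_. std_normal_distribution" UNIV ..
  interpret Q: prob_space Q unfolding Q_def by (rule prob_space_PiM) unfold_locales
  have comp: "distr Q borel (\<lambda>\<xi>. \<xi> i) = std_normal_distribution" for i
  proof -
    have "distr Q borel (\<lambda>\<xi>. \<xi> i) = distr Q std_normal_distribution (\<lambda>\<xi>. \<xi> i)"
      by (intro distr_cong) auto
    also have "\<dots> = std_normal_distribution"
      unfolding Q_def by (intro distr_PiM_component) (auto intro: N.prob_space_axioms)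
    finally show ?thesis .
  qed
  have sP [measurable_cong]: "sets Q = sets (\<Pi>\<^sub>M i\<in>(UNIV :: 'i set). borel)"
    unfolding Q_def by (intro sets_PiM_cong) auto
  have rv [measurable]: "(\<lambda>\<xi>. \<xi> i) \<in> borel_measurable Q" for i
    by measurable
  have "distr Q (\<Pi>\<^sub>M i\<in>(UNIV :: 'i set). borel) (\<lambda>\<xi>. \<lambda>i\<in>UNIV. \<xi> i) = Q"
    unfolding restrict_def using distr_id2[OF sP[symmetric]] by simp
  then have ind: "Q.indep_vars (\<lambda>_. borel) (\<lambda>i \<xi>. \<xi> i) (UNIV :: 'i set)"
    by (subst Q.indep_vars_iff_distr_eq_PiM') (auto simp: comp simp flip: Q_def)
  \<comment> \<open>Coefficients 0 are dropped because a normal density needs positive variance; if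
    none is left, the sum has the point mass at 0, which is what \<open>normal_law\<close> assigns
    to variance 0.\<close>
  define I where "I = {i. c i \<noteq> 0}"
  have sums: "(\<Sum>i\<in>UNIV. c i * \<xi> i) = (\<Sum>i\<in>I. c i * \<xi> i)" "(\<Sum>i\<in>UNIV. (c i)\<^sup>2) = (\<Sum>i\<in>I. (c i)\<^sup>2)" for \<xi>
    by (intro sum.mono_neutral_right; force simp: I_def)+
  show ?thesis
  proof (cases "I = {}")
    case True
    then have "distr Q borel (\<lambda>\<xi>. \<Sum>i\<in>UNIV. c i * \<xi> i) = distr Q borel (\<lambda>\<xi>. 0)" by (simp add: sums)
    also have "\<dots> = return borel 0" by (intro Q.distr_const) auto
    finally show ?thesis using True by (simp add: normal_law_def sums)
  next
    case False
    have nrm: "distributed Q lborel (\<lambda>\<xi>. c i * \<xi> i) (normal_density 0 \<bar>c i\<bar>)" if "i \<in> I" for i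
    proof -
      have "distributed Q lborel (\<lambda>\<xi>. \<xi> i) (normal_density 0 1)"
        unfolding distributed_def using comp[of i] by (auto cong: distr_cong)
      from Q.normal_density_affine[OF this, of "c i" 0] that show ?thesis by (simp add: I_def)
    qed
    have ind': "Q.indep_vars (\<lambda>_. borel) (\<lambda>i \<xi>. c i * \<xi> i) I"
      using Q.indep_vars_compose2[OF Q.indep_vars_subset[OF ind, of I], of "\<lambda>i x. c i * x" "\<lambda>_. borel"] by auto
    have "distributed Q lborel (\<lambda>\<xi>. \<Sum>i\<in>I. c i * \<xi> i) (normal_density (\<Sum>i\<in>I. 0) (sqrt (\<Sum>i\<in>I. \<bar>c i\<bar>\<^sup>2)))"
      using False by (intro Q.sum_indep_normal ind' nrm) (auto simp: I_def)
    then have "distr Q lborel (\<lambda>\<xi>. \<Sum>i\<in>I. c i * \<xi> i) = density lborel (normal_density 0 (sqrt (\<Sum>i\<in>I. (c i)\<^sup>2)))"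
      by (simp add: distributed_def)
    moreover have "(\<Sum>i\<in>I. (c i)\<^sup>2) \<noteq> 0"
      using False by (subst sum_nonneg_eq_0_iff) (auto simp: I_def)
    ultimately show ?thesis
      by (simp add: sums normal_law_def cong: distr_cong)
  qed
qed

text \<open>The law of the sum of xi_k a_k, with independent standard normal xi_k and the rank-one
  factors a_k of C. No inverse of C occurs, so singular matrices are covered.\<close>

lemma multivariate_normal_exists:
  fixes C :: "real^'n^'n"
  assumes "pos_semidef C"
  obtains \<mu> where "multivariate_normal 0 C \<mu>"
proof -
  have "\<exists>a. C = (\<chi> i j. \<Sum>k\<in>(UNIV :: 'n set). a k $ i * (a k :: real^'n) $ j)"
    by (rule pos_semidef_rank_one_sum[OF _ assms]) auto
  then obtain a where a: "C = (\<chi> i j. \<Sum>k\<in>(UNIV :: 'n set). a k $ i * (a k :: real^'n) $ j)"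
    by blast
  define Q where "Q = (\<Pi>\<^sub>M i\<in>(UNIV :: 'n set). std_normal_distribution)"
  interpret N: prob_space std_normal_distribution by (rule real_dist_normal_dist[THEN real_distribution.axioms(1)])
  interpret product_prob_space "\<lambda>_. std_normal_distribution" UNIV ..
  interpret Q: prob_space Q unfolding Q_def by (rule prob_space_PiM) unfold_locales
  have sP [measurable_cong]: "sets Q = sets (\<Pi>\<^sub>M i\<in>(UNIV :: 'n set). borel)"
    unfolding Q_def by (intro sets_PiM_cong) auto
  have [measurable]: "(\<lambda>\<xi>. \<Sum>k\<in>UNIV. \<xi> k *\<^sub>R a k) \<in> borel_measurable Q" by measurable
  define \<mu> where "\<mu> = distr Q borel (\<lambda>\<xi>. \<Sum>k\<in>UNIV. \<xi> k *\<^sub>R a k)"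
  have "distr \<mu> borel (\<lambda>x. t \<bullet> x) = normal_law 0 (t \<bullet> (C *v t))" for t
  proof -
    have "distr \<mu> borel (\<lambda>x. t \<bullet> x) = distr Q borel (\<lambda>\<xi>. \<Sum>k\<in>UNIV. (t \<bullet> a k) * \<xi> k)"
      unfolding \<mu>_def by (subst distr_distr) (auto simp: comp_def inner_sum_right mult.commute)
    also have "\<dots> = normal_law 0 (t \<bullet> (C *v t))"
      unfolding Q_def by (simp add: std_normal_product_linear a sum_rank_one_quadratic)
    finally show ?thesis .
  qed
  then have "multivariate_normal 0 C \<mu>"
    using assms by (auto simp: multivariate_normal_def \<mu>_def intro!: Q.prob_space_distr)
  then show ?thesis by (rule that)
qed

lemma normal_law_integral:
  assumes "0 < v" and [measurable]: "f \<in> borel_measurable borel"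
  shows "integral\<^sup>L (normal_law 0 v) f = (\<integral>x. normal_density 0 (sqrt v) x * f x \<partial>lborel :: real)"
  using assms by (simp add: normal_law_def integral_density)

lemma normal_law_variance:
  assumes "0 \<le> v"
  shows "(\<integral>y. (y - (\<integral>z. z \<partial>normal_law 0 v))\<^sup>2 \<partial>normal_law 0 v) = v"
proof (cases "v = 0")
  case True
  then show ?thesis by (simp add: normal_law_def integral_return)
next
  case False
  then have v: "0 < v" using assms by simp
  have "(\<integral>z. z \<partial>normal_law 0 v) = 0"
    using integral_normal_moment_nz_1[of "sqrt v" 0] v by (simp add: normal_law_integral)
  then show ?thesis
    using integral_normal_moment_even[of "sqrt v" 0 1] v by (simp add: normal_law_integral)
qed

lemma multivariate_normal_integral:
  assumes "multivariate_normal 0 C \<mu>" and [measurable]: "f \<in> borel_measurable borel"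
  shows "(\<integral>x. f (t \<bullet> x) \<partial>\<mu>) = (\<integral>y. f y \<partial>normal_law 0 (t \<bullet> (C *v t)) :: real)"
proof -
  have [measurable_cong]: "sets \<mu> = sets borel" and d: "distr \<mu> borel (\<lambda>x. t \<bullet> x) = normal_law 0 (t \<bullet> (C *v t))"
    using assms by (auto simp: multivariate_normal_def)
  show ?thesis unfolding d[symmetric] by (subst integral_distr) auto
qed

lemma multivariate_normal_variance:
  assumes "multivariate_normal 0 C \<mu>"
  shows "prob_space.variance \<mu> (\<lambda>v. v $ i) = C $ i $ i"
proof -
  have "prob_space \<mu>" and C: "pos_semidef C" using assms by (auto simp: multivariate_normal_def)
  let ?t = "axis i 1"
  have "0 \<le> C $ i $ i" using C unfolding pos_semidef_def by (metis inner_axis_matrix_mult)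
  moreover have "v $ i = ?t \<bullet> v" for v by (simp add: inner_axis')
  ultimately show ?thesis
    using multivariate_normal_integral[OF assms, of "\<lambda>x. x" ?t] normal_law_variance[of "C $ i $ i"]
      multivariate_normal_integral[OF assms, of "\<lambda>x. (x - (\<integral>z. z \<partial>normal_law 0 (C $ i $ i)))\<^sup>2" ?t]
    by (simp add: inner_axis_matrix_mult)
qed

section \<open>Central limit theorem for asymptotically linear vectors\<close>

context iid_sample
begin

text \<open>The classical theorem divides by the standard deviation, so v = 0 is treated apart:
  there g vanishes almost surely on the sample and both sides are cos c. For v > 0 the factor
  \<sigma> is moved into the test function.\<close>

lemma clt_cos:
  assumes g: "influence g"
  shows "(\<lambda>n. expectation (\<lambda>x. cos (sqrt n * avg g (n, x) + c))) \<longlonglongrightarrow>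
    (\<integral>y. cos (y + c) \<partial>normal_law 0 (expectation (\<lambda>x. (g (Z x))\<^sup>2)))"
proof -
  define v where "v = expectation (\<lambda>x. (g (Z x))\<^sup>2)"
  have [measurable]: "g \<in> borel_measurable borel" and sq: "integrable M (\<lambda>x. (g (Z x))\<^sup>2)"
    and E0: "expectation (\<lambda>x. g (Z x)) = 0"
    using g by (auto simp: influence_def L2_fun_def)
  have v0: "0 \<le> v" by (simp add: v_def)
  have sqi: "integrable M (\<lambda>x. (g (Zs i x))\<^sup>2)" "expectation (\<lambda>x. (g (Zs i x))\<^sup>2) = v" for i
    using sq integrable_Zs_iff[of "\<lambda>z. (g z)\<^sup>2"] expectation_Zs[of "\<lambda>z. (g z)\<^sup>2"] by (auto simp: v_def)
  show ?thesis
  proof (cases "v = 0")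
    case True
    have "AE x in M. g (Zs i x) = 0" for i
      using integral_nonneg_eq_0_iff_AE[OF sqi(1)[of i]] sqi(2)[of i] True by auto
    then have "AE x in M. \<forall>i. g (Zs i x) = 0" by (simp add: AE_all_countable)
    then have "AE x in M. cos (sqrt n * avg g (n, x) + c) = cos c" for n
      by eventually_elim (simp add: avg_def)
    then have "expectation (\<lambda>x. cos (sqrt n * avg g (n, x) + c)) = expectation (\<lambda>x. cos c)" for n
      by (intro integral_cong_AE) (auto simp: avg_def)
    then show ?thesis unfolding v_def[symmetric] True
      by (simp add: normal_law_def integral_return prob_space)
  next
    case False
    define \<sigma> where "\<sigma> = sqrt v"
    have \<sigma>: "0 < \<sigma>" "\<sigma>\<^sup>2 = v" using False v0 by (auto simp: \<sigma>_def)
    have w: "weak_conv_m (\<lambda>n. distr M borel (\<lambda>x. (\<Sum>i<n. g (Zs i x)) / sqrt (n * \<sigma>\<^sup>2))) std_normal_distribution"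
    proof (rule central_limit_theorem_zero_mean[where \<mu>="distr M borel (\<lambda>x. g (Z x))"])
      show "indep_vars (\<lambda>i. borel) (\<lambda>i x. g (Zs i x)) UNIV"
        by (rule indep_vars_compose2[OF indep]) simp
      show e: "expectation (\<lambda>x. g (Zs n x)) = 0" for n using expectation_Zs[of g] E0 by simp
      show "variance (\<lambda>x. g (Zs n x)) = \<sigma>\<^sup>2" for n using e sqi \<sigma> by simp
      have "distr M borel (\<lambda>x. g (Zs n x)) = distr (distr M borel (Zs n)) borel g" for n
        by (subst distr_distr) (auto simp: comp_def)
      then show "distr M borel (\<lambda>x. g (Zs n x)) = distr M borel (\<lambda>x. g (Z x))" for n
        by (simp add: distr_eq distr_distr comp_def)
    qed (use sqi \<sigma> in auto)
    have "(\<lambda>n. integral\<^sup>L (distr M borel (\<lambda>x. (\<Sum>i<n. g (Zs i x)) / sqrt (n * \<sigma>\<^sup>2))) (\<lambda>y. cos (\<sigma> * y + c)))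
        \<longlonglongrightarrow> integral\<^sup>L std_normal_distribution (\<lambda>y. cos (\<sigma> * y + c))"
      by (rule weak_conv_imp_integral_bdd_continuous_conv[OF _ _ w, where B=1])
        (auto intro!: real_distribution_distr real_dist_normal_dist continuous_intros)
    moreover have "integral\<^sup>L (distr M borel (\<lambda>x. (\<Sum>i<n. g (Zs i x)) / sqrt (n * \<sigma>\<^sup>2))) (\<lambda>y. cos (\<sigma> * y + c))
        = expectation (\<lambda>x. cos (sqrt n * avg g (n, x) + c))" for n
    proof -
      have "\<sigma> * (s / sqrt (n * \<sigma>\<^sup>2)) = sqrt n * (s / n)" for s
        using \<sigma>(1) real_div_sqrt[of "real n"] by (cases "n = 0") (simp_all add: real_sqrt_mult field_simps)
      then show ?thesis by (subst integral_distr) (auto simp: avg_def)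
    qed
    moreover have "integral\<^sup>L std_normal_distribution (\<lambda>y. cos (\<sigma> * y + c)) = (\<integral>y. cos (y + c) \<partial>normal_law 0 v)"
    proof -
      interpret N: prob_space std_normal_distribution by (rule real_dist_normal_dist[THEN real_distribution.axioms(1)])
      have "distributed std_normal_distribution lborel (\<lambda>x. x) (normal_density 0 1)"
        unfolding distributed_def by (auto intro!: distr_id2)
      from N.normal_density_affine[OF this, of \<sigma> 0] \<sigma>
      have "distr std_normal_distribution lborel (\<lambda>x. \<sigma> * x) = density lborel (normal_density 0 \<sigma>)"
        by (simp add: distributed_def)
      also have "\<dots> = normal_law 0 v" using False by (simp add: normal_law_def \<sigma>_def)
      finally have "integral\<^sup>L (normal_law 0 v) (\<lambda>y. cos (y + c)) =
          integral\<^sup>L (distr std_normal_distribution lborel (\<lambda>x. \<sigma> * x)) (\<lambda>y. cos (y + c))" by simp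
      also have "\<dots> = integral\<^sup>L std_normal_distribution (\<lambda>y. cos (\<sigma> * y + c))"
        by (subst integral_distr) auto
      finally show ?thesis by simp
    qed
    ultimately show ?thesis unfolding v_def[symmetric] by simp
  qed
qed

end

context prob_space
begin

lemma expectation_diff_tendsto_0:
  fixes f g :: "nat \<Rightarrow> 'a \<Rightarrow> real"
  assumes [measurable]: "\<And>n. f n \<in> borel_measurable M" "\<And>n. g n \<in> borel_measurable M"
    and bd: "\<And>n x. \<bar>f n x\<bar> \<le> 1" "\<And>n x. \<bar>g n x\<bar> \<le> 1"
    and lim: "((\<lambda>w. f (fst w) (snd w) - g (fst w) (snd w)) \<longlongrightarrow> 0) (in_prob M)"
  shows "(\<lambda>n. expectation (f n) - expectation (g n)) \<longlonglongrightarrow> 0"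
  unfolding tendsto_iff
proof (intro allI impI)
  fix e :: real assume "0 < e"
  then have e: "0 < e/4" by simp
  have "\<forall>\<^sub>F n in sequentially. \<exists>E\<in>sets M. prob (space M - E) \<le> e/4 \<and> (\<forall>x\<in>E. dist (f n x - g n x) 0 < e/4)"
    using lim e unfolding tendsto_iff eventually_in_prob eventually_up_to_def by fastforce
  then show "\<forall>\<^sub>F n in sequentially. dist (expectation (f n) - expectation (g n)) 0 < e"
  proof eventually_elim
    case (elim n)
    then obtain E where E: "E \<in> sets M" "prob (space M - E) \<le> e/4" "\<forall>x\<in>E. dist (f n x - g n x) 0 < e/4" by blast
    have "\<bar>expectation (f n) - expectation (g n)\<bar> \<le> e/4 + (1 + 1) * (e/4)"
      by (rule integral_diff_le_on_event[where E=E]) (use E bd e in \<open>auto intro: less_imp_le\<close>)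
    then show ?case using \<open>0 < e\<close> by simp
  qed
qed

end

lemma abs_cos_diff_le: "\<bar>cos x - cos y\<bar> \<le> \<bar>x - y\<bar>" for x y :: real
proof -
  have "\<bar>cos x - cos y\<bar> = 2 * (\<bar>sin ((x + y) / 2)\<bar> * \<bar>sin ((y - x) / 2)\<bar>)"
    by (simp add: cos_diff_cos abs_mult)
  also have "\<dots> \<le> 2 * (1 * \<bar>(y - x) / 2\<bar>)"
    by (intro mult_left_mono mult_mono abs_sin_le_one abs_sin_x_le_abs_x) auto
  finally show ?thesis by simp
qed

text \<open>Cramer-Wold: each linear combination of the coordinates of V is asymptotically linear
  with the same combination of the \<open>\<psi> i\<close> as influence function, and because cos is
  1-Lipschitz the remainder disappears from the expectations. C consists of the expectations of
  \<open>\<psi> i\<close> times \<open>\<psi> j\<close>; it is positive semidefinite because its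
  quadratic form is the second moment of the combination.\<close>

theorem (in iid_sample) asym_linear_normal:
  fixes V :: "nat \<Rightarrow> 'a \<Rightarrow> real^'n" and c :: "real^'n"
  assumes [measurable]: "\<And>n. V n \<in> borel_measurable M"
    and lin: "\<And>i. asym_linear (\<lambda>w. V (fst w) (snd w) $ i) (c $ i) (\<psi> i)"
  obtains \<mu> C where "multivariate_normal 0 C \<mu>"
    "weak_limit (\<lambda>n. distr M borel (\<lambda>x. sqrt (real n) *\<^sub>R (V n x - c))) \<mu>"
    "\<And>i. prob_space.variance \<mu> (\<lambda>v. v $ i) = expectation (\<lambda>x. (\<psi> i (Z x))\<^sup>2)"
proof -
  have infl: "influence (\<psi> i)" for i using lin by (rule asym_linear_influence)
  have int: "integrable M (\<lambda>x. \<psi> i (Z x) * \<psi> j (Z x))" for i j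
    by (intro L2_fun_mult_integrable influence_L2 infl)
  define C :: "real^'n^'n" where "C = (\<chi> i j. expectation (\<lambda>x. \<psi> i (Z x) * \<psi> j (Z x)))"
  define g where "g t A = (\<Sum>i\<in>UNIV. t $ i * \<psi> i A)" for t :: "real^'n" and A
  have g: "influence (g t)" for t
    unfolding g_def by (intro influence_sum influence_cmult infl)
  have quad: "t \<bullet> (C *v t) = expectation (\<lambda>x. (g t (Z x))\<^sup>2)" for t
  proof -
    have "expectation (\<lambda>x. (g t (Z x))\<^sup>2) = expectation (\<lambda>x. \<Sum>i\<in>UNIV. \<Sum>j\<in>UNIV. t $ i * t $ j * (\<psi> i (Z x) * \<psi> j (Z x)))"
      by (simp add: g_def power2_eq_square sum_product mult_ac)
    also have "\<dots> = (\<Sum>i\<in>UNIV. \<Sum>j\<in>UNIV. t $ i * t $ j * expectation (\<lambda>x. \<psi> i (Z x) * \<psi> j (Z x)))"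
      using int by (simp add: Bochner_Integration.integral_sum)
    also have "\<dots> = t \<bullet> (C *v t)"
      by (simp add: inner_vec_def matrix_vector_mult_def C_def sum_distrib_left mult_ac)
    finally show ?thesis by simp
  qed
  have "pos_semidef C"
    unfolding pos_semidef_def quad by (simp add: transpose_eq_iff C_def mult.commute)
  then obtain \<mu> where \<mu>: "multivariate_normal 0 C \<mu>" by (rule multivariate_normal_exists)
  define U where "U n x = sqrt (real n) *\<^sub>R (V n x - c)" for n x
  have [measurable]: "U n \<in> borel_measurable M" for n unfolding U_def by measurable
  have [measurable]: "g t \<in> borel_measurable borel" for t using g by (auto simp: influence_def L2_fun_def)
  have "weak_limit (\<lambda>n. distr M borel (U n)) \<mu>"
  proof (rule weak_limit_of_cos)
    show "prob_space \<mu>" "sets \<mu> = sets borel" using \<mu> by (auto simp: multivariate_normal_def)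
    have "tight_seq M (\<lambda>w. \<Sum>i\<in>UNIV. \<bar>sqrt (fst w) * (V (fst w) (snd w) $ i - c $ i)\<bar>)"
      by (intro tight_seq_sum_abs asym_linear_tight[OF lin]) auto
    then show "tight_seq M (\<lambda>(n, x). norm (U n x))"
    proof (rule tight_seq_mono)
      fix w :: "nat \<times> 'a"
      have "norm (U (fst w) (snd w)) \<le> (\<Sum>i\<in>UNIV. \<bar>U (fst w) (snd w) $ i\<bar>)" by (rule norm_le_l1_cart)
      then show "\<bar>(\<lambda>(n, x). norm (U n x)) w\<bar> \<le> \<bar>\<Sum>i\<in>UNIV. \<bar>sqrt (fst w) * (V (fst w) (snd w) $ i - c $ i)\<bar>\<bar>"
        by (simp add: U_def split_beta)
    qed
    fix t :: "real^'n" and d :: real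
    have "asym_linear (\<lambda>w. \<Sum>i\<in>UNIV. t $ i * V (fst w) (snd w) $ i) (\<Sum>i\<in>UNIV. t $ i * c $ i) (g t)"
      unfolding g_def by (intro asym_linear_sum asym_linear_cmult lin)
    moreover define h where "h w = sqrt (fst w) * ((\<Sum>i\<in>UNIV. t $ i * V (fst w) (snd w) $ i) - (\<Sum>i\<in>UNIV. t $ i * c $ i) - avg (g t) w)" for w :: "nat \<times> 'a"
    ultimately have lim: "(h \<longlongrightarrow> 0) (in_prob M)" by (simp add: asym_linear_def h_def[abs_def])
    have Ut: "t \<bullet> U (fst w) (snd w) = sqrt (fst w) * avg (g t) w + h w" for w
      by (simp add: U_def h_def inner_vec_def sum_subtractf right_diff_distrib sum_distrib_left mult_ac)
    have "((\<lambda>w. cos (t \<bullet> U (fst w) (snd w) + d) - cos (sqrt (fst w) * avg (g t) (fst w, snd w) + d)) \<longlongrightarrow> 0) (in_prob M)"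
    proof (rule Lim_null_comparison[OF always_eventually tendsto_rabs_zero[OF lim]], rule allI)
      fix w :: "nat \<times> 'a"
      show "norm (cos (t \<bullet> U (fst w) (snd w) + d) - cos (sqrt (fst w) * avg (g t) (fst w, snd w) + d)) \<le> \<bar>h w\<bar>"
        using abs_cos_diff_le[of "t \<bullet> U (fst w) (snd w) + d" "sqrt (fst w) * avg (g t) w + d"] by (simp add: Ut)
    qed
    then have "(\<lambda>n. expectation (\<lambda>x. cos (t \<bullet> U n x + d)) - expectation (\<lambda>x. cos (sqrt n * avg (g t) (n, x) + d))) \<longlonglongrightarrow> 0"
      by (intro expectation_diff_tendsto_0) (auto simp: avg_def)
    from tendsto_add[OF this clt_cos[OF g, of t d]]
    show "(\<lambda>n. expectation (\<lambda>x. cos (t \<bullet> U n x + d))) \<longlonglongrightarrow> (\<integral>x. cos (t \<bullet> x + d) \<partial>\<mu>)"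
      using multivariate_normal_integral[OF \<mu>, of "\<lambda>y. cos (y + d)" t] by (simp add: quad)
  qed measurable
  moreover have "prob_space.variance \<mu> (\<lambda>v. v $ i) = expectation (\<lambda>x. (\<psi> i (Z x))\<^sup>2)" for i
    using multivariate_normal_variance[OF \<mu>, of i] by (simp add: C_def power2_eq_square)
  ultimately show ?thesis using \<mu> that unfolding U_def by blast
qed

section \<open>Moments of matrices with independent entries\<close>

text \<open>Groups a monomial, given as a list of indices, by entries, so that independence can
  factor its expectation.\<close>

lemma prod_list_eq_prod_count:
  "(\<Prod>i\<leftarrow>xs. f i) = (\<Prod>i\<in>(UNIV :: 'i::finite set). f i ^ count_list xs i)" for f :: "'i::finite \<Rightarrow> real"
proof (induction xs)
  case (Cons a xs)
  have "(\<Prod>i\<in>UNIV. f i ^ count_list (a # xs) i) = (\<Prod>i\<in>UNIV. (if i = a then f i else 1) * f i ^ count_list xs i)"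
    by (intro prod.cong) auto
  then show ?case using Cons by (simp add: prod.distrib)
qed simp

abbreviation entry :: "'p \<times> 'q \<Rightarrow> real^'q^'p \<Rightarrow> real" where
  "entry i A \<equiv> A $ fst i $ snd i"

lemma power_le_one_plus_power: "\<bar>x\<bar> ^ k \<le> 1 + \<bar>x\<bar> ^ n" if "k \<le> n" for x :: real
proof (cases "\<bar>x\<bar> \<le> 1")
  case True
  then have "\<bar>x\<bar> ^ k \<le> 1" by (simp add: power_le_one)
  then show ?thesis using zero_le_power[of "\<bar>x\<bar>" n] by linarith
next
  case False
  then have "\<bar>x\<bar> ^ k \<le> \<bar>x\<bar> ^ n" using that by (intro power_increasing) auto
  then show ?thesis by linarith
qed

definition kron :: "'i \<Rightarrow> 'i \<Rightarrow> real" where "kron i j = (if i = j then 1 else 0)"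

locale independent_entries = iid_sample M Z Zs
  for M :: "'a measure" and Z :: "'a \<Rightarrow> real^'q^'p" and Zs +
  assumes entries_indep: "indep_vars (\<lambda>_. borel) (\<lambda>i x. entry i (Z x)) UNIV"
    and eighth_moment: "integrable M (\<lambda>x. (entry i (Z x)) ^ 8)"
    and entry_mean: "expectation (\<lambda>x. entry i (Z x)) = 0"
    and entry_variance: "expectation (\<lambda>x. (entry i (Z x))\<^sup>2) = 1"
begin

definition moment :: "'p \<times> 'q \<Rightarrow> nat \<Rightarrow> real" where
  "moment i k = expectation (\<lambda>x. (entry i (Z x)) ^ k)"

abbreviation "\<gamma> i \<equiv> moment i 3"
abbreviation "\<beta> i \<equiv> moment i 4"
abbreviation "cube_var i \<equiv> moment i 6 - (moment i 3)\<^sup>2"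

lemma moment_simps [simp]: "moment i 0 = 1" "moment i (Suc 0) = 0" "moment i 2 = 1" "moment i (Suc (Suc 0)) = 1"
  using entry_mean entry_variance by (simp_all add: moment_def prob_space flip: numeral_2_eq_2)

lemma entry_borel [measurable]: "entry i \<in> borel_measurable borel"
  by (intro borel_measurable_continuous_onI continuous_intros)

lemma entry_measurable [measurable]: "(\<lambda>x. entry i (Z x)) \<in> borel_measurable M"
  using measurable_compose[OF Z_measurable entry_borel] .

lemma entry_power_integrable: "k \<le> 8 \<Longrightarrow> integrable M (\<lambda>x. (entry i (Z x)) ^ k)"
proof (rule Bochner_Integration.integrable_bound)
  show "integrable M (\<lambda>x. 1 + (entry i (Z x)) ^ 8)" using eighth_moment[of i] by simp
  assume "k \<le> 8"
  then show "AE x in M. norm ((entry i (Z x)) ^ k) \<le> norm (1 + (entry i (Z x)) ^ 8)"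
    using power_le_one_plus_power[of k 8] by (intro AE_I2) (simp add: power_abs power_even_abs)
qed measurable

lemma
  assumes "\<And>i. f i \<in> borel_measurable borel" "\<And>i. integrable M (\<lambda>x. f i (entry i (Z x)) :: real)"
  shows expectation_prod_entries:
      "expectation (\<lambda>x. \<Prod>i\<in>UNIV. f i (entry i (Z x))) = (\<Prod>i\<in>UNIV. expectation (\<lambda>x. f i (entry i (Z x))))"
    and integrable_prod_entries: "integrable M (\<lambda>x. \<Prod>i\<in>UNIV. f i (entry i (Z x)))"
proof -
  have "indep_vars (\<lambda>_. borel) (\<lambda>i x. f i (entry i (Z x))) UNIV"
    using indep_vars_compose2[OF entries_indep, of f "\<lambda>_. borel"] assms(1) by auto
  then show "expectation (\<lambda>x. \<Prod>i\<in>UNIV. f i (entry i (Z x))) = (\<Prod>i\<in>UNIV. expectation (\<lambda>x. f i (entry i (Z x))))"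
    "integrable M (\<lambda>x. \<Prod>i\<in>UNIV. f i (entry i (Z x)))"
    using assms(2) by (auto intro!: indep_vars_lebesgue_integral indep_vars_integrable)
qed

lemma expectation_prod_list:
  assumes "length xs \<le> 8"
  shows "expectation (\<lambda>x. \<Prod>i\<leftarrow>xs. entry i (Z x)) = (\<Prod>i\<in>UNIV. moment i (count_list xs i))"
  unfolding prod_list_eq_prod_count moment_def
  using assms count_le_length[of xs]
  by (intro expectation_prod_entries) (auto intro!: entry_power_integrable intro: order_trans)

text \<open>An index that occurs once contributes its mean, which is 0, as a factor.\<close>

lemma expectation_prod_list_0:
  assumes "length xs \<le> 8" "count_list xs i = 1"
  shows "expectation (\<lambda>x. \<Prod>i\<leftarrow>xs. entry i (Z x)) = 0"
  unfolding expectation_prod_list[OF assms(1)] using assms(2) by (intro prod_zero bexI[of _ i]) simp_all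

lemma expectation_prod_list_set:
  assumes "length xs \<le> 8"
  shows "expectation (\<lambda>x. \<Prod>i\<leftarrow>xs. entry i (Z x)) = (\<Prod>i\<in>set xs. moment i (count_list xs i))"
  unfolding expectation_prod_list[OF assms(1)]
  by (intro prod.mono_neutral_right) (auto simp: count_list_0_iff)

text \<open>The fourth moment tensor of the entries: the three pairings that Gaussian entries would
  give, plus the fourth cumulant \<beta> - 3 where all four indices agree.\<close>

definition \<tau> :: "'p \<times> 'q \<Rightarrow> 'p \<times> 'q \<Rightarrow> 'p \<times> 'q \<Rightarrow> 'p \<times> 'q \<Rightarrow> real" where
  "\<tau> i j k l = kron i j * kron k l + kron i k * kron j l + kron i l * kron j k + (\<beta> i - 3) * (kron i j * kron i k * kron i l)"

lemma expectation_entry2: "expectation (\<lambda>x. entry i (Z x) * entry j (Z x)) = kron i j"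
proof (cases "i = j")
  case True
  then show ?thesis using entry_variance by (simp add: kron_def power2_eq_square)
next
  case False
  then show ?thesis using expectation_prod_list_0[of "[i, j]" i] by (simp add: kron_def)
qed

lemma expectation_entry3:
  "expectation (\<lambda>x. entry i (Z x) * entry j (Z x) * entry k (Z x)) = \<gamma> i * (kron i j * kron i k)"
proof (cases "i = j \<and> i = k")
  case True
  then have "j = i" "k = i" by auto
  then show ?thesis by (simp add: kron_def moment_def power3_eq_cube)
next
  case False
  then have "count_list [i, j, k] i = 1 \<or> count_list [i, j, k] j = 1 \<or> count_list [i, j, k] k = 1"
    by auto
  then obtain c where "count_list [i, j, k] c = 1" by blast
  from expectation_prod_list_0[OF _ this] False show ?thesis by (auto simp: kron_def mult.assoc)
qed

text \<open>An index that occurs exactly once makes both sides 0. Otherwise the four indices fall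
  into pairs, and the few coincidence patterns are evaluated.\<close>

lemma expectation_entry4:
  "expectation (\<lambda>x. entry i (Z x) * entry j (Z x) * entry k (Z x) * entry l (Z x)) = \<tau> i j k l"
proof -
  have e: "expectation (\<lambda>x. entry i (Z x) * entry j (Z x) * entry k (Z x) * entry l (Z x)) =
    expectation (\<lambda>x. \<Prod>c\<leftarrow>[i, j, k, l]. entry c (Z x))" by (simp add: mult.assoc)
  show ?thesis
  proof (cases "\<exists>c. count_list [i, j, k, l] c = 1")
    case True
    then obtain c where c: "count_list [i, j, k, l] c = 1" by blast
    then have "\<tau> i j k l = 0"
      by (auto simp: \<tau>_def kron_def split: if_splits)
    then show ?thesis unfolding e using expectation_prod_list_0[OF _ c] by simp
  next
    case False
    then have "count_list [i, j, k, l] i \<noteq> 1 \<and> count_list [i, j, k, l] j \<noteq> 1 \<and>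
        count_list [i, j, k, l] k \<noteq> 1 \<and> count_list [i, j, k, l] l \<noteq> 1"
      by blast
    then have "(i = j \<and> k = l) \<or> (i = k \<and> j = l) \<or> (i = l \<and> j = k)"
      by (cases "i = j"; cases "i = k"; cases "i = l"; cases "j = k"; cases "j = l"; cases "k = l") auto
    moreover have "expectation (\<lambda>x. \<Prod>c\<leftarrow>[i, j, k, l]. entry c (Z x)) =
        (\<Prod>c\<in>set [i, j, k, l]. moment c (count_list [i, j, k, l] c))"
      by (rule expectation_prod_list_set) simp
    ultimately show ?thesis unfolding e
      by (auto simp: \<tau>_def kron_def numeral_eq_Suc insert_commute)
  qed
qed

text \<open>\<open>None\<close> stands for the factor 1, so that square integrability of all
  monomials of degree at most four becomes one statement about four factors.\<close>

definition feature :: "('p \<times> 'q) option \<Rightarrow> real^'q^'p \<Rightarrow> real" where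
  "feature u A = (case u of None \<Rightarrow> 1 | Some i \<Rightarrow> entry i A)"

text \<open>The eighth moments enter here: using x y <= x^2 + y^2 for nonnegative x, y twice bounds
  the squared product of four factors by the sum of their eighth powers.\<close>

lemma L2_fun_features: "L2_fun (\<lambda>A. feature a A * feature b A * feature c A * feature d A)"
  unfolding L2_fun_def
proof
  have [measurable]: "feature u \<in> borel_measurable borel" for u :: "('p \<times> 'q) option"
    unfolding feature_def by (cases u) auto
  show "(\<lambda>A. feature a A * feature b A * feature c A * feature d A) \<in> borel_measurable borel"
    by measurable
  have 8: "integrable M (\<lambda>x. (feature u (Z x)) ^ 8)" for u
    unfolding feature_def using eighth_moment by (cases u) auto
  show "integrable M (\<lambda>x. (feature a (Z x) * feature b (Z x) * feature c (Z x) * feature d (Z x))\<^sup>2)"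
  proof (rule Bochner_Integration.integrable_bound)
    show "integrable M (\<lambda>x. (feature a (Z x)) ^ 8 + (feature b (Z x)) ^ 8 + (feature c (Z x)) ^ 8 + (feature d (Z x)) ^ 8)"
      using 8 by auto
    have "(u * v * w * t)\<^sup>2 \<le> u ^ 8 + v ^ 8 + w ^ 8 + t ^ 8" for u v w t :: real
    proof -
      have 2: "x * y \<le> x\<^sup>2 + y\<^sup>2" if "0 \<le> x" "0 \<le> y" for x y :: real
        using sum_squares_bound[of x y] mult_nonneg_nonneg[OF that] by linarith
      have "(u * v * w * t)\<^sup>2 = (u\<^sup>2 * v\<^sup>2) * (w\<^sup>2 * t\<^sup>2)" by (simp add: power_mult_distrib)
      also have "\<dots> \<le> (u\<^sup>2 * v\<^sup>2)\<^sup>2 + (w\<^sup>2 * t\<^sup>2)\<^sup>2" by (rule 2) auto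
      also have "\<dots> = u ^ 4 * v ^ 4 + w ^ 4 * t ^ 4" by (simp add: power_mult_distrib flip: power_mult)
      also have "\<dots> \<le> ((u ^ 4)\<^sup>2 + (v ^ 4)\<^sup>2) + ((w ^ 4)\<^sup>2 + (t ^ 4)\<^sup>2)" by (intro add_mono 2) auto
      finally show ?thesis by (simp flip: power_mult)
    qed
    then show "AE x in M. norm ((feature a (Z x) * feature b (Z x) * feature c (Z x) * feature d (Z x))\<^sup>2) \<le>
       norm ((feature a (Z x)) ^ 8 + (feature b (Z x)) ^ 8 + (feature c (Z x)) ^ 8 + (feature d (Z x)) ^ 8)"
      by (intro AE_I2) simp
  qed measurable
qed

lemma L2_fun_entries:
  "L2_fun (entry i)" "L2_fun (\<lambda>A. entry i A * entry j A)" "L2_fun (\<lambda>A. entry i A * entry j A * entry k A)"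
  "L2_fun (\<lambda>A. entry i A * entry j A * entry k A * entry l A)"
  using L2_fun_features[of "Some i" None None None] L2_fun_features[of "Some i" "Some j" None None]
    L2_fun_features[of "Some i" "Some j" "Some k" None] L2_fun_features[of "Some i" "Some j" "Some k" "Some l"]
  by (simp_all add: feature_def)

text \<open>Products of centered functions of single entries: \<open>e i\<close> selects $1$, $z$, $z^2 - 1$ or
  $z^3 - \gamma$ in coordinate \<open>i\<close>. Two such products are orthogonal unless they depend on the same
  set of coordinates.\<close>

definition base :: "'p \<times> 'q \<Rightarrow> nat \<Rightarrow> real \<Rightarrow> real" where
  "base i s z = (if s = 0 then 1 else if s = 1 then z else if s = 2 then z\<^sup>2 - 1 else z ^ 3 - \<gamma> i)"

definition basis_prod :: "('p \<times> 'q \<Rightarrow> nat) \<Rightarrow> real^'q^'p \<Rightarrow> real" where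
  "basis_prod e A = (\<Prod>i\<in>UNIV. base i (e i) (entry i A))"

definition gram :: "'p \<times> 'q \<Rightarrow> nat \<Rightarrow> nat \<Rightarrow> real" where
  "gram i s t = expectation (\<lambda>x. base i s (entry i (Z x)) * base i t (entry i (Z x)))"

definition inner_L2 :: "(real^'q^'p \<Rightarrow> real) \<Rightarrow> (real^'q^'p \<Rightarrow> real) \<Rightarrow> real" where
  "inner_L2 f g = expectation (\<lambda>x. f (Z x) * g (Z x))"

lemma base_measurable [measurable]: "base i s \<in> borel_measurable borel"
  unfolding base_def by (cases "s = 0"; cases "s = 1"; cases "s = 2") auto

lemma base_mult_integrable: "integrable M (\<lambda>x. base i s (entry i (Z x)) * base i t (entry i (Z x)))"
proof -
  have *: "integrable M (\<lambda>x. (base i s (entry i (Z x)))\<^sup>2)" for s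
  proof -
    let ?z = "\<lambda>x. entry i (Z x)"
    have p: "integrable M (\<lambda>x. ?z x ^ k)" if "k \<le> 8" for k using entry_power_integrable[OF that] .
    have "integrable M (\<lambda>x. (?z x ^ 2 - 1)\<^sup>2)"
    proof -
      have "(?z x ^ 2 - 1)\<^sup>2 = ?z x ^ 4 - 2 * ?z x ^ 2 + 1" for x
        by (simp add: power2_diff flip: power_mult)
      then show ?thesis using p[of 4] p[of 2] by simp
    qed
    moreover have "integrable M (\<lambda>x. (?z x ^ 3 - \<gamma> i)\<^sup>2)"
    proof -
      have "(?z x ^ 3 - \<gamma> i)\<^sup>2 = ?z x ^ 6 + (\<gamma> i)\<^sup>2 - 2 * (?z x ^ 3 * \<gamma> i)" for x
        by (simp add: power2_diff flip: power_mult)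
      then show ?thesis using p[of 6] p[of 3] by simp
    qed
    ultimately show ?thesis using p[of 2]
      by (cases "s = 0"; cases "s = 1"; cases "s = 2") (auto simp: base_def)
  qed
  have "L2_fun (\<lambda>A. base i s (entry i A))" for s using * by (auto simp: L2_fun_def)
  from L2_fun_mult_integrable[OF this[of s] this[of t]] show ?thesis .
qed

text \<open>Index 0 is the constant 1 and the other functions are centered, whence the zeros.
  Indices 1 and 3 are not orthogonal: their inner product \<beta> is the origin of the products of
  fourth moments in the asymptotic variance.\<close>

lemma gram_simps [simp]:
  "gram i 0 0 = 1" "gram i 0 (Suc s) = 0" "gram i (Suc s) 0 = 0" "gram i (Suc 0) (Suc 0) = 1"
  "gram i 2 2 = \<beta> i - 1" "gram i 3 3 = cube_var i" "gram i (Suc 0) 3 = \<beta> i" "gram i 3 (Suc 0) = \<beta> i"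
proof -
  let ?z = "\<lambda>x. entry i (Z x)"
  have p: "integrable M (\<lambda>x. ?z x ^ k)" if "k \<le> 8" for k using entry_power_integrable[OF that] .
  have p1: "integrable M ?z" using p[of 1] by simp
  show "gram i 0 0 = 1" by (simp add: gram_def base_def prob_space)
  have "expectation (\<lambda>x. base i (Suc s) (?z x)) = 0"
    using p[of 2] p[of 3] p1 entry_mean[of i] entry_variance[of i]
    by (cases "s = 0"; cases "s = 1") (auto simp: base_def prob_space moment_def)
  then show "gram i 0 (Suc s) = 0" "gram i (Suc s) 0 = 0" by (simp_all add: gram_def base_def[of _ 0])
  show "gram i (Suc 0) (Suc 0) = 1"
    using entry_variance[of i] by (simp add: gram_def base_def power2_eq_square)
  have "(?z x ^ 2 - 1) * (?z x ^ 2 - 1) = ?z x ^ 4 - 2 * ?z x ^ 2 + 1" for x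
    by (simp add: algebra_simps power2_eq_square power4_eq_xxxx)
  then show "gram i 2 2 = \<beta> i - 1"
    using p[of 4] p[of 2] entry_variance[of i] by (simp add: gram_def base_def prob_space moment_def)
  have "(?z x ^ 3 - \<gamma> i) * (?z x ^ 3 - \<gamma> i) = ?z x ^ 6 + (\<gamma> i)\<^sup>2 - 2 * (\<gamma> i * ?z x ^ 3)" for x
    by (simp add: algebra_simps power2_eq_square eval_nat_numeral)
  then show "gram i 3 3 = cube_var i"
    using p[of 6] p[of 3] by (simp add: gram_def base_def prob_space moment_def[symmetric] power2_eq_square)
  have "?z x * (?z x ^ 3 - \<gamma> i) = ?z x ^ 4 - \<gamma> i * ?z x" "(?z x ^ 3 - \<gamma> i) * ?z x = ?z x ^ 4 - \<gamma> i * ?z x" for x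
    by (simp_all add: algebra_simps eval_nat_numeral)
  then show "gram i (Suc 0) 3 = \<beta> i" "gram i 3 (Suc 0) = \<beta> i"
    using p[of 4] p1 entry_mean[of i] by (simp_all add: gram_def base_def moment_def[symmetric])
qed

lemma inner_basis_prod: "inner_L2 (basis_prod e) (basis_prod e') = (\<Prod>i\<in>UNIV. gram i (e i) (e' i))"
  unfolding inner_L2_def basis_prod_def gram_def prod.distrib[symmetric]
  by (rule expectation_prod_entries) (auto simp: base_mult_integrable)

lemma L2_fun_basis_prod: "L2_fun (basis_prod e)"
  unfolding L2_fun_def
proof
  show "basis_prod e \<in> borel_measurable borel" unfolding basis_prod_def by measurable
  show "integrable M (\<lambda>x. (basis_prod e (Z x))\<^sup>2)"
    unfolding basis_prod_def power2_eq_square prod.distrib[symmetric]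
    by (rule integrable_prod_entries) (auto simp: base_mult_integrable)
qed

lemma basis_prod_0: "basis_prod (\<lambda>_. 0) A = 1"
  by (simp add: basis_prod_def base_def)

text \<open>Assembles a basis product from the constant 1, one entry at a time. Together with
  \<open>inner_basis_prod_upd\<close> this lets rewriting evaluate concrete inner products.\<close>

lemma basis_prod_upd:
  assumes "e i = 0"
  shows "basis_prod (e(i := s)) A = base i s (entry i A) * basis_prod e A"
proof -
  have "basis_prod (e(i := s)) A = (\<Prod>j\<in>UNIV. (if j = i then base i s (entry i A) else 1) * base j (e j) (entry j A))"
    unfolding basis_prod_def using assms by (intro prod.cong) (auto simp: base_def)
  then show ?thesis by (simp add: prod.distrib basis_prod_def)
qed

lemma inner_basis_prod_0: "inner_L2 (basis_prod (\<lambda>_. 0)) (basis_prod (\<lambda>_. 0)) = 1"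
  by (simp add: inner_basis_prod)

lemma inner_basis_prod_upd:
  assumes "e i = 0" "e' i = 0"
  shows "inner_L2 (basis_prod (e(i := s))) (basis_prod (e'(i := t))) = gram i s t * inner_L2 (basis_prod e) (basis_prod e')"
proof -
  have "(\<Prod>j\<in>UNIV. gram j ((e(i := s)) j) ((e'(i := t)) j)) =
      (\<Prod>j\<in>UNIV. (if j = i then gram i s t else 1) * gram j (e j) (e' j))"
    using assms by (intro prod.cong) auto
  then show ?thesis by (simp add: prod.distrib inner_basis_prod)
qed

text \<open>The component of the Hoeffding decomposition that belongs to the set S of entries, as
  far as basis products span it: each entry in S carries a centered factor and no other entry
  occurs.\<close>

inductive pure :: "('p \<times> 'q) set \<Rightarrow> (real^'q^'p \<Rightarrow> real) \<Rightarrow> bool" where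
  basis: "{i. e i \<noteq> 0} = S \<Longrightarrow> pure S (basis_prod e)"
| add: "pure S f \<Longrightarrow> pure S g \<Longrightarrow> pure S (\<lambda>A. f A + g A)"
| cmult: "pure S f \<Longrightarrow> pure S (\<lambda>A. c * f A)"

lemma pure_L2: "pure S f \<Longrightarrow> L2_fun f"
  by (induction rule: pure.induct) (auto intro: L2_fun_basis_prod L2_fun_add L2_fun_cmult)

lemma inner_L2_add_left: "L2_fun f \<Longrightarrow> L2_fun g \<Longrightarrow> L2_fun h \<Longrightarrow>
    inner_L2 (\<lambda>A. f A + g A) h = inner_L2 f h + inner_L2 g h"
  by (simp add: inner_L2_def distrib_right L2_fun_mult_integrable)

lemma inner_L2_cmult_left: "inner_L2 (\<lambda>A. c * f A) h = c * inner_L2 f h"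
  by (simp add: inner_L2_def mult.assoc)

lemma inner_L2_commute: "inner_L2 f g = inner_L2 g f"
  by (simp add: inner_L2_def mult.commute)

lemma inner_L2_add_right: "L2_fun f \<Longrightarrow> L2_fun g \<Longrightarrow> L2_fun h \<Longrightarrow>
    inner_L2 h (\<lambda>A. f A + g A) = inner_L2 h f + inner_L2 h g"
  by (simp add: inner_L2_commute[of h] inner_L2_add_left)

lemma inner_L2_cmult_right: "inner_L2 h (\<lambda>A. c * f A) = c * inner_L2 h f"
  by (simp add: inner_L2_commute[of h] inner_L2_cmult_left)

lemma inner_L2_sum_left: "(\<And>j. j \<in> J \<Longrightarrow> L2_fun (f j)) \<Longrightarrow> L2_fun h \<Longrightarrow>
    inner_L2 (\<lambda>A. \<Sum>j\<in>J. f j A) h = (\<Sum>j\<in>J. inner_L2 (f j) h)"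
proof (induction J rule: infinite_finite_induct)
  case (insert j J)
  then have "L2_fun (f j)" "L2_fun (\<lambda>A. \<Sum>j\<in>J. f j A)" by (auto intro: L2_fun_sum)
  then show ?case using insert by (simp add: inner_L2_add_left)
qed (auto simp: inner_L2_def)

lemma inner_L2_sum_right: "(\<And>j. j \<in> J \<Longrightarrow> L2_fun (f j)) \<Longrightarrow> L2_fun h \<Longrightarrow>
    inner_L2 h (\<lambda>A. \<Sum>j\<in>J. f j A) = (\<Sum>j\<in>J. inner_L2 h (f j))"
  by (simp add: inner_L2_commute[of h] inner_L2_sum_left)

text \<open>At an entry in exactly one of the supports a centered factor meets the constant 1, and
  its mean 0 annihilates the product. Bilinearity extends this from basis products to both
  spans.\<close>

lemma pure_orthogonal:
  assumes "pure S f" "pure T g" "S \<noteq> T"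
  shows "inner_L2 f g = 0"
proof -
  have b: "inner_L2 (basis_prod e) (basis_prod e') = 0" if ne: "{i. e i \<noteq> 0} \<noteq> {i. e' i \<noteq> 0}" for e e'
  proof -
    obtain i where i: "(e i = 0) \<noteq> (e' i = 0)"
      using ne by (metis (mono_tags, lifting) Collect_cong)
    then have "gram i (e i) (e' i) = 0"
      by (cases "e i"; cases "e' i") auto
    then show ?thesis unfolding inner_basis_prod by (intro prod_zero bexI[of _ i]) simp_all
  qed
  have *: "inner_L2 (basis_prod e) g = 0" if ne: "{i. e i \<noteq> 0} \<noteq> T" for e
    using assms(2) ne
  proof (induction rule: pure.induct)
    case (add S f g)
    then show ?case by (simp add: inner_L2_add_right L2_fun_basis_prod pure_L2)
  qed (auto simp: b inner_L2_cmult_right)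
  show ?thesis using assms(1,3)
  proof (induction rule: pure.induct)
    case (add S f g')
    then show ?case using assms(2) by (simp add: inner_L2_add_left pure_L2)
  qed (auto simp: * inner_L2_cmult_left)
qed

lemma inner_pure_sums:
  assumes "finite I" "finite J" "\<And>i. i \<in> I \<Longrightarrow> pure (S i) (f i)" "\<And>j. j \<in> J \<Longrightarrow> pure (T j) (g j)"
    and "\<And>i j. i \<in> I \<Longrightarrow> j \<in> J \<Longrightarrow> S i \<noteq> T j"
  shows "inner_L2 (\<lambda>A. \<Sum>i\<in>I. f i A) (\<lambda>A. \<Sum>j\<in>J. g j A) = 0"
proof -
    have Lg: "L2_fun (\<lambda>A. \<Sum>j\<in>J. g j A)" using assms(4) by (intro L2_fun_sum) (auto intro: pure_L2)
    have Lf: "L2_fun (f i)" if "i \<in> I" for i using assms(3) that pure_L2 by blast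
    have "inner_L2 (\<lambda>A. \<Sum>i\<in>I. f i A) (\<lambda>A. \<Sum>j\<in>J. g j A) = (\<Sum>i\<in>I. inner_L2 (f i) (\<lambda>A. \<Sum>j\<in>J. g j A))"
      by (rule inner_L2_sum_left[OF Lf Lg])
    also have "\<dots> = (\<Sum>i\<in>I. \<Sum>j\<in>J. inner_L2 (f i) (g j))"
      using assms(4) by (intro sum.cong refl inner_L2_sum_right) (auto intro: pure_L2 Lf)
    also have "\<dots> = (\<Sum>i\<in>I. \<Sum>j\<in>J. 0)"
      using assms(3-5) by (intro sum.cong refl pure_orthogonal) auto
    finally show ?thesis by simp
qed

lemma norm_pure_sum:
  assumes "finite I" "\<And>i. i \<in> I \<Longrightarrow> pure (S i) (f i)" "inj_on S I"
  shows "inner_L2 (\<lambda>A. \<Sum>i\<in>I. f i A) (\<lambda>A. \<Sum>i\<in>I. f i A) = (\<Sum>i\<in>I. inner_L2 (f i) (f i))"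
proof -
  have Lf: "L2_fun (f i)" if "i \<in> I" for i using assms(2) that pure_L2 by blast
  have "inner_L2 (\<lambda>A. \<Sum>i\<in>I. f i A) (\<lambda>A. \<Sum>j\<in>I. f j A) = (\<Sum>i\<in>I. inner_L2 (f i) (\<lambda>A. \<Sum>j\<in>I. f j A))"
    by (rule inner_L2_sum_left[OF Lf L2_fun_sum[OF Lf]])
  also have "\<dots> = (\<Sum>i\<in>I. \<Sum>j\<in>I. inner_L2 (f i) (f j))"
    by (intro sum.cong refl inner_L2_sum_right Lf)
  also have "\<dots> = (\<Sum>i\<in>I. \<Sum>j\<in>I. if j = i then inner_L2 (f i) (f i) else 0)"
  proof (intro sum.cong refl)
    fix i j assume ij: "i \<in> I" "j \<in> I"
    show "inner_L2 (f i) (f j) = (if j = i then inner_L2 (f i) (f i) else 0)"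
    proof (cases "j = i")
      case False
      then have "S i \<noteq> S j" using assms(3) ij by (auto dest: inj_onD)
      then show ?thesis using False pure_orthogonal[OF assms(2)[OF ij(1)] assms(2)[OF ij(2)]] by simp
    qed simp
  qed
  also have "\<dots> = (\<Sum>i\<in>I. inner_L2 (f i) (f i))" using assms(1) by simp
  finally show ?thesis .
qed

end

section \<open>Linearization of the MFOBI matrices\<close>

lemma (in iid_sample) asym_linear_eq:
  assumes "asym_linear f c g" "\<forall>\<^sub>F w in in_prob M. f' w = f w" "c = c'" "\<And>A. g A = g' A"
  shows "asym_linear f' c' g'"
proof -
  have "g = g'" using assms(4) by auto
  then show ?thesis using asym_linear_cong[OF assms(1,2)] assms(3) by simp
qed

lemma (in iid_sample) asym_linear_diff:
  assumes "asym_linear f c g" "asym_linear f' c' g'"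
  shows "asym_linear (\<lambda>w. f w - f' w) (c - c') (\<lambda>A. g A - g' A)"
  using asym_linear_add[OF assms(1) asym_linear_cmult[OF assms(2), of "-1"]] by simp

lemma sum_kron [simp]:
  "(\<Sum>c\<in>UNIV. kron i c * f c) = f i" "(\<Sum>c\<in>UNIV. f c * kron i c) = f i"
  "(\<Sum>c\<in>UNIV. kron c i * f c) = f i" "(\<Sum>c\<in>UNIV. f c * kron c i) = f i"
  for f :: "'i::finite \<Rightarrow> real"
  by (simp_all add: kron_def if_distrib[of "\<lambda>x. x * _"] if_distrib[of "\<lambda>x. _ * x"] cong: if_cong)

text \<open>The remainder in \<open>inv_sqrt_near_one\<close> is quadratic in S - 1, which is O_P(1
  / sqrt n), so it vanishes even after scaling by sqrt n. What remains is the affine map 1 - (S - 1)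
  / 2 = 3/2 - S / 2.\<close>

lemma (in iid_sample) asym_linear_inv_sqrt:
  fixes S :: "nat \<times> 'a \<Rightarrow> real^'n^'n"
  assumes sym: "\<And>w. transpose (S w) = S w"
    and lin: "\<And>i j. asym_linear (\<lambda>w. S w $ i $ j) (kron i j) (s i j)"
  shows "\<forall>\<^sub>F w in in_prob M. norm (S w - mat 1) \<le> 1/4"
    and "asym_linear (\<lambda>w. inv_sqrt (S w) $ i $ j) (kron i j) (\<lambda>A. - (1/2) * s i j A)"
proof -
  have ent: "(S w - mat 1) $ i $ j = S w $ i $ j - kron i j" for w i j
    by (simp add: mat_def kron_def)
  have sq: "((\<lambda>w. sqrt (fst w) * (norm (S w - mat 1))\<^sup>2) \<longlongrightarrow> 0) (in_prob M)"
  proof -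
    have "((\<lambda>w. \<Sum>i\<in>UNIV. \<Sum>j\<in>UNIV. sqrt (fst w) * (S w $ i $ j - kron i j) * (S w $ i $ j - kron i j)) \<longlongrightarrow> 0) (in_prob M)"
      by (intro tendsto_null_sum tight_mult_tendsto_0 asym_linear_tight[OF lin] LIM_zero asym_linear_tendsto[OF lin])
    moreover have "(\<Sum>i\<in>UNIV. \<Sum>j\<in>UNIV. sqrt (fst w) * (S w $ i $ j - kron i j) * (S w $ i $ j - kron i j)) =
        sqrt (fst w) * (norm (S w - mat 1))\<^sup>2" for w :: "nat \<times> 'a"
      unfolding norm_sq_matrix ent by (simp add: sum_distrib_left power2_eq_square mult.assoc)
    ultimately show ?thesis by simp
  qed
  have "((\<lambda>w. S w - mat 1) \<longlongrightarrow> 0) (in_prob M)"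
    by (intro vec_tendstoI) (simp add: ent[unfolded vector_minus_component] LIM_zero asym_linear_tendsto[OF lin])
  then have "((\<lambda>w. norm (S w - mat 1)) \<longlongrightarrow> 0) (in_prob M)" by (rule tendsto_norm_zero)
  then have "\<forall>\<^sub>F w in in_prob M. norm (S w - mat 1) < 1/4" by (rule order_tendstoD) simp
  then show near: "\<forall>\<^sub>F w in in_prob M. norm (S w - mat 1) \<le> 1/4" by (rule eventually_mono) simp
  have "((\<lambda>w. sqrt (fst w) * (inv_sqrt (S w) $ i $ j - (3/2 * kron i j + - (1/2) * S w $ i $ j))) \<longlongrightarrow> 0) (in_prob M)"
  proof (rule Lim_null_comparison)
    show "((\<lambda>w. 2 * (sqrt (fst w) * (norm (S w - mat 1))\<^sup>2)) \<longlongrightarrow> 0) (in_prob M)"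
      using tendsto_mult_right_zero[OF sq] .
    show "\<forall>\<^sub>F w in in_prob M. norm (sqrt (fst w) * (inv_sqrt (S w) $ i $ j - (3/2 * kron i j + - (1/2) * S w $ i $ j)))
        \<le> 2 * (sqrt (fst w) * (norm (S w - mat 1))\<^sup>2)"
      using near
    proof eventually_elim
      case (elim w)
      let ?D = "inv_sqrt (S w) - mat 1 + (1/2) *\<^sub>R (S w - mat 1)"
      have "\<bar>?D $ i $ j\<bar> \<le> norm ?D"
        by (rule order_trans[OF component_le_norm_cart Finite_Cartesian_Product.norm_nth_le])
      also have "\<dots> \<le> 2 * (norm (S w - mat 1))\<^sup>2"
        by (rule inv_sqrt_near_one[OF sym elim])
      also have "?D $ i $ j = inv_sqrt (S w) $ i $ j - (3/2 * kron i j + - (1/2) * S w $ i $ j)"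
        by (simp add: mat_def kron_def field_simps)
      finally have "sqrt (fst w) * \<bar>inv_sqrt (S w) $ i $ j - (3/2 * kron i j + - (1/2) * S w $ i $ j)\<bar>
          \<le> sqrt (fst w) * (2 * (norm (S w - mat 1))\<^sup>2)"
        by (intro mult_left_mono) auto
      then show ?case unfolding real_norm_def abs_mult by simp
    qed
  qed
  moreover have "asym_linear (\<lambda>w. 3/2 * kron i j + - (1/2) * S w $ i $ j) (3/2 * kron i j + - (1/2) * kron i j) (\<lambda>A. 0 + - (1/2) * s i j A)"
    by (intro asym_linear_add asym_linear_const asym_linear_cmult lin)
  ultimately show "asym_linear (\<lambda>w. inv_sqrt (S w) $ i $ j) (kron i j) (\<lambda>A. - (1/2) * s i j A)"
    using asym_linear_close by simp
qed

text \<open>The product rule for weights that tend to the identity: of the F only the one at index i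
  keeps its own influence function, and the fluctuations of the weights act on the limits t.\<close>

lemma (in iid_sample) asym_linear_contract:
  fixes W F :: "'i::finite \<Rightarrow> nat \<times> 'a \<Rightarrow> real"
  assumes "\<And>c. asym_linear (W c) (kron i c) (v c)" "\<And>c. asym_linear (F c) (t c) (g c)"
  shows "asym_linear (\<lambda>w. \<Sum>c\<in>UNIV. W c w * F c w) (t i) (\<lambda>A. g i A + (\<Sum>c\<in>UNIV. t c * v c A))"
proof -
  have "asym_linear (\<lambda>w. \<Sum>c\<in>UNIV. W c w * F c w) (\<Sum>c\<in>UNIV. kron i c * t c) (\<lambda>A. \<Sum>c\<in>UNIV. kron i c * g c A + t c * v c A)"
    by (intro asym_linear_sum asym_linear_mult assms)
  then show ?thesis by (simp add: sum.distrib)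
qed

lemma sum_UNIV_prod: "(\<Sum>c\<in>UNIV. f c) = (\<Sum>a\<in>UNIV. \<Sum>b\<in>UNIV. f (a, b))"
  for f :: "'i::finite \<times> 'j::finite \<Rightarrow> real"
  by (simp add: sum.cartesian_product flip: UNIV_Times_UNIV)

context independent_entries
begin

section \<open>Moments of the centered and standardized entries\<close>

abbreviation sample :: "'a \<Rightarrow> nat \<Rightarrow> real^'q^'p" where "sample x \<equiv> (\<lambda>i. Zs i x)"

definition cent :: "'p \<times> 'q \<Rightarrow> nat \<times> 'a \<Rightarrow> nat \<Rightarrow> real" where
  "cent i w s = entry i (Zs s (snd w)) - avg (entry i) w"

definition stdz :: "'p \<times> 'q \<Rightarrow> nat \<times> 'a \<Rightarrow> nat \<Rightarrow> real" where
  "stdz i w s = entry i (standardized (sample (snd w)) (fst w) s)"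

definition mean_prod4 :: "(nat \<times> 'a \<Rightarrow> nat \<Rightarrow> real) \<Rightarrow> (nat \<times> 'a \<Rightarrow> nat \<Rightarrow> real) \<Rightarrow> (nat \<times> 'a \<Rightarrow> nat \<Rightarrow> real)
    \<Rightarrow> (nat \<times> 'a \<Rightarrow> nat \<Rightarrow> real) \<Rightarrow> nat \<times> 'a \<Rightarrow> real" where
  "mean_prod4 f g h k w = (\<Sum>s<fst w. f w s * g w s * h w s * k w s) / real (fst w)"

lemma entry_centered: "entry i (centered (sample x) n s) = cent i (n, x) s"
  by (simp add: cent_def centered_def sample_mean_def avg_def sum_component)

lemma centered_nth: "centered (sample x) n s $ k $ l = cent (k, l) (n, x) s"
  using entry_centered[where i="(k, l)"] by simp

lemma asym_linear_entry: "asym_linear (avg (entry i)) 0 (entry i)"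
  using asym_linear_avg[OF L2_fun_entries(1), of i] by (simp add: entry_mean)

text \<open>Centering subtracts a product of two sample means; both tend to 0, so it has no
  first-order effect.\<close>

lemma asym_linear_cent2:
  "asym_linear (\<lambda>w. (\<Sum>s<fst w. cent i w s * cent j w s) / fst w) (kron i j) (\<lambda>A. entry i A * entry j A - kron i j)"
proof (rule asym_linear_eq)
  have "asym_linear (avg (\<lambda>A. entry i A * entry j A)) (kron i j) (\<lambda>A. entry i A * entry j A - kron i j)"
    using asym_linear_avg[OF L2_fun_entries(2), of i j] by (simp add: expectation_entry2)
  then show "asym_linear (\<lambda>w. avg (\<lambda>A. entry i A * entry j A) w - avg (entry i) w * avg (entry j) w)
      (kron i j - 0 * 0) (\<lambda>A. entry i A * entry j A - kron i j - (0 * entry j A + 0 * entry i A))"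
    by (intro asym_linear_diff asym_linear_mult asym_linear_entry)
  show "\<forall>\<^sub>F w in in_prob M. (\<Sum>s<fst w. cent i w s * cent j w s) / fst w =
      avg (\<lambda>A. entry i A * entry j A) w - avg (entry i) w * avg (entry j) w"
    using in_prob_pos
  proof eventually_elim
    case (elim w)
    let ?n = "real (fst w)" and ?z = "\<lambda>i s. entry i (Zs s (snd w))"
    have s: "(\<Sum>s<fst w. ?z i s) = ?n * avg (entry i) w" for i
      using elim by (simp add: avg_def split_beta)
    have s2: "(\<Sum>s<fst w. ?z i s * ?z j s) = ?n * avg (\<lambda>A. entry i A * entry j A) w"
      using elim by (simp add: avg_def split_beta)
    have "(\<Sum>s<fst w. cent i w s * cent j w s) = (\<Sum>s<fst w. ?z i s * ?z j s)
        - avg (entry i) w * (\<Sum>s<fst w. ?z j s) - avg (entry j) w * (\<Sum>s<fst w. ?z i s)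
        + ?n * (avg (entry i) w * avg (entry j) w)"
      by (simp add: cent_def algebra_simps sum.distrib sum_subtractf sum_distrib_left)
    then show ?case using elim unfolding s s2 by (simp add: field_simps)
  qed
qed auto

definition \<tau>3 :: "'p \<times> 'q \<Rightarrow> 'p \<times> 'q \<Rightarrow> 'p \<times> 'q \<Rightarrow> real" where
  "\<tau>3 i j k = \<gamma> i * (kron i j * kron i k)"

text \<open>In contrast to second moments, centering here leaves a first-order trace: each sample
  mean is multiplied by the third moment of the other three entries.\<close>

definition t4 :: "'p \<times> 'q \<Rightarrow> 'p \<times> 'q \<Rightarrow> 'p \<times> 'q \<Rightarrow> 'p \<times> 'q \<Rightarrow> real^'q^'p \<Rightarrow> real" where
  "t4 i j k l A = entry i A * entry j A * entry k A * entry l A - \<tau> i j k l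
     - \<tau>3 j k l * entry i A - \<tau>3 i k l * entry j A - \<tau>3 i j l * entry k A - \<tau>3 i j k * entry l A"

text \<open>The product of four differences is expanded. Terms with at least two sample means have
  influence function 0, because every mean tends to 0; those with one mean give the correction in
  \<open>t4\<close>.\<close>

lemma asym_linear_cent4:
  "asym_linear (mean_prod4 (cent i) (cent j) (cent k) (cent l)) (\<tau> i j k l) (t4 i j k l)"
proof (rule asym_linear_eq)
  let ?m = "\<lambda>i. avg (entry i)" and ?a2 = "\<lambda>i j. avg (\<lambda>A. entry i A * entry j A)"
    and ?a3 = "\<lambda>i j k. avg (\<lambda>A. entry i A * entry j A * entry k A)"
    and ?a4 = "avg (\<lambda>A. entry i A * entry j A * entry k A * entry l A)"
  have a2: "asym_linear (?a2 i j) (kron i j) (\<lambda>A. entry i A * entry j A - kron i j)" for i j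
    using asym_linear_avg[OF L2_fun_entries(2), of i j] by (simp add: expectation_entry2)
  have a3: "asym_linear (?a3 i j k) (\<tau>3 i j k) (\<lambda>A. entry i A * entry j A * entry k A - \<tau>3 i j k)" for i j k
    using asym_linear_avg[OF L2_fun_entries(3), of i j k] by (simp add: expectation_entry3 \<tau>3_def)
  have a4: "asym_linear ?a4 (\<tau> i j k l) (\<lambda>A. entry i A * entry j A * entry k A * entry l A - \<tau> i j k l)"
    using asym_linear_avg[OF L2_fun_entries(4), of i j k l] by (simp add: expectation_entry4)
  have ma3: "asym_linear (\<lambda>w. ?m i w * ?a3 j k l w) 0 (\<lambda>A. \<tau>3 j k l * entry i A)" for i j k l
    using asym_linear_mult[OF asym_linear_entry[of i] a3[of j k l]] by simp
  have mm: "asym_linear (\<lambda>w. ?m i w * ?m j w) 0 (\<lambda>A. 0)" for i j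
    using asym_linear_mult[OF asym_linear_entry[of i] asym_linear_entry[of j]] by simp
  have mma2: "asym_linear (\<lambda>w. ?m i w * ?m j w * ?a2 k l w) 0 (\<lambda>A. 0)" for i j k l
    using asym_linear_mult[OF mm[of i j] a2[of k l]] by simp
  \<comment> \<open>The factor 3: the four terms with three means each average to minus the product
    of all four means, and the term with four means gives it back once.\<close>
  have mmmm: "asym_linear (\<lambda>w. 3 * (?m i w * ?m j w * (?m k w * ?m l w))) 0 (\<lambda>A. 0)"
    using asym_linear_cmult[OF asym_linear_mult[OF mm[of i j] mm[of k l]], of 3] by simp
  let ?E = "\<lambda>w. ?a4 w - ?m i w * ?a3 j k l w - ?m j w * ?a3 i k l w - ?m k w * ?a3 i j l w - ?m l w * ?a3 i j k w
     + ?m i w * ?m j w * ?a2 k l w + ?m i w * ?m k w * ?a2 j l w + ?m i w * ?m l w * ?a2 j k w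
     + ?m j w * ?m k w * ?a2 i l w + ?m j w * ?m l w * ?a2 i k w + ?m k w * ?m l w * ?a2 i j w
     - 3 * (?m i w * ?m j w * (?m k w * ?m l w))"
  show "asym_linear ?E
     (\<tau> i j k l - 0 - 0 - 0 - 0 + 0 + 0 + 0 + 0 + 0 + 0 - 0)
     (\<lambda>A. entry i A * entry j A * entry k A * entry l A - \<tau> i j k l
     - \<tau>3 j k l * entry i A - \<tau>3 i k l * entry j A - \<tau>3 i j l * entry k A - \<tau>3 i j k * entry l A
     + 0 + 0 + 0 + 0 + 0 + 0 - 0)"
    by (intro asym_linear_add asym_linear_diff a4 ma3 mma2 mmmm)
  show "\<forall>\<^sub>F w in in_prob M. mean_prod4 (cent i) (cent j) (cent k) (cent l) w = ?E w"
    using in_prob_pos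
  proof eventually_elim
    case (elim w)
    let ?n = "real (fst w)" and ?z = "\<lambda>i s. entry i (Zs s (snd w))"
    define I J K L where "I = ?m i w" and "J = ?m j w" and "K = ?m k w" and "L = ?m l w"
    have s1: "(\<Sum>s<fst w. ?z i s) = ?n * ?m i w" for i
      using elim by (simp add: avg_def split_beta)
    have s2: "(\<Sum>s<fst w. ?z i s * ?z j s) = ?n * ?a2 i j w" for i j
      using elim by (simp add: avg_def split_beta)
    have s3: "(\<Sum>s<fst w. ?z i s * ?z j s * ?z k s) = ?n * ?a3 i j k w" for i j k
      using elim by (simp add: avg_def split_beta)
    have s4: "(\<Sum>s<fst w. ?z i s * ?z j s * ?z k s * ?z l s) = ?n * ?a4 w"
      using elim by (simp add: avg_def split_beta)
    have "(\<Sum>s<fst w. cent i w s * cent j w s * cent k w s * cent l w s) =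
       (\<Sum>s<fst w. ?z i s * ?z j s * ?z k s * ?z l s - I * (?z j s * ?z k s * ?z l s) - J * (?z i s * ?z k s * ?z l s)
        - K * (?z i s * ?z j s * ?z l s) - L * (?z i s * ?z j s * ?z k s)
        + I * J * (?z k s * ?z l s) + I * K * (?z j s * ?z l s) + I * L * (?z j s * ?z k s)
        + J * K * (?z i s * ?z l s) + J * L * (?z i s * ?z k s) + K * L * (?z i s * ?z j s)
        - J * K * L * ?z i s - I * K * L * ?z j s - I * J * L * ?z k s - I * J * K * ?z l s + I * J * K * L)"
      by (intro sum.cong refl) (simp add: cent_def I_def J_def K_def L_def, algebra)
    also have "\<dots> = ?n * ?a4 w - I * (?n * ?a3 j k l w) - J * (?n * ?a3 i k l w) - K * (?n * ?a3 i j l w) - L * (?n * ?a3 i j k w)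
        + I * J * (?n * ?a2 k l w) + I * K * (?n * ?a2 j l w) + I * L * (?n * ?a2 j k w)
        + J * K * (?n * ?a2 i l w) + J * L * (?n * ?a2 i k w) + K * L * (?n * ?a2 i j w)
        - J * K * L * (?n * I) - I * K * L * (?n * J) - I * J * L * (?n * K) - I * J * K * (?n * L) + ?n * (I * J * K * L)"
      unfolding sum.distrib sum_subtractf sum_distrib_left[symmetric] s1 s2 s3 s4
      by (simp add: I_def J_def K_def L_def)
    also have "\<dots> = ?n * (?a4 w - I * ?a3 j k l w - J * ?a3 i k l w - K * ?a3 i j l w - L * ?a3 i j k w
        + I * J * ?a2 k l w + I * K * ?a2 j l w + I * L * ?a2 j k w
        + J * K * ?a2 i l w + J * L * ?a2 i k w + K * L * ?a2 i j w - 3 * (I * J * (K * L)))"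
      by algebra
    finally show ?case
      unfolding mean_prod4_def I_def[symmetric] J_def[symmetric] K_def[symmetric] L_def[symmetric]
      using elim by simp
  qed
qed (auto simp: t4_def)

definition row_infl :: "'p \<Rightarrow> 'p \<Rightarrow> real^'q^'p \<Rightarrow> real" where
  "row_infl k k' A = (\<Sum>l\<in>UNIV. entry (k, l) A * entry (k', l) A - kron k k') / real CARD('q)"

definition col_infl :: "'q \<Rightarrow> 'q \<Rightarrow> real^'q^'p \<Rightarrow> real" where
  "col_infl l l' A = (\<Sum>k\<in>UNIV. entry (k, l) A * entry (k, l') A - kron l l') / real CARD('p)"

lemma kron_same [simp]: "kron i i = 1" by (simp add: kron_def)

lemma kron_Pair: "kron (k, l) (k', l') = kron k k' * kron l l'"
  by (simp add: kron_def)

abbreviation "SL w \<equiv> S_L (sample (snd w)) (fst w)"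
abbreviation "SR w \<equiv> S_R (sample (snd w)) (fst w)"

lemma SL_nth: "SL w $ k $ k' = (\<Sum>l\<in>UNIV. (\<Sum>s<fst w. cent (k, l) w s * cent (k', l) w s) / fst w) / real CARD('q)"
proof -
  have "SL w $ k $ k' = (\<Sum>s<fst w. \<Sum>l\<in>UNIV. cent (k, l) w s * cent (k', l) w s) / (real (fst w) * real CARD('q))"
    by (simp add: centered_nth S_L_def sum_component matrix_matrix_mult_def transpose_def)
  then show ?thesis by (subst (asm) sum.swap) (simp add: sum_divide_distrib field_simps)
qed

lemma SR_nth: "SR w $ l $ l' = (\<Sum>k\<in>UNIV. (\<Sum>s<fst w. cent (k, l) w s * cent (k, l') w s) / fst w) / real CARD('p)"
proof -
  have "SR w $ l $ l' = (\<Sum>s<fst w. \<Sum>k\<in>UNIV. cent (k, l) w s * cent (k, l') w s) / (real (fst w) * real CARD('p))"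
    by (simp add: centered_nth S_R_def sum_component matrix_matrix_mult_def transpose_def)
  then show ?thesis by (subst (asm) sum.swap) (simp add: sum_divide_distrib field_simps)
qed

lemma asym_linear_SL: "asym_linear (\<lambda>w. SL w $ k $ k') (kron k k') (row_infl k k')"
proof (rule asym_linear_eq)
  show "asym_linear (\<lambda>w. (1 / real CARD('q)) * (\<Sum>l\<in>UNIV. (\<Sum>s<fst w. cent (k, l) w s * cent (k', l) w s) / fst w))
      ((1 / real CARD('q)) * (\<Sum>l\<in>(UNIV :: 'q set). kron (k, l) (k', l)))
      (\<lambda>A. (1 / real CARD('q)) * (\<Sum>l\<in>(UNIV :: 'q set). entry (k, l) A * entry (k', l) A - kron (k, l) (k', l)))"
    by (intro asym_linear_cmult asym_linear_sum asym_linear_cent2)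
qed (auto simp: SL_nth row_infl_def kron_Pair)

lemma asym_linear_SR: "asym_linear (\<lambda>w. SR w $ l $ l') (kron l l') (col_infl l l')"
proof (rule asym_linear_eq)
  show "asym_linear (\<lambda>w. (1 / real CARD('p)) * (\<Sum>k\<in>UNIV. (\<Sum>s<fst w. cent (k, l) w s * cent (k, l') w s) / fst w))
      ((1 / real CARD('p)) * (\<Sum>k\<in>(UNIV :: 'p set). kron (k, l) (k, l')))
      (\<lambda>A. (1 / real CARD('p)) * (\<Sum>k\<in>(UNIV :: 'p set). entry (k, l) A * entry (k, l') A - kron (k, l) (k, l')))"
    by (intro asym_linear_cmult asym_linear_sum asym_linear_cent2)
qed (auto simp: SR_nth col_infl_def kron_Pair)

lemma SL_symmetric: "transpose (SL w) = SL w"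
  by (simp add: transpose_eq_iff SL_nth mult.commute)

lemma SR_symmetric: "transpose (SR w) = SR w"
  by (simp add: transpose_eq_iff SR_nth mult.commute)

lemmas SL_near = asym_linear_inv_sqrt(1)[OF SL_symmetric asym_linear_SL]
  and SR_near = asym_linear_inv_sqrt(1)[OF SR_symmetric asym_linear_SR]
  and asym_linear_RL = asym_linear_inv_sqrt(2)[OF SL_symmetric asym_linear_SL]
  and asym_linear_RR = asym_linear_inv_sqrt(2)[OF SR_symmetric asym_linear_SR]

text \<open>Entry (i, c) of the Kronecker product of the two inverse square roots, hence the
  coefficient of the centered entry c in the standardized entry i.\<close>

definition wt :: "'p \<times> 'q \<Rightarrow> 'p \<times> 'q \<Rightarrow> nat \<times> 'a \<Rightarrow> real" where
  "wt i c w = inv_sqrt (SL w) $ fst i $ fst c * inv_sqrt (SR w) $ snd i $ snd c"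

definition wt_infl :: "'p \<times> 'q \<Rightarrow> 'p \<times> 'q \<Rightarrow> real^'q^'p \<Rightarrow> real" where
  "wt_infl i c A = kron (fst i) (fst c) * (- (1/2) * col_infl (snd i) (snd c) A) + kron (snd i) (snd c) * (- (1/2) * row_infl (fst i) (fst c) A)"

lemma asym_linear_wt: "asym_linear (wt i c) (kron i c) (wt_infl i c)"
proof (rule asym_linear_eq)
  show "asym_linear (\<lambda>w. inv_sqrt (SL w) $ fst i $ fst c * inv_sqrt (SR w) $ snd i $ snd c)
     (kron (fst i) (fst c) * kron (snd i) (snd c))
     (\<lambda>A. kron (fst i) (fst c) * (- (1/2) * col_infl (snd i) (snd c) A) + kron (snd i) (snd c) * (- (1/2) * row_infl (fst i) (fst c) A))"
    by (intro asym_linear_mult asym_linear_RL asym_linear_RR)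
  show "kron (fst i) (fst c) * kron (snd i) (snd c) = kron i c"
    by (cases i; cases c) (simp add: kron_Pair)
qed (auto simp: wt_def wt_infl_def)

lemma stdz_eq: "stdz i w s = (\<Sum>c\<in>UNIV. wt i c w * cent c w s)"
proof -
  have "stdz i w s = (\<Sum>b\<in>UNIV. (\<Sum>a\<in>UNIV. inv_sqrt (SL w) $ fst i $ a * cent (a, b) w s) * inv_sqrt (SR w) $ snd i $ b)"
    by (simp add: centered_nth stdz_def standardized_def matrix_matrix_mult_def transpose_def)
  then show ?thesis
    unfolding sum_UNIV_prod
    by (subst sum.swap) (simp add: wt_def sum_distrib_right sum_distrib_left mult_ac)
qed

text \<open>Passes from the centered to the standardized entry in the front factor only, so that the
  four factors can be treated one after the other by linearity.\<close>

lemma asym_linear_stdz_step: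
  assumes "\<And>c. asym_linear (mean_prod4 (cent c) g h k) (t c) (u c)"
  shows "asym_linear (mean_prod4 (stdz i) g h k) (t i) (\<lambda>A. u i A + (\<Sum>c\<in>UNIV. t c * wt_infl i c A))"
proof (rule asym_linear_eq)
  show "asym_linear (\<lambda>w. \<Sum>c\<in>UNIV. wt i c w * mean_prod4 (cent c) g h k w) (t i) (\<lambda>A. u i A + (\<Sum>c\<in>UNIV. t c * wt_infl i c A))"
    by (intro asym_linear_contract asym_linear_wt assms)
  have "mean_prod4 (stdz i) g h k w = (\<Sum>c\<in>UNIV. wt i c w * mean_prod4 (cent c) g h k w)" for w
    unfolding mean_prod4_def stdz_eq sum_distrib_right sum_divide_distrib sum_distrib_left
    by (subst sum.swap) (simp add: mult_ac)
  then show "\<forall>\<^sub>F w in in_prob M. mean_prod4 (stdz i) g h k w = (\<Sum>c\<in>UNIV. wt i c w * mean_prod4 (cent c) g h k w)"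
    by simp
qed auto

text \<open>Brings each of the four factors to the front in turn, where
  \<open>asym_linear_stdz_step\<close> acts; after four rounds the original order is
  restored.\<close>

lemma mean_prod4_rotate: "mean_prod4 f g h k = mean_prod4 g h k f"
  by (simp add: fun_eq_iff mean_prod4_def mult_ac)

definition y4_infl :: "'p \<times> 'q \<Rightarrow> 'p \<times> 'q \<Rightarrow> 'p \<times> 'q \<Rightarrow> 'p \<times> 'q \<Rightarrow> real^'q^'p \<Rightarrow> real" where
  "y4_infl i j k l A = t4 i j k l A + (\<Sum>c\<in>UNIV. \<tau> c j k l * wt_infl i c A) + (\<Sum>c\<in>UNIV. \<tau> i c k l * wt_infl j c A)
     + (\<Sum>c\<in>UNIV. \<tau> i j c l * wt_infl k c A) + (\<Sum>c\<in>UNIV. \<tau> i j k c * wt_infl l c A)"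

lemma asym_linear_stdz4:
  "asym_linear (mean_prod4 (stdz i) (stdz j) (stdz k) (stdz l)) (\<tau> i j k l) (y4_infl i j k l)"
proof -
  have 1: "asym_linear (mean_prod4 (cent j) (cent k) (cent l) (stdz i)) (\<tau> i j k l)
      (\<lambda>A. t4 i j k l A + (\<Sum>c\<in>UNIV. \<tau> c j k l * wt_infl i c A))" for i j k l
    unfolding mean_prod4_rotate[of "stdz i", symmetric]
    by (rule asym_linear_stdz_step) (rule asym_linear_cent4)
  have 2: "asym_linear (mean_prod4 (cent k) (cent l) (stdz i) (stdz j)) (\<tau> i j k l)
      (\<lambda>A. t4 i j k l A + (\<Sum>c\<in>UNIV. \<tau> c j k l * wt_infl i c A) + (\<Sum>c\<in>UNIV. \<tau> i c k l * wt_infl j c A))" for i j k l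
    unfolding mean_prod4_rotate[of "stdz j", symmetric]
    by (rule asym_linear_stdz_step) (rule 1)
  have 3: "asym_linear (mean_prod4 (cent l) (stdz i) (stdz j) (stdz k)) (\<tau> i j k l)
      (\<lambda>A. t4 i j k l A + (\<Sum>c\<in>UNIV. \<tau> c j k l * wt_infl i c A) + (\<Sum>c\<in>UNIV. \<tau> i c k l * wt_infl j c A)
        + (\<Sum>c\<in>UNIV. \<tau> i j c l * wt_infl k c A))" for i j k l
    unfolding mean_prod4_rotate[of "stdz k", symmetric]
    by (rule asym_linear_stdz_step) (rule 2)
  show ?thesis
    unfolding mean_prod4_rotate[of "stdz l", symmetric] y4_infl_def
    by (rule asym_linear_stdz_step) (rule 3)
qed

section \<open>The MFOBI matrices as sums of standardized fourth moments\<close>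

definition B_mean :: "nat \<Rightarrow> 'p \<Rightarrow> 'p \<Rightarrow> real" where
  "B_mean N k k' = (if N = 0 then (\<Sum>l\<in>UNIV. \<Sum>m\<in>UNIV. \<Sum>l'\<in>UNIV. \<tau> (k, l) (m, l) (m, l') (k', l'))
     else (\<Sum>m\<in>UNIV. \<Sum>b\<in>UNIV. \<Sum>l\<in>UNIV. \<tau> (m, b) (m, b) (k, l) (k', l))) / real CARD('q)"

definition B_infl :: "nat \<Rightarrow> 'p \<Rightarrow> 'p \<Rightarrow> real^'q^'p \<Rightarrow> real" where
  "B_infl N k k' A = (if N = 0 then (\<Sum>l\<in>UNIV. \<Sum>m\<in>UNIV. \<Sum>l'\<in>UNIV. y4_infl (k, l) (m, l) (m, l') (k', l') A)
     else (\<Sum>m\<in>UNIV. \<Sum>b\<in>UNIV. \<Sum>l\<in>UNIV. y4_infl (m, b) (m, b) (k, l) (k', l) A)) / real CARD('q)"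

abbreviation "BL N w \<equiv> B_L N (sample (snd w)) (fst w)"

lemma B_L0_nth: "B_L0 (sample (snd w)) (fst w) $ k $ k' =
    (1 / real CARD('q)) * (\<Sum>l\<in>UNIV. \<Sum>m\<in>UNIV. \<Sum>l'\<in>UNIV. mean_prod4 (stdz (k, l)) (stdz (m, l)) (stdz (m, l')) (stdz (k', l')) w)"
proof -
  let ?Y = "\<lambda>s. standardized (sample (snd w)) (fst w) s"
  have "(?Y s ** transpose (?Y s) ** ?Y s ** transpose (?Y s)) $ k $ k' =
      (\<Sum>l\<in>UNIV. \<Sum>m\<in>UNIV. \<Sum>l'\<in>UNIV. stdz (k, l) w s * stdz (m, l) w s * stdz (m, l') w s * stdz (k', l') w s)" for s
  proof -
    have "(?Y s ** transpose (?Y s) ** ?Y s ** transpose (?Y s)) $ k $ k' =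
        (\<Sum>l'\<in>UNIV. \<Sum>m\<in>UNIV. \<Sum>l\<in>UNIV. stdz (k, l) w s * stdz (m, l) w s * stdz (m, l') w s * stdz (k', l') w s)"
      by (simp add: matrix_matrix_mult_def transpose_def stdz_def sum_distrib_right)
    also have "\<dots> = (\<Sum>m\<in>UNIV. \<Sum>l'\<in>UNIV. \<Sum>l\<in>UNIV. stdz (k, l) w s * stdz (m, l) w s * stdz (m, l') w s * stdz (k', l') w s)"
      by (rule sum.swap)
    also have "\<dots> = (\<Sum>m\<in>UNIV. \<Sum>l\<in>UNIV. \<Sum>l'\<in>UNIV. stdz (k, l) w s * stdz (m, l) w s * stdz (m, l') w s * stdz (k', l') w s)"
      by (intro sum.cong refl sum.swap)
    also have "\<dots> = (\<Sum>l\<in>UNIV. \<Sum>m\<in>UNIV. \<Sum>l'\<in>UNIV. stdz (k, l) w s * stdz (m, l) w s * stdz (m, l') w s * stdz (k', l') w s)"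
      by (rule sum.swap)
    finally show ?thesis .
  qed
  then have "B_L0 (sample (snd w)) (fst w) $ k $ k' = (1 / (real (fst w) * real CARD('q))) *
    (\<Sum>s<fst w. \<Sum>l\<in>UNIV. \<Sum>m\<in>UNIV. \<Sum>l'\<in>UNIV. stdz (k, l) w s * stdz (m, l) w s * stdz (m, l') w s * stdz (k', l') w s)"
    by (simp add: B_L0_def Let_def sum_component)
  also have "(\<Sum>s<fst w. \<Sum>l\<in>UNIV. \<Sum>m\<in>UNIV. \<Sum>l'\<in>UNIV. stdz (k, l) w s * stdz (m, l) w s * stdz (m, l') w s * stdz (k', l') w s)
    = (\<Sum>l\<in>UNIV. \<Sum>m\<in>UNIV. \<Sum>l'\<in>UNIV. \<Sum>s<fst w. stdz (k, l) w s * stdz (m, l) w s * stdz (m, l') w s * stdz (k', l') w s)"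
    by (simp only: sum.swap[of _ _ "{..<fst w}"])
  finally show ?thesis
    by (simp add: mean_prod4_def sum_divide_distrib[symmetric])
qed

lemma B_L1_nth: "B_L1 (sample (snd w)) (fst w) $ k $ k' =
    (1 / real CARD('q)) * (\<Sum>m\<in>UNIV. \<Sum>b\<in>UNIV. \<Sum>l\<in>UNIV. mean_prod4 (stdz (m, b)) (stdz (m, b)) (stdz (k, l)) (stdz (k', l)) w)"
proof -
  let ?Y = "\<lambda>s. standardized (sample (snd w)) (fst w) s"
  have "((norm (?Y s))\<^sup>2 *\<^sub>R (?Y s ** transpose (?Y s))) $ k $ k' =
      (\<Sum>m\<in>UNIV. \<Sum>b\<in>UNIV. \<Sum>l\<in>UNIV. stdz (m, b) w s * stdz (m, b) w s * stdz (k, l) w s * stdz (k', l) w s)" for s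
    by (simp add: norm_sq_matrix matrix_matrix_mult_def transpose_def stdz_def sum_distrib_right)
      (simp add: sum_distrib_left power2_eq_square mult.assoc)
  then have "B_L1 (sample (snd w)) (fst w) $ k $ k' = (1 / (real (fst w) * real CARD('q))) *
    (\<Sum>s<fst w. \<Sum>m\<in>UNIV. \<Sum>b\<in>UNIV. \<Sum>l\<in>UNIV. stdz (m, b) w s * stdz (m, b) w s * stdz (k, l) w s * stdz (k', l) w s)"
    by (simp add: B_L1_def Let_def sum_component)
  also have "(\<Sum>s<fst w. \<Sum>m\<in>UNIV. \<Sum>b\<in>UNIV. \<Sum>l\<in>UNIV. stdz (m, b) w s * stdz (m, b) w s * stdz (k, l) w s * stdz (k', l) w s)
    = (\<Sum>m\<in>UNIV. \<Sum>b\<in>UNIV. \<Sum>l\<in>UNIV. \<Sum>s<fst w. stdz (m, b) w s * stdz (m, b) w s * stdz (k, l) w s * stdz (k', l) w s)"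
    by (simp only: sum.swap[of _ _ "{..<fst w}"])
  finally show ?thesis
    by (simp add: mean_prod4_def sum_divide_distrib[symmetric])
qed

lemma asym_linear_BL: "asym_linear (\<lambda>w. BL N w $ k $ k') (B_mean N k k') (B_infl N k k')"
proof (cases "N = 0")
  case True
  have "asym_linear (\<lambda>w. (1 / real CARD('q)) * (\<Sum>l\<in>UNIV. \<Sum>m\<in>UNIV. \<Sum>l'\<in>UNIV.
          mean_prod4 (stdz (k, l)) (stdz (m, l)) (stdz (m, l')) (stdz (k', l')) w))
       ((1 / real CARD('q)) * (\<Sum>l\<in>UNIV. \<Sum>m\<in>UNIV. \<Sum>l'\<in>UNIV. \<tau> (k, l) (m, l) (m, l') (k', l')))
       (\<lambda>A. (1 / real CARD('q)) * (\<Sum>l\<in>UNIV. \<Sum>m\<in>UNIV. \<Sum>l'\<in>UNIV. y4_infl (k, l) (m, l) (m, l') (k', l') A))"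
    by (intro asym_linear_cmult asym_linear_sum asym_linear_stdz4)
  then show ?thesis
    by (rule asym_linear_eq) (use True in \<open>simp_all add: B_L_def B_L0_nth B_mean_def B_infl_def\<close>)
next
  case False
  have "asym_linear (\<lambda>w. (1 / real CARD('q)) * (\<Sum>m\<in>UNIV. \<Sum>b\<in>UNIV. \<Sum>l\<in>UNIV.
          mean_prod4 (stdz (m, b)) (stdz (m, b)) (stdz (k, l)) (stdz (k', l)) w))
       ((1 / real CARD('q)) * (\<Sum>m\<in>UNIV. \<Sum>b\<in>UNIV. \<Sum>l\<in>UNIV. \<tau> (m, b) (m, b) (k, l) (k', l)))
       (\<lambda>A. (1 / real CARD('q)) * (\<Sum>m\<in>UNIV. \<Sum>b\<in>UNIV. \<Sum>l\<in>UNIV. y4_infl (m, b) (m, b) (k, l) (k', l) A))"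
    by (intro asym_linear_cmult asym_linear_sum asym_linear_stdz4)
  then show ?thesis
    by (rule asym_linear_eq) (use False in \<open>simp_all add: B_L_def B_L1_nth B_mean_def B_infl_def\<close>)
qed

end

section \<open>Influence functions in closed form\<close>

lemma sum_split_diagonal:
  fixes g :: "'i::finite \<Rightarrow> 'i \<Rightarrow> real"
  shows "(\<Sum>l\<in>UNIV. \<Sum>l'\<in>UNIV. g l l') = (\<Sum>(l, l')\<in>{(l, l'). l \<noteq> l'}. g l l') + (\<Sum>l\<in>UNIV. g l l)"
proof -
  have "(\<Sum>l\<in>UNIV. \<Sum>l'\<in>UNIV. g l l') = (\<Sum>(l, l')\<in>UNIV. g l l')"
    by (simp add: sum.cartesian_product flip: UNIV_Times_UNIV)
  also have "\<dots> = (\<Sum>(l, l')\<in>{(l, l'). l \<noteq> l'}. g l l') + (\<Sum>(l, l')\<in>{(l, l'). l = l'}. g l l')"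
    by (subst sum.union_disjoint[symmetric]) (auto intro!: sum.cong)
  also have "(\<Sum>(l, l')\<in>{(l, l'). l = l'}. g l l') = (\<Sum>l\<in>UNIV. g l l)"
    by (rule sum.reindex_bij_witness[of _ "\<lambda>l. (l, l)" fst]) auto
  finally show ?thesis .
qed

text \<open>Centering the squares releases \<open>CARD('i)\<close> copies of the inner product of x
  and y; the diagonal of the centered double sum is the cubic sum minus one copy. The three pieces
  reappear in \<open>num_infl_decomp\<close>.\<close>

lemma sum_squares_times_inner:
  fixes x y :: "'i::finite \<Rightarrow> real"
  shows "(\<Sum>l\<in>UNIV. (x l)\<^sup>2) * (\<Sum>l\<in>UNIV. x l * y l) = (\<Sum>(l, l')\<in>{(l, l'). l \<noteq> l'}. ((x l)\<^sup>2 - 1) * (x l' * y l'))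
    + (\<Sum>l\<in>UNIV. (x l) ^ 3 * y l) + (real CARD('i) - 1) * (\<Sum>l\<in>UNIV. x l * y l)"
proof -
  have "(\<Sum>l\<in>UNIV. \<Sum>l'\<in>UNIV. ((x l)\<^sup>2 - 1) * (x l' * y l')) =
      (\<Sum>l\<in>UNIV. (x l)\<^sup>2) * (\<Sum>l\<in>UNIV. x l * y l) - real CARD('i) * (\<Sum>l\<in>UNIV. x l * y l)"
    by (simp add: sum_product[symmetric] sum_distrib_left[symmetric] sum_distrib_right[symmetric] sum_subtractf left_diff_distrib)
  moreover have "(\<Sum>l\<in>UNIV. ((x l)\<^sup>2 - 1) * (x l * y l)) = (\<Sum>l\<in>UNIV. (x l) ^ 3 * y l) - (\<Sum>l\<in>UNIV. x l * y l)"
    by (simp add: sum_subtractf[symmetric] power2_eq_square power3_eq_cube algebra_simps)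
  ultimately show ?thesis
    unfolding sum_split_diagonal[of "\<lambda>l l'. ((x l)\<^sup>2 - 1) * (x l' * y l')"] by (simp add: algebra_simps)
qed

lemma sum_UNIV_two:
  fixes f :: "'i::finite \<Rightarrow> real"
  assumes "k \<noteq> k'"
  shows "(\<Sum>m\<in>UNIV. f m) = f k + f k' + (\<Sum>m\<in>UNIV - {k, k'}. f m)"
proof -
  have "(\<Sum>m\<in>UNIV. f m) = (\<Sum>m\<in>{k, k'}. f m) + (\<Sum>m\<in>UNIV - {k, k'}. f m)"
    by (rule sum.subset_diff[of "{k, k'}", THEN trans]) auto
  then show ?thesis using assms by simp
qed

context independent_entries
begin

definition row_mean :: "('p \<times> 'q \<Rightarrow> real) \<Rightarrow> 'p \<Rightarrow> real" where
  "row_mean f k = (\<Sum>l\<in>UNIV. f (k, l)) / real CARD('q)"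

text \<open>The part of the eigenvalues shared by all rows; the row averages of the fourth moments
  alone separate them.\<close>

definition eig_shift :: "nat \<Rightarrow> real" where
  "eig_shift N = (if N = 0 then real CARD('q) + real CARD('p) - 2 else real CARD('p) * real CARD('q) - 1)"

definition eig :: "nat \<Rightarrow> 'p \<Rightarrow> real" where
  "eig N k = row_mean \<beta> k + eig_shift N"

text \<open>Up to sign, the multiple of \<open>row_infl\<close> in an off-diagonal influence
  function of the matrix that comes from standardizing the two factors whose row index m is summed
  over.\<close>

definition middle_coeff :: "nat \<Rightarrow> real" where
  "middle_coeff N = (if N = 0 then real CARD('q) + 1 else 2)"

lemma sum_kron_const [simp]: "(\<Sum>c\<in>UNIV. kron i c) = 1" "(\<Sum>c\<in>UNIV. kron c i) = 1"
  for i :: "'i::finite"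
  using sum_kron(1)[of i "\<lambda>_. 1"] sum_kron(3)[of i "\<lambda>_. 1"] by simp_all

lemma sum_row: "(\<Sum>l\<in>UNIV. f (k, l)) = real CARD('q) * row_mean f k"
  by (simp add: row_mean_def)

lemma B_mean_scaled:
  "N = 0 \<Longrightarrow> real CARD('q) * B_mean N k k' = (\<Sum>l\<in>UNIV. \<Sum>m\<in>UNIV. \<Sum>l'\<in>UNIV. \<tau> (k, l) (m, l) (m, l') (k', l'))"
  "N \<noteq> 0 \<Longrightarrow> real CARD('q) * B_mean N k k' = (\<Sum>m\<in>UNIV. \<Sum>b\<in>UNIV. \<Sum>l\<in>UNIV. \<tau> (m, b) (m, b) (k, l) (k', l))"
  by (simp_all add: B_mean_def)

text \<open>Every pairing in \<tau> links row k to row k', directly or through m, so the limit is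
  diagonal.\<close>

lemma B_mean_eq: "B_mean N k k' = kron k k' * eig N k"
proof (cases "N = 0")
  case True
  have "\<tau> (k, l) (m, l) (m, l') (k', l') = kron k k' * (kron k m + kron k m * kron l l' + kron l l' + kron k m * ((\<beta> (k, l) - 3) * kron l l'))" for l m l'
    by (auto simp: \<tau>_def kron_def)
  then have "real CARD('q) * B_mean N k k' = kron k k' * (\<Sum>l\<in>UNIV. \<Sum>m\<in>UNIV. \<Sum>l'\<in>(UNIV :: 'q set). kron k m + kron k m * kron l l' + kron l l' + kron k m * ((\<beta> (k, l) - 3) * kron l l'))"
    unfolding B_mean_scaled(1)[OF True] by (simp add: sum_distrib_left)
  also have "\<dots> = kron k k' * (real CARD('q) * real CARD('q) + real CARD('q) + real CARD('p) * real CARD('q) + (real CARD('q) * row_mean \<beta> k - 3 * real CARD('q)))"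
    by (simp add: sum.distrib sum_distrib_left[symmetric] sum_distrib_right[symmetric] sum_subtractf sum_row[of \<beta>], (simp add: algebra_simps)?)
  also have "\<dots> = real CARD('q) * (kron k k' * eig N k)"
    using True by (simp add: eig_def eig_shift_def algebra_simps)
  finally show ?thesis by simp
next
  case False
  have "\<tau> (m, b) (m, b) (k, l) (k', l) = kron k k' * (1 + 2 * (kron k m * kron l b) + kron k m * ((\<beta> (m, b) - 3) * kron l b))" for m b l
    by (auto simp: \<tau>_def kron_def)
  then have "real CARD('q) * B_mean N k k' = kron k k' * (\<Sum>m\<in>UNIV. \<Sum>b\<in>UNIV. \<Sum>l\<in>(UNIV :: 'q set). 1 + 2 * (kron k m * kron l b) + kron k m * ((\<beta> (m, b) - 3) * kron l b))"
    unfolding B_mean_scaled(2)[OF False] by (simp add: sum_distrib_left)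
  also have "\<dots> = kron k k' * (real CARD('p) * real CARD('q) * real CARD('q) + 2 * real CARD('q) + (real CARD('q) * row_mean \<beta> k - 3 * real CARD('q)))"
    by (simp add: sum.distrib sum_distrib_left[symmetric] sum_distrib_right[symmetric] sum_subtractf sum_row[of \<beta>], (simp add: algebra_simps)?)
  also have "\<dots> = real CARD('q) * (kron k k' * eig N k)"
    using False by (simp add: eig_def eig_shift_def algebra_simps)
  finally show ?thesis by simp
qed

lemma wt_contract:
  "(\<Sum>c\<in>UNIV. f c * wt_infl (k, l) c A) = - (1/2) * (\<Sum>b\<in>UNIV. f (k, b) * col_infl l b A) - (1/2) * (\<Sum>a\<in>UNIV. row_infl k a A * f (a, l))"
proof -
  have "(\<Sum>c\<in>UNIV. f c * wt_infl (k, l) c A) = (\<Sum>a\<in>UNIV. \<Sum>b\<in>UNIV. kron k a * (- (1/2) * (f (a, b) * col_infl l b A)))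
      + (\<Sum>a\<in>UNIV. \<Sum>b\<in>UNIV. kron l b * (- (1/2) * (row_infl k a A * f (a, b))))"
    unfolding sum_UNIV_prod wt_infl_def by (simp add: sum.distrib[symmetric] algebra_simps)
  also have "(\<Sum>a\<in>UNIV. \<Sum>b\<in>UNIV. kron k a * (- (1/2) * (f (a, b) * col_infl l b A))) = - (1/2) * (\<Sum>b\<in>UNIV. f (k, b) * col_infl l b A)"
    by (simp only: sum_distrib_left[symmetric] sum_kron)
  also have "(\<Sum>a\<in>UNIV. \<Sum>b\<in>UNIV. kron l b * (- (1/2) * (row_infl k a A * f (a, b)))) = - (1/2) * (\<Sum>a\<in>UNIV. row_infl k a A * f (a, l))"
    by (simp only: sum_distrib_left[symmetric] sum_kron)
  finally show ?thesis by simp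
qed

lemma row_infl_commute: "row_infl k k' A = row_infl k' k A"
  by (simp add: row_infl_def mult.commute kron_def eq_commute)

definition prod4_sum :: "nat \<Rightarrow> 'p \<Rightarrow> 'p \<Rightarrow> real^'q^'p \<Rightarrow> real" where
  "prod4_sum N k k' A = (if N = 0 then (\<Sum>l\<in>UNIV. \<Sum>m\<in>UNIV. \<Sum>l'\<in>UNIV. entry (k, l) A * entry (m, l) A * entry (m, l') A * entry (k', l') A)
     else (\<Sum>m\<in>UNIV. \<Sum>b\<in>UNIV. \<Sum>l\<in>UNIV. entry (m, b) A * entry (m, b) A * entry (k, l) A * entry (k', l) A))"

definition third_sum :: "'p \<Rightarrow> 'p \<Rightarrow> real^'q^'p \<Rightarrow> real" where
  "third_sum k k' A = (\<Sum>l\<in>UNIV. \<gamma> (k, l) * entry (k', l) A) + (\<Sum>l\<in>UNIV. \<gamma> (k', l) * entry (k, l) A)"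

lemma sum_two_kron: "(\<Sum>a\<in>UNIV. x a * (kron k a * c + kron k' a * d)) = c * x k + d * x k'"
  for x :: "'i::finite \<Rightarrow> real"
proof -
  have "(\<Sum>a\<in>UNIV. x a * (kron k a * c + kron k' a * d)) = (\<Sum>a\<in>UNIV. kron k a * (c * x a) + kron k' a * (d * x a))"
    by (simp add: algebra_simps)
  then show ?thesis by (simp add: sum.distrib)
qed

text \<open>Column-side standardization has no effect off the diagonal: it changes column indices
  only, and \<tau> vanishes for any columns because rows k and k' cannot be paired (fact
  \<open>z\<close>). On the row side, the factors with rows k and k' lead back to diagonal limits,
  hence to the mean of two eigenvalues (\<open>outer\<close>), and those with row m give
  \<open>middle_coeff\<close> (\<open>middle\<close>).\<close>

lemma B_infl_eq:
  assumes "k \<noteq> k'"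
  shows "real CARD('q) * B_infl N k k' A = prod4_sum N k k' A - third_sum k k' A
    - real CARD('q) * ((eig N k + eig N k') / 2 + middle_coeff N) * row_infl k k' A"
proof (cases "N = 0")
  case True
  have z: "\<tau> (k, a) (m, b) (m, c) (k', d) = 0" for a m b c d
    using assms by (auto simp: \<tau>_def kron_def)
  have outer: "(\<Sum>a\<in>UNIV. row_infl k a A * \<tau> (a, l) (m, l) (m, l') (k', l')) = row_infl k k' A * \<tau> (k', l) (m, l) (m, l') (k', l')"
    "(\<Sum>a\<in>UNIV. row_infl k' a A * \<tau> (k, l) (m, l) (m, l') (a, l')) = row_infl k k' A * \<tau> (k, l) (m, l) (m, l') (k, l')" for l m l'
  proof -
    have "(\<Sum>a\<in>UNIV. row_infl k a A * \<tau> (a, l) (m, l) (m, l') (k', l')) = (\<Sum>a\<in>UNIV. kron k' a * (row_infl k a A * \<tau> (k', l) (m, l) (m, l') (k', l')))"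
      "(\<Sum>a\<in>UNIV. row_infl k' a A * \<tau> (k, l) (m, l) (m, l') (a, l')) = (\<Sum>a\<in>UNIV. kron k a * (row_infl k' a A * \<tau> (k, l) (m, l) (m, l') (k, l')))"
      by (auto intro!: sum.cong simp: \<tau>_def kron_def)
    then show "(\<Sum>a\<in>UNIV. row_infl k a A * \<tau> (a, l) (m, l) (m, l') (k', l')) = row_infl k k' A * \<tau> (k', l) (m, l) (m, l') (k', l')"
      "(\<Sum>a\<in>UNIV. row_infl k' a A * \<tau> (k, l) (m, l) (m, l') (a, l')) = row_infl k k' A * \<tau> (k, l) (m, l) (m, l') (k, l')"
      by (simp_all add: row_infl_commute[of k' k])
  qed
  have middle: "(\<Sum>a\<in>UNIV. row_infl m a A * \<tau> (k, l) (a, l) (m, l') (k', l')) = kron k' m * row_infl m k A + kron k m * kron l l' * row_infl m k' A"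
    "(\<Sum>a\<in>UNIV. row_infl m a A * \<tau> (k, l) (m, l) (a, l') (k', l')) = kron k' m * kron l l' * row_infl m k A + kron k m * row_infl m k' A" for l l' m
  proof -
    have "\<tau> (k, l) (a, l) (m, l') (k', l') = kron k a * kron k' m + kron k' a * (kron k m * kron l l')"
      "\<tau> (k, l) (m, l) (a, l') (k', l') = kron k a * (kron k' m * kron l l') + kron k' a * kron k m" for a
      using assms by (auto simp: \<tau>_def kron_def)
    then show "(\<Sum>a\<in>UNIV. row_infl m a A * \<tau> (k, l) (a, l) (m, l') (k', l')) = kron k' m * row_infl m k A + kron k m * kron l l' * row_infl m k' A"
      "(\<Sum>a\<in>UNIV. row_infl m a A * \<tau> (k, l) (m, l) (a, l') (k', l')) = kron k' m * kron l l' * row_infl m k A + kron k m * row_infl m k' A"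
      by (simp_all only: sum_two_kron)
  qed
  \<comment> \<open>A third moment involving both rows k and k' is 0, so two of the four centering
    terms remain; summed up they form \<open>third_sum\<close>.\<close>
  have t4: "t4 (k, l) (m, l) (m, l') (k', l') A = entry (k, l) A * entry (m, l) A * entry (m, l') A * entry (k', l') A
      - kron k m * (kron l l' * (\<gamma> (k, l) * entry (k', l') A)) - kron k' m * (kron l' l * (\<gamma> (k', l) * entry (k, l) A))" for l m l'
    using assms by (auto simp: t4_def z \<tau>3_def kron_def)
  have y4: "y4_infl (k, l) (m, l) (m, l') (k', l') A = t4 (k, l) (m, l) (m, l') (k', l') A
     - (row_infl k k' A / 2) * (\<tau> (k', l) (m, l) (m, l') (k', l') + \<tau> (k, l) (m, l) (m, l') (k, l'))
     - (kron k' m * ((1 + kron l l') * (row_infl m k A / 2)) + kron k m * ((1 + kron l l') * (row_infl m k' A / 2)))" for l m l'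
    unfolding y4_infl_def wt_contract z outer middle by (simp add: field_simps)
  have "real CARD('q) * B_infl N k k' A = (\<Sum>l\<in>UNIV. \<Sum>m\<in>UNIV. \<Sum>l'\<in>UNIV. y4_infl (k, l) (m, l) (m, l') (k', l') A)"
    using True by (simp add: B_infl_def)
  also have "\<dots> = prod4_sum N k k' A - third_sum k k' A - (row_infl k k' A / 2) * (real CARD('q) * eig N k' + real CARD('q) * eig N k)
      - (real CARD('q) * real CARD('q) + real CARD('q)) * ((row_infl k' k A + row_infl k k' A) / 2)"
    using True B_mean_scaled(1)[OF True, of k k] B_mean_scaled(1)[OF True, of k' k']
    by (simp add: y4 t4 sum_subtractf sum.distrib sum_distrib_left[symmetric] sum_distrib_right[symmetric]
        sum_divide_distrib[symmetric] B_mean_eq prod4_sum_def third_sum_def) (simp add: field_simps)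
  finally show ?thesis using True by (simp add: row_infl_commute[of k'] middle_coeff_def algebra_simps add_divide_distrib)
next
  case False
  have z: "\<tau> (m, b) (m, c) (k, a) (k', d) = 0" for a m b c d
    using assms by (auto simp: \<tau>_def kron_def)
  have outer: "(\<Sum>a\<in>UNIV. row_infl k a A * \<tau> (m, b) (m, b) (a, l) (k', l)) = row_infl k k' A * \<tau> (m, b) (m, b) (k', l) (k', l)"
    "(\<Sum>a\<in>UNIV. row_infl k' a A * \<tau> (m, b) (m, b) (k, l) (a, l)) = row_infl k k' A * \<tau> (m, b) (m, b) (k, l) (k, l)" for m b l
  proof -
    have "(\<Sum>a\<in>UNIV. row_infl k a A * \<tau> (m, b) (m, b) (a, l) (k', l)) = (\<Sum>a\<in>UNIV. kron k' a * (row_infl k a A * \<tau> (m, b) (m, b) (k', l) (k', l)))"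
      "(\<Sum>a\<in>UNIV. row_infl k' a A * \<tau> (m, b) (m, b) (k, l) (a, l)) = (\<Sum>a\<in>UNIV. kron k a * (row_infl k' a A * \<tau> (m, b) (m, b) (k, l) (k, l)))"
      by (auto intro!: sum.cong simp: \<tau>_def kron_def)
    then show "(\<Sum>a\<in>UNIV. row_infl k a A * \<tau> (m, b) (m, b) (a, l) (k', l)) = row_infl k k' A * \<tau> (m, b) (m, b) (k', l) (k', l)"
      "(\<Sum>a\<in>UNIV. row_infl k' a A * \<tau> (m, b) (m, b) (k, l) (a, l)) = row_infl k k' A * \<tau> (m, b) (m, b) (k, l) (k, l)"
      by (simp_all add: row_infl_commute[of k' k])
  qed
  have middle: "(\<Sum>a\<in>UNIV. row_infl m a A * \<tau> (a, b) (m, b) (k, l) (k', l)) = kron k' m * kron b l * row_infl m k A + kron k m * kron b l * row_infl m k' A"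
    "(\<Sum>a\<in>UNIV. row_infl m a A * \<tau> (m, b) (a, b) (k, l) (k', l)) = kron k' m * kron b l * row_infl m k A + kron k m * kron b l * row_infl m k' A" for m b l
  proof -
    have "\<tau> (a, b) (m, b) (k, l) (k', l) = kron k a * (kron k' m * kron b l) + kron k' a * (kron k m * kron b l)"
      "\<tau> (m, b) (a, b) (k, l) (k', l) = kron k a * (kron k' m * kron b l) + kron k' a * (kron k m * kron b l)" for a
      using assms by (auto simp: \<tau>_def kron_def)
    then show "(\<Sum>a\<in>UNIV. row_infl m a A * \<tau> (a, b) (m, b) (k, l) (k', l)) = kron k' m * kron b l * row_infl m k A + kron k m * kron b l * row_infl m k' A"
      "(\<Sum>a\<in>UNIV. row_infl m a A * \<tau> (m, b) (a, b) (k, l) (k', l)) = kron k' m * kron b l * row_infl m k A + kron k m * kron b l * row_infl m k' A"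
      by (simp_all only: sum_two_kron)
  qed
  have t4: "t4 (m, b) (m, b) (k, l) (k', l) A = entry (m, b) A * entry (m, b) A * entry (k, l) A * entry (k', l) A
      - kron k m * (kron b l * (\<gamma> (k, l) * entry (k', l) A)) - kron k' m * (kron b l * (\<gamma> (k', l) * entry (k, l) A))" for m b l
    using assms by (auto simp: t4_def z \<tau>3_def kron_def)
  have y4: "y4_infl (m, b) (m, b) (k, l) (k', l) A = t4 (m, b) (m, b) (k, l) (k', l) A
     - (row_infl k k' A / 2) * (\<tau> (m, b) (m, b) (k', l) (k', l) + \<tau> (m, b) (m, b) (k, l) (k, l))
     - (kron k' m * (kron b l * row_infl m k A) + kron k m * (kron b l * row_infl m k' A))" for m b l
    unfolding y4_infl_def wt_contract z outer middle by (simp add: field_simps)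
  have "real CARD('q) * B_infl N k k' A = (\<Sum>m\<in>UNIV. \<Sum>b\<in>UNIV. \<Sum>l\<in>UNIV. y4_infl (m, b) (m, b) (k, l) (k', l) A)"
    using False by (simp add: B_infl_def)
  also have "\<dots> = prod4_sum N k k' A - third_sum k k' A - (row_infl k k' A / 2) * (real CARD('q) * eig N k' + real CARD('q) * eig N k)
      - real CARD('q) * (row_infl k' k A + row_infl k k' A)"
    using False B_mean_scaled(2)[OF False, of k k] B_mean_scaled(2)[OF False, of k' k']
    by (simp add: y4 t4 sum_subtractf sum.distrib sum_distrib_left[symmetric] sum_distrib_right[symmetric]
        sum_divide_distrib[symmetric] B_mean_eq prod4_sum_def third_sum_def)
  finally show ?thesis using False by (simp add: row_infl_commute[of k'] middle_coeff_def algebra_simps add_divide_distrib)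
qed

text \<open>The product rule for U R. The eigenvector term is absent on the diagonal because the
  rows of U have unit length.\<close>

definition gamma_infl :: "nat \<Rightarrow> 'p \<Rightarrow> 'p \<Rightarrow> real^'q^'p \<Rightarrow> real" where
  "gamma_infl N k k' A = (if k = k' then 0 else B_infl N k' k A / (eig N k - eig N k')) - (1/2) * row_infl k k' A"

definition num_infl :: "nat \<Rightarrow> 'p \<Rightarrow> 'p \<Rightarrow> real^'q^'p \<Rightarrow> real" where
  "num_infl N k k' A = prod4_sum N k' k A - third_sum k k' A
     - (eig N k + middle_coeff N) * (\<Sum>l\<in>UNIV. entry (k, l) A * entry (k', l) A)"

text \<open>The mean of the two eigenvalues from \<open>B_infl_eq\<close> and half their difference
  from the inverse square root add up to \<open>eig N k\<close> alone. This makes the variance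
  asymmetric in k and k'.\<close>

lemma gamma_infl_offdiag:
  assumes "k \<noteq> k'" "row_mean \<beta> k \<noteq> row_mean \<beta> k'"
  shows "gamma_infl N k k' A = num_infl N k k' A / (real CARD('q) * (row_mean \<beta> k - row_mean \<beta> k'))"
proof -
  have S: "real CARD('q) * row_infl k k' A = (\<Sum>l\<in>UNIV. entry (k, l) A * entry (k', l) A)"
    using assms by (simp add: row_infl_def kron_def)
  have d: "eig N k - eig N k' = row_mean \<beta> k - row_mean \<beta> k'" by (simp add: eig_def)
  have "real CARD('q) * ((row_mean \<beta> k - row_mean \<beta> k') * gamma_infl N k k' A) =
      real CARD('q) * B_infl N k' k A - (row_mean \<beta> k - row_mean \<beta> k') / 2 * (real CARD('q) * row_infl k k' A)"
    using assms by (simp add: gamma_infl_def d field_simps)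
  also have "\<dots> = num_infl N k k' A"
    using assms(1) unfolding B_infl_eq[OF assms(1)[symmetric]] num_infl_def S[symmetric]
    by (simp add: row_infl_commute[of k'] third_sum_def eig_def algebra_simps) (simp add: field_simps)
  finally have "num_infl N k k' A = real CARD('q) * (row_mean \<beta> k - row_mean \<beta> k') * gamma_infl N k k' A" by simp
  then show ?thesis using assms by simp
qed

text \<open>Collects what depends on the two entries of column l in rows k and k';
  \<open>third_sum\<close> is what centers the cubes.\<close>

definition diag_part :: "'p \<Rightarrow> 'p \<Rightarrow> 'q \<Rightarrow> real^'q^'p \<Rightarrow> real" where
  "diag_part k k' l A = base (k, l) 3 (entry (k, l) A) * entry (k', l) A + base (k', l) 3 (entry (k', l) A) * entry (k, l) A
     - (row_mean \<beta> k + 3) * (entry (k, l) A * entry (k', l) A)"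

definition cross_part :: "'p \<Rightarrow> 'p \<Rightarrow> 'q \<times> 'q \<Rightarrow> real^'q^'p \<Rightarrow> real" where
  "cross_part k k' = (\<lambda>(l, l') A. ((entry (k, l) A)\<^sup>2 - 1) * (entry (k, l') A * entry (k', l') A))"

text \<open>The contribution of a third row m. For N = 0 and different columns it is a product of
  four distinct entries; equal columns, and every term for N = 1, give a centered square times a
  product from rows k and k'.\<close>

definition rest_part :: "nat \<Rightarrow> 'p \<Rightarrow> 'p \<Rightarrow> 'p \<times> 'q \<times> 'q \<Rightarrow> real^'q^'p \<Rightarrow> real" where
  "rest_part N k k' = (\<lambda>(m, l, l') A.
     if N = 0 then (if l = l' then ((entry (m, l) A)\<^sup>2 - 1) * (entry (k, l) A * entry (k', l) A)
       else entry (m, l) A * entry (m, l') A * (entry (k, l') A * entry (k', l) A))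
     else ((entry (m, l) A)\<^sup>2 - 1) * (entry (k, l') A * entry (k', l') A))"

text \<open>The sum over m is split into m = k and m = k', where
  \<open>sum_squares_times_inner\<close> applies, and the remaining rows. Each centered square
  releases a multiple of the inner product of rows k and k'; these multiples cancel
  \<open>eig N k + middle_coeff N\<close> up to the row average plus 3, for both choices of the
  matrix.\<close>

lemma num_infl_decomp:
  assumes "k \<noteq> k'"
  shows "num_infl N k k' A = (\<Sum>l\<in>UNIV. diag_part k k' l A) + (\<Sum>j\<in>{(l, l'). l \<noteq> l'}. cross_part k k' j A)
    + (\<Sum>j\<in>{(l, l'). l \<noteq> l'}. cross_part k' k j A) + (\<Sum>j\<in>(UNIV - {k, k'}) \<times> UNIV. rest_part N k k' j A)"
proof -
  define x y where "x l = entry (k, l) A" and "y l = entry (k', l) A" for l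
  define z where "z m l = entry (m, l) A" for m l
  define S where "S = (\<Sum>l\<in>UNIV. x l * y l)"
  define X3 Y3 where "X3 = (\<Sum>l\<in>UNIV. (x l) ^ 3 * y l)" and "Y3 = (\<Sum>l\<in>UNIV. (y l) ^ 3 * x l)"
  define C C' where "C = (\<Sum>j\<in>{(l, l'). l \<noteq> l'}. cross_part k k' j A)" and "C' = (\<Sum>j\<in>{(l, l'). l \<noteq> l'}. cross_part k' k j A)"
  define R where "R m = (\<Sum>j\<in>UNIV. rest_part N k k' (m, j) A)" for m
  have S': "S = (\<Sum>l\<in>UNIV. y l * x l)" by (simp add: S_def mult.commute)
  have xx: "(\<Sum>l\<in>UNIV. (x l)\<^sup>2) * S = C + X3 + (real CARD('q) - 1) * S"
    unfolding S_def C_def X3_def sum_squares_times_inner by (simp add: cross_part_def x_def y_def split_beta)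
  have yy: "(\<Sum>l\<in>UNIV. (y l)\<^sup>2) * S = C' + Y3 + (real CARD('q) - 1) * S"
    unfolding S' C'_def Y3_def sum_squares_times_inner by (simp add: cross_part_def x_def y_def split_beta)
  have diag: "(\<Sum>l\<in>UNIV. diag_part k k' l A) = X3 + Y3 - third_sum k k' A - (row_mean \<beta> k + 3) * S"
    by (simp add: diag_part_def base_def X3_def Y3_def S_def third_sum_def x_def y_def sum_distrib_left
        sum.distrib[symmetric] sum_subtractf[symmetric] algebra_simps)
  have rest: "(\<Sum>j\<in>(UNIV - {k, k'}) \<times> UNIV. rest_part N k k' j A) = (\<Sum>m\<in>UNIV - {k, k'}. R m)"
    by (simp add: R_def sum.cartesian_product split_beta)
  have card: "(\<Sum>m\<in>UNIV - {k, k'}. c) = (real CARD('p) - 2) * c" for c :: real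
  proof -
    have "CARD('p) \<ge> 2" using card_mono[of UNIV "{k, k'}"] assms by simp
    then show ?thesis using assms by (simp add: card_Diff_subset of_nat_diff)
  qed
  have main: "prod4_sum N k' k A = C + C' + X3 + Y3 + (\<Sum>m\<in>UNIV - {k, k'}. R m) + (eig N k + middle_coeff N - (row_mean \<beta> k + 3)) * S"
  proof (cases "N = 0")
    case True
    \<comment> \<open>For N = 0 the sum over both columns factors into the inner products of row m
      with rows k' and k.\<close>
    define P where "P m = (\<Sum>l\<in>UNIV. y l * z m l) * (\<Sum>l\<in>UNIV. z m l * x l)" for m
    have Rm: "P m = R m + S" for m
    proof -
      have "P m = (\<Sum>l\<in>UNIV. \<Sum>l'\<in>UNIV. rest_part N k k' (m, l, l') A + kron l l' * (x l * y l))"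
        unfolding P_def sum_product using True
        by (intro sum.cong refl) (auto simp: rest_part_def kron_def z_def x_def y_def power2_eq_square algebra_simps)
      also have "\<dots> = R m + S"
        by (simp add: sum.distrib R_def S_def sum_UNIV_prod sum_distrib_right[symmetric])
      finally show ?thesis .
    qed
    have "prod4_sum N k' k A = (\<Sum>m\<in>UNIV. P m)"
      unfolding P_def sum_product using True by (subst sum.swap) (simp add: prod4_sum_def x_def y_def z_def mult.assoc)
    also have "\<dots> = P k + P k' + (\<Sum>m\<in>UNIV - {k, k'}. P m)"
      by (rule sum_UNIV_two[OF assms])
    also have "P k = S * (\<Sum>l\<in>UNIV. (x l)\<^sup>2)"
      by (simp add: P_def S' z_def x_def power2_eq_square mult.commute)
    also have "P k' = (\<Sum>l\<in>UNIV. (y l)\<^sup>2) * S"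
      by (simp add: P_def S_def z_def y_def power2_eq_square mult.commute)
    also have "(\<Sum>m\<in>UNIV - {k, k'}. P m) = (\<Sum>m\<in>UNIV - {k, k'}. R m + S)"
      by (simp only: Rm)
    also have "S * (\<Sum>l\<in>UNIV. (x l)\<^sup>2) + (\<Sum>l\<in>UNIV. (y l)\<^sup>2) * S + (\<Sum>m\<in>UNIV - {k, k'}. R m + S)
      = C + C' + X3 + Y3 + (\<Sum>m\<in>UNIV - {k, k'}. R m) + (2 * (real CARD('q) - 1) + (real CARD('p) - 2)) * S"
      using xx yy card[of S] by (simp add: sum.distrib algebra_simps)
    finally show ?thesis using True by (simp add: eig_def eig_shift_def middle_coeff_def algebra_simps)
  next
    case False
    have Rm: "(\<Sum>b\<in>UNIV. (z m b)\<^sup>2) * S = R m + real CARD('q) * S" for m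
    proof -
      have "R m = (\<Sum>b\<in>UNIV. \<Sum>l\<in>UNIV. ((z m b)\<^sup>2 - 1) * (x l * y l))"
        unfolding R_def sum_UNIV_prod using False by (simp add: rest_part_def z_def x_def y_def)
      also have "\<dots> = (\<Sum>b\<in>UNIV. (z m b)\<^sup>2) * S - real CARD('q) * S"
        by (simp add: S_def sum_distrib_left[symmetric] sum_distrib_right[symmetric] sum_subtractf left_diff_distrib)
      finally show ?thesis by simp
    qed
    have "prod4_sum N k' k A = (\<Sum>m\<in>UNIV. (\<Sum>b\<in>UNIV. (z m b)\<^sup>2) * S)"
      unfolding S_def sum_product sum_distrib_right using False
      by (simp add: prod4_sum_def x_def y_def z_def power2_eq_square sum_distrib_left mult_ac)
    also have "\<dots> = (\<Sum>l\<in>UNIV. (x l)\<^sup>2) * S + (\<Sum>l\<in>UNIV. (y l)\<^sup>2) * S + (\<Sum>m\<in>UNIV - {k, k'}. R m + real CARD('q) * S)"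
      unfolding sum_UNIV_two[OF assms, of "\<lambda>m. (\<Sum>b\<in>UNIV. (z m b)\<^sup>2) * S"] Rm[symmetric]
      by (simp add: z_def x_def y_def)
    also have "\<dots> = C + C' + X3 + Y3 + (\<Sum>m\<in>UNIV - {k, k'}. R m) + (2 * (real CARD('q) - 1) + (real CARD('p) - 2) * real CARD('q)) * S"
      using xx yy card[of "real CARD('q) * S"] by (simp add: sum.distrib algebra_simps)
    finally show ?thesis using False by (simp add: eig_def eig_shift_def middle_coeff_def algebra_simps)
  qed
  have S'': "(\<Sum>l\<in>UNIV. entry (k, l) A * entry (k', l) A) = S" by (simp add: S_def x_def y_def)
  show ?thesis
    unfolding num_infl_def main diag rest C_def[symmetric] C'_def[symmetric] S'' by (simp add: algebra_simps)
qed

end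

section \<open>Orthogonal decomposition and variances\<close>

context independent_entries
begin

lemma base_1 [simp]: "base i (Suc 0) z = z"
  by (simp add: base_def)

lemma base_2: "base i 2 z = z\<^sup>2 - 1"
  by (simp add: base_def)

abbreviation (input) bs :: "'p \<times> 'q \<Rightarrow> nat \<Rightarrow> real^'q^'p \<Rightarrow> real" where
  "bs i s A \<equiv> base i s (entry i A)"

lemma basis_prod_eq:
  "distinct [i, j] \<Longrightarrow> (\<lambda>A. bs i s A * bs j t A) = basis_prod ((\<lambda>_. 0)(j := t, i := s))"
  "distinct [i, j, k] \<Longrightarrow> (\<lambda>A. bs i s A * (bs j t A * bs k u A)) = basis_prod ((\<lambda>_. 0)(k := u, j := t, i := s))"
  "distinct [i, j, k, l] \<Longrightarrow>
    (\<lambda>A. bs i s A * (bs j t A * (bs k u A * bs l v A))) = basis_prod ((\<lambda>_. 0)(l := v, k := u, j := t, i := s))"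
  by (auto simp: fun_eq_iff basis_prod_upd basis_prod_0 simp del: fun_upd_apply) (auto simp: basis_prod_upd basis_prod_0)

lemma pure_prods:
  "distinct [i, j] \<Longrightarrow> s \<noteq> 0 \<Longrightarrow> t \<noteq> 0 \<Longrightarrow> pure {i, j} (\<lambda>A. bs i s A * bs j t A)"
  "distinct [i, j, k] \<Longrightarrow> s \<noteq> 0 \<Longrightarrow> t \<noteq> 0 \<Longrightarrow> u \<noteq> 0 \<Longrightarrow> pure {i, j, k} (\<lambda>A. bs i s A * (bs j t A * bs k u A))"
  "distinct [i, j, k, l] \<Longrightarrow> s \<noteq> 0 \<Longrightarrow> t \<noteq> 0 \<Longrightarrow> u \<noteq> 0 \<Longrightarrow> v \<noteq> 0 \<Longrightarrow>
    pure {i, j, k, l} (\<lambda>A. bs i s A * (bs j t A * (bs k u A * bs l v A)))"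
  by (simp_all only: basis_prod_eq) (auto intro!: pure.basis split: if_splits)

lemma inner_prods:
  "distinct [i, j] \<Longrightarrow> inner_L2 (\<lambda>A. bs i s A * bs j t A) (\<lambda>A. bs i s' A * bs j t' A) = gram i s s' * gram j t t'"
  "distinct [i, j, k] \<Longrightarrow> inner_L2 (\<lambda>A. bs i s A * (bs j t A * bs k u A)) (\<lambda>A. bs i s' A * (bs j t' A * bs k u' A))
    = gram i s s' * (gram j t t' * gram k u u')"
  "distinct [i, j, k, l] \<Longrightarrow> inner_L2 (\<lambda>A. bs i s A * (bs j t A * (bs k u A * bs l v A)))
      (\<lambda>A. bs i s' A * (bs j t' A * (bs k u' A * bs l v' A)))
    = gram i s s' * (gram j t t' * (gram k u u' * gram l v v'))"
  by (simp_all only: basis_prod_eq) (simp_all add: inner_basis_prod_upd inner_basis_prod_0)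

text \<open>The three products lie in the same component, so mixed terms survive. The two cubic
  products have inner product \<open>\<beta> (k, l) * \<beta> (k', l)\<close>, which leads to the
  row covariance in the variance formula; each of them meets the bilinear product in one fourth
  moment.\<close>

lemma
  assumes "k \<noteq> k'"
  shows pure_diag_part: "pure {(k, l), (k', l)} (diag_part k k' l)"
    and norm_diag_part: "inner_L2 (diag_part k k' l) (diag_part k k' l) = cube_var (k, l) + cube_var (k', l)
      + (row_mean \<beta> k + 3)\<^sup>2 + 2 * \<beta> (k, l) * \<beta> (k', l) - 2 * (row_mean \<beta> k + 3) * (\<beta> (k, l) + \<beta> (k', l))"
proof -
  define c where "c = - (row_mean \<beta> k + 3)"
  let ?f = "\<lambda>s t A. bs (k, l) s A * bs (k', l) t A"
  have ne: "distinct [(k, l), (k', l)]" using assms by simp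
  have eq: "diag_part k k' l = (\<lambda>A. (?f 3 (Suc 0) A + ?f (Suc 0) 3 A) + c * ?f (Suc 0) (Suc 0) A)"
    by (simp add: fun_eq_iff diag_part_def c_def algebra_simps)
  have p: "pure {(k, l), (k', l)} (?f s t)" if "s \<noteq> 0" "t \<noteq> 0" for s t
    using pure_prods(1)[OF ne that] .
  show "pure {(k, l), (k', l)} (diag_part k k' l)"
    unfolding eq by (intro pure.add pure.cmult p) auto
  have L: "L2_fun (?f 3 (Suc 0))" "L2_fun (?f (Suc 0) 3)" "L2_fun (?f (Suc 0) (Suc 0))"
    using pure_L2[OF p[of 3 "Suc 0"]] pure_L2[OF p[of "Suc 0" 3]] pure_L2[OF p[of "Suc 0" "Suc 0"]] by simp_all
  note L' = L2_fun_add[OF L(1,2)] L2_fun_cmult[OF L(3), of c] L2_fun_add[OF L2_fun_add[OF L(1,2)] L2_fun_cmult[OF L(3), of c]]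
  have i: "inner_L2 (?f s t) (?f s' t') = gram (k, l) s s' * gram (k', l) t t'" for s t s' t'
    using inner_prods(1)[OF ne] .
  have "inner_L2 (diag_part k k' l) (diag_part k k' l) = cube_var (k, l) + cube_var (k', l)
      + c\<^sup>2 + 2 * \<beta> (k, l) * \<beta> (k', l) + 2 * c * (\<beta> (k, l) + \<beta> (k', l))"
    unfolding eq
    apply (simp only: inner_L2_add_left[OF L'(1,2,3)] inner_L2_add_right[OF L'(1,2)] inner_L2_add_left[OF L(1,2)]
        inner_L2_add_right[OF L(1,2)] inner_L2_cmult_left inner_L2_cmult_right L L' i)
    apply (simp add: algebra_simps power2_eq_square)
    done
  then show "inner_L2 (diag_part k k' l) (diag_part k k' l) = cube_var (k, l) + cube_var (k', l)
      + (row_mean \<beta> k + 3)\<^sup>2 + 2 * \<beta> (k, l) * \<beta> (k', l) - 2 * (row_mean \<beta> k + 3) * (\<beta> (k, l) + \<beta> (k', l))"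
    by (simp add: c_def power2_eq_square algebra_simps)
qed

lemma
  assumes "k \<noteq> k'" "l \<noteq> l'"
  shows pure_cross_part: "pure {(k, l), (k, l'), (k', l')} (cross_part k k' (l, l'))"
    and norm_cross_part: "inner_L2 (cross_part k k' (l, l')) (cross_part k k' (l, l')) = \<beta> (k, l) - 1"
proof -
  have d: "distinct [(k, l), (k, l'), (k', l')]" using assms by simp
  have eq: "cross_part k k' (l, l') = (\<lambda>A. bs (k, l) 2 A * (bs (k, l') (Suc 0) A * bs (k', l') (Suc 0) A))"
    by (simp add: fun_eq_iff cross_part_def base_2)
  show "pure {(k, l), (k, l'), (k', l')} (cross_part k k' (l, l'))"
    unfolding eq by (rule pure_prods(2)[OF d]) auto
  show "inner_L2 (cross_part k k' (l, l')) (cross_part k k' (l, l')) = \<beta> (k, l) - 1"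
    unfolding eq inner_prods(2)[OF d] by simp
qed

definition rest_supp :: "nat \<Rightarrow> 'p \<Rightarrow> 'p \<Rightarrow> 'p \<times> 'q \<times> 'q \<Rightarrow> ('p \<times> 'q) set" where
  "rest_supp N k k' = (\<lambda>(m, l, l'). if N = 0 then {(m, l), (m, l'), (k, l'), (k', l)} else {(m, l), (k, l'), (k', l')})"

lemma
  assumes "k \<noteq> k'" "m \<noteq> k" "m \<noteq> k'"
  shows pure_rest_part: "pure (rest_supp N k k' (m, l, l')) (rest_part N k k' (m, l, l'))"
    and norm_rest_part: "inner_L2 (rest_part N k k' (m, l, l')) (rest_part N k k' (m, l, l')) =
      (if N = 0 \<and> l \<noteq> l' then 1 else \<beta> (m, l) - 1)"
proof -
  have d: "distinct [(m, l), (k, b), (k', b)]" for b using assms by simp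
  have sq: "pure {(m, l), (k, b), (k', b)} (\<lambda>A. ((entry (m, l) A)\<^sup>2 - 1) * (entry (k, b) A * entry (k', b) A))"
    "inner_L2 (\<lambda>A. ((entry (m, l) A)\<^sup>2 - 1) * (entry (k, b) A * entry (k', b) A))
      (\<lambda>A. ((entry (m, l) A)\<^sup>2 - 1) * (entry (k, b) A * entry (k', b) A)) = \<beta> (m, l) - 1" for b
    using pure_prods(2)[OF d, of 2 "Suc 0" "Suc 0"] inner_prods(2)[OF d, where s=2 and s'=2 and t="Suc 0" and t'="Suc 0" and u="Suc 0" and u'="Suc 0"]
    by (simp_all add: base_2)
  have d4: "distinct [(m, l), (m, l'), (k, l'), (k', l)]" if "l \<noteq> l'" using that assms by simp
  have xx: "pure {(m, l), (m, l'), (k, l'), (k', l)} (\<lambda>A. entry (m, l) A * (entry (m, l') A * (entry (k, l') A * entry (k', l) A)))"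
    "inner_L2 (\<lambda>A. entry (m, l) A * (entry (m, l') A * (entry (k, l') A * entry (k', l) A)))
      (\<lambda>A. entry (m, l) A * (entry (m, l') A * (entry (k, l') A * entry (k', l) A))) = 1" if "l \<noteq> l'"
    using pure_prods(3)[OF d4[OF that], of "Suc 0" "Suc 0" "Suc 0" "Suc 0"]
      inner_prods(3)[OF d4[OF that], where s="Suc 0" and s'="Suc 0" and t="Suc 0" and t'="Suc 0" and u="Suc 0" and u'="Suc 0" and v="Suc 0" and v'="Suc 0"]
    by simp_all
  show "pure (rest_supp N k k' (m, l, l')) (rest_part N k k' (m, l, l'))"
    using sq(1)[of l] sq(1)[of l'] xx(1)
    by (cases "N = 0"; cases "l = l'") (simp_all add: rest_part_def rest_supp_def mult.assoc insert_commute)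
  show "inner_L2 (rest_part N k k' (m, l, l')) (rest_part N k k' (m, l, l')) =
      (if N = 0 \<and> l \<noteq> l' then 1 else \<beta> (m, l) - 1)"
    using sq(2)[of l] sq(2)[of l'] xx(2)
    by (cases "N = 0"; cases "l = l'") (simp_all add: rest_part_def mult.assoc)
qed

text \<open>The supports of the summands are told apart by the columns they use in each row.\<close>

lemma row_supp_eq: "S = T \<Longrightarrow> {x. (r, x) \<in> S} = {x. (r, x) \<in> T}"
  by simp

text \<open>Pythagoras for four groups of summands. In rows k and k' a diagonal part uses one column
  each, a cross part uses two columns in one row and one in the other, and only the rest parts reach
  a third row; so no two summands share a support.\<close>

lemma norm_num_infl:
  assumes kk': "k \<noteq> k'"
  shows "inner_L2 (num_infl N k k') (num_infl N k k') =
    (\<Sum>l\<in>UNIV. inner_L2 (diag_part k k' l) (diag_part k k' l))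
    + (\<Sum>j\<in>{(l, l'). l \<noteq> l'}. inner_L2 (cross_part k k' j) (cross_part k k' j))
    + (\<Sum>j\<in>{(l, l'). l \<noteq> l'}. inner_L2 (cross_part k' k j) (cross_part k' k j))
    + (\<Sum>j\<in>(UNIV - {k, k'}) \<times> UNIV. inner_L2 (rest_part N k k' j) (rest_part N k k' j))"
proof -
  let ?NE = "{(l :: 'q, l'). l \<noteq> l'}" and ?R = "(UNIV - {k, k'}) \<times> (UNIV :: ('q \<times> 'q) set)"
  let ?D = "\<lambda>A. \<Sum>l\<in>UNIV. diag_part k k' l A" and ?C = "\<lambda>A. \<Sum>j\<in>?NE. cross_part k k' j A"
    and ?C' = "\<lambda>A. \<Sum>j\<in>?NE. cross_part k' k j A" and ?Q = "\<lambda>A. \<Sum>j\<in>?R. rest_part N k k' j A"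
  define sD where "sD l = {(k, l), (k', l)}" for l :: 'q
  define sC where "sC k k' j = {(k, fst j), (k, snd j), (k', snd j)}" for k k' :: 'p and j :: "'q \<times> 'q"
  have pD: "pure (sD l) (diag_part k k' l)" for l using pure_diag_part[OF kk'] by (simp add: sD_def)
  have pC: "pure (sC k k' j) (cross_part k k' j)" if "j \<in> ?NE" "k \<noteq> k'" for j k k'
    using pure_cross_part[OF that(2)] that(1) by (auto simp: sC_def)
  have pR: "pure (rest_supp N k k' j) (rest_part N k k' j)" if "j \<in> ?R" for j
    using pure_rest_part[OF kk'] that by (cases j) auto
  have rD: "{x. (k, x) \<in> sD l} = {l}" "{x. (k', x) \<in> sD l} = {l}" for l
    by (auto simp: sD_def)
  have rC: "{x. (k, x) \<in> sC k k' j} = {fst j, snd j}"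
    "{x. (k', x) \<in> sC k k' j} = {snd j}"
    "m \<noteq> k \<Longrightarrow> m \<noteq> k' \<Longrightarrow> {x. (m, x) \<in> sC k k' j} = {}" if "k \<noteq> k'" for j m and k k' :: 'p
    using that by (auto simp: sC_def)
  have rR: "\<exists>x y. {z. (k, z) \<in> rest_supp N k k' j} = {x} \<and> {z. (k', z) \<in> rest_supp N k k' j} = {y} \<and> {z. (fst j, z) \<in> rest_supp N k k' j} \<noteq> {}"
    if "j \<in> ?R" for j
    using that kk' by (cases j) (auto simp: rest_supp_def)
  have L: "L2_fun ?D" "L2_fun ?C" "L2_fun ?C'" "L2_fun ?Q"
    using kk' by (auto intro!: L2_fun_sum intro: pure_L2 pD pC pR)
  have DC: "inner_L2 ?D ?C = 0"
  proof (rule inner_pure_sums[OF _ _ pD pC])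
    show "sD l \<noteq> sC k k' j" if "j \<in> ?NE" for l j
      using row_supp_eq[of "sD l" _ k] rC(1)[OF kk', of j] rD(1)[of l] that by (cases j) fastforce
  qed (use kk' in auto)
  have DC': "inner_L2 ?D ?C' = 0"
  proof (rule inner_pure_sums[OF _ _ pD pC])
    show "sD l \<noteq> sC k' k j" if "j \<in> ?NE" for l j
      using row_supp_eq[of "sD l" _ k'] rC(1)[OF kk'[symmetric], of j] rD(2)[of l] that by (cases j) fastforce
  qed (use kk' in auto)
  have CC': "inner_L2 ?C ?C' = 0"
  proof (rule inner_pure_sums[OF _ _ pC pC])
    show "sC k k' i \<noteq> sC k' k j" if "i \<in> ?NE" "j \<in> ?NE" for i j
      using row_supp_eq[of "sC k k' i" _ k] rC(1)[OF kk', of i] rC(2)[OF kk'[symmetric], of j] that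
      by (cases i; cases j) fastforce
  qed (use kk' in auto)
  have DQ: "inner_L2 ?D ?Q = 0"
  proof (rule inner_pure_sums[OF _ _ pD pR])
    show "sD l \<noteq> rest_supp N k k' j" if "j \<in> ?R" for l j
    proof
      assume e: "sD l = rest_supp N k k' j"
      have "{z. (fst j, z) \<in> sD l} = {}" using that by (cases j) (auto simp: sD_def)
      then show False using rR[OF that] unfolding e by blast
    qed
  qed auto
  have CQ: "inner_L2 ?C ?Q = 0"
  proof (rule inner_pure_sums[OF _ _ pC pR])
    show "sC k k' i \<noteq> rest_supp N k k' j" if "i \<in> ?NE" "j \<in> ?R" for i j
    proof
      assume e: "sC k k' i = rest_supp N k k' j"
      have "{z. (fst j, z) \<in> sC k k' i} = {}" using rC(3)[OF kk'] that by auto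
      then show False using rR[OF that(2)] unfolding e by blast
    qed
  qed (use kk' in auto)
  have CQ': "inner_L2 ?C' ?Q = 0"
  proof (rule inner_pure_sums[OF _ _ pC pR])
    show "sC k' k i \<noteq> rest_supp N k k' j" if "i \<in> ?NE" "j \<in> ?R" for i j
    proof
      assume e: "sC k' k i = rest_supp N k k' j"
      have "{z. (fst j, z) \<in> sC k' k i} = {}" using rC(3)[OF kk'[symmetric]] that by auto
      then show False using rR[OF that(2)] unfolding e by blast
    qed
  qed (use kk' in auto)
  have nD: "inner_L2 ?D ?D = (\<Sum>l\<in>UNIV. inner_L2 (diag_part k k' l) (diag_part k k' l))"
    by (rule norm_pure_sum[OF _ pD]) (auto simp: inj_on_def sD_def)
  have nC: "inner_L2 (\<lambda>A. \<Sum>j\<in>?NE. cross_part k k' j A) (\<lambda>A. \<Sum>j\<in>?NE. cross_part k k' j A) =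
      (\<Sum>j\<in>?NE. inner_L2 (cross_part k k' j) (cross_part k k' j))" if "k \<noteq> k'" for k k'
  proof (rule norm_pure_sum[OF _ pC])
    show "inj_on (sC k k') ?NE"
    proof (rule inj_onI)
      fix i j assume ij: "i \<in> ?NE" "j \<in> ?NE" and e: "sC k k' i = sC k k' j"
      have "{fst i, snd i} = {fst j, snd j}" "{snd i} = {snd j}"
        using row_supp_eq[OF e, of k] row_supp_eq[OF e, of k'] unfolding rC(1,2)[OF that] by auto
      then show "i = j" using ij by (cases i; cases j) (auto simp: doubleton_eq_iff)
    qed
  qed (use that in auto)
  have nQ: "inner_L2 ?Q ?Q = (\<Sum>j\<in>?R. inner_L2 (rest_part N k k' j) (rest_part N k k' j))"
  proof (rule norm_pure_sum[OF _ pR])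
    show "inj_on (rest_supp N k k') ?R"
    proof (rule inj_onI)
      fix i j assume ij: "i \<in> ?R" "j \<in> ?R" and e: "rest_supp N k k' i = rest_supp N k k' j"
      obtain m l l' n b b' where i: "i = (m, l, l')" and j: "j = (n, b, b')" by (cases i; cases j) auto
      have ne: "m \<noteq> k" "m \<noteq> k'" "n \<noteq> k" "n \<noteq> k'" using ij i j by auto
      have "(m, l) \<in> rest_supp N k k' j" unfolding e[symmetric] i by (auto simp: rest_supp_def)
      then have "m = n" using ne unfolding j rest_supp_def by (auto split: if_splits)
      moreover have "{x. (k, x) \<in> rest_supp N k k' i} = {l'}" "{x. (k, x) \<in> rest_supp N k k' j} = {b'}"
        using ne kk' by (auto simp: i j rest_supp_def)
      then have "l' = b'" unfolding e by simp
      \<comment> \<open>The column l is visible in row k' for N = 0, but in the third row for N =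
        1.\<close>
      moreover have "l = b"
      proof (cases "N = 0")
        case True
        then have "{x. (k', x) \<in> rest_supp N k k' i} = {l}" "{x. (k', x) \<in> rest_supp N k k' j} = {b}"
          using ne kk' by (auto simp: i j rest_supp_def)
        then show ?thesis unfolding e by simp
      next
        case False
        then have "{x. (m, x) \<in> rest_supp N k k' i} = {l}" "{x. (m, x) \<in> rest_supp N k k' j} = {b}"
          using ne kk' \<open>m = n\<close> by (auto simp: i j rest_supp_def)
        then show ?thesis unfolding e by simp
      qed
      ultimately show "i = j" by (simp add: i j)
    qed
  qed auto
  have num: "num_infl N k k' = (\<lambda>A. ((?D A + ?C A) + ?C' A) + ?Q A)"
    using num_infl_decomp[OF kk'] by (simp add: fun_eq_iff)
  note La = L2_fun_add[OF L(1,2)] L2_fun_add[OF L2_fun_add[OF L(1,2)] L(3)] L2_fun_add[OF L2_fun_add[OF L2_fun_add[OF L(1,2)] L(3)] L(4)]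
  have "inner_L2 (num_infl N k k') (num_infl N k k') = inner_L2 ?D ?D + inner_L2 ?C ?C + inner_L2 ?C' ?C' + inner_L2 ?Q ?Q"
    unfolding num
    by (simp only: inner_L2_add_left[OF La(2) L(4)] inner_L2_add_left[OF La(1) L(3)] inner_L2_add_left[OF L(1,2)]
        inner_L2_add_right[OF La(2) L(4)] inner_L2_add_right[OF La(1) L(3)] inner_L2_add_right[OF L(1,2)] L La
        DC DC' CC' DQ CQ CQ' inner_L2_commute[of ?C ?D] inner_L2_commute[of ?C' ?D] inner_L2_commute[of ?C' ?C]
        inner_L2_commute[of ?Q ?D] inner_L2_commute[of ?Q ?C] inner_L2_commute[of ?Q ?C'] add_0_left add_0_right)
  then show ?thesis unfolding nD nC[OF kk'] nC[OF kk'[symmetric]] nQ .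
qed

lemma sum_off_diagonal: "(\<Sum>(l, l')\<in>{(l :: 'q, l'). l \<noteq> l'}. f l) = (real CARD('q) - 1) * (\<Sum>l\<in>UNIV. f l)"
  using sum_split_diagonal[of "\<lambda>l l'. f l"] by (simp add: sum_distrib_left[symmetric] left_diff_distrib)

text \<open>Origin of the constants, with r and r' the two row averages: the diagonal parts give (r
  + 3)^2 - 2 (r + 3) (r + r') = - r^2 - 2 r r' - 6 r' + 9, where - 2 r r' completes the covariance,
  and the cross parts add (q - 1) (r + r' - 2). This yields the coefficient q - 7 and the constant
  11 - 2 q. Besides row averages, the third rows add (p - 2) (q - 2) for N = 0 and - q (p - 2) for N
  = 1.\<close>

lemma gamma_infl_offdiag_norm:
  assumes kk': "k \<noteq> k'" and ne: "row_mean \<beta> k \<noteq> row_mean \<beta> k'"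
  shows "expectation (\<lambda>x. (gamma_infl N k k' (Z x))\<^sup>2) =
    (row_mean cube_var k + row_mean cube_var k' - (row_mean \<beta> k)\<^sup>2
      + 2 * (row_mean (\<lambda>i. \<beta> i * \<beta> (k', snd i)) k - row_mean \<beta> k * row_mean \<beta> k')
      + (real CARD('q) - 1) * row_mean \<beta> k + (real CARD('q) - 7) * row_mean \<beta> k'
      + (if N = 0 then (\<Sum>m\<in>UNIV - {k, k'}. row_mean \<beta> m) + real CARD('p) * real CARD('q) - 2 * real CARD('p) - 4 * real CARD('q) + 15
         else real CARD('q) * (\<Sum>m\<in>UNIV - {k, k'}. row_mean \<beta> m) - real CARD('p) * real CARD('q) + 11))
    / (real CARD('q) * (row_mean \<beta> k - row_mean \<beta> k')\<^sup>2)"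
proof -
  define q p where "q = real CARD('q)" and "p = real CARD('p)"
  define r where "r = row_mean \<beta>"
  have q: "q > 0" by (simp add: q_def)
  have card: "(\<Sum>m\<in>UNIV - {k, k'}. c) = (p - 2) * c" for c :: real
  proof -
    have "CARD('p) \<ge> 2" using card_mono[of UNIV "{k, k'}"] kk' by simp
    then show ?thesis using kk' by (simp add: card_Diff_subset of_nat_diff p_def)
  qed
  have row: "(\<Sum>l\<in>UNIV. f (k, l)) = q * row_mean f k" for f k by (simp add: sum_row q_def)
  have D: "(\<Sum>l\<in>UNIV. inner_L2 (diag_part k k' l) (diag_part k k' l)) =
     q * (row_mean cube_var k + row_mean cube_var k' + (r k + 3)\<^sup>2 + 2 * row_mean (\<lambda>i. \<beta> i * \<beta> (k', snd i)) k - 2 * (r k + 3) * (r k + r k'))"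
  proof -
    have "(\<Sum>l\<in>UNIV. inner_L2 (diag_part k k' l) (diag_part k k' l)) =
       (\<Sum>l\<in>UNIV. cube_var (k, l)) + (\<Sum>l\<in>UNIV. cube_var (k', l)) + q * (r k + 3)\<^sup>2
        + 2 * (\<Sum>l\<in>UNIV. \<beta> (k, l) * \<beta> (k', l)) - 2 * (r k + 3) * ((\<Sum>l\<in>UNIV. \<beta> (k, l)) + (\<Sum>l\<in>UNIV. \<beta> (k', l)))"
      unfolding norm_diag_part[OF kk'] r_def[symmetric]
      by (simp only: sum.distrib sum_subtractf sum_distrib_left[symmetric] mult.assoc) (simp add: q_def)
    then show ?thesis
      using row[of cube_var k] row[of cube_var k'] row[of \<beta> k] row[of \<beta> k'] row[of "\<lambda>i. \<beta> i * \<beta> (k', snd i)" k]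
      by (simp add: r_def algebra_simps)
  qed
  have C: "(\<Sum>j\<in>{(l, l'). l \<noteq> l'}. inner_L2 (cross_part k k' j) (cross_part k k' j)) = (q - 1) * (q * (r k - 1))" if "k \<noteq> k'" for k k'
  proof -
    have "(\<Sum>j\<in>{(l, l'). l \<noteq> l'}. inner_L2 (cross_part k k' j) (cross_part k k' j)) = (\<Sum>(l, l')\<in>{(l, l'). l \<noteq> l'}. \<beta> (k, l) - 1)"
      using norm_cross_part[OF that] by (intro sum.cong) auto
    then show ?thesis unfolding sum_off_diagonal using row[of \<beta> k] by (simp add: sum_subtractf r_def q_def algebra_simps)
  qed
  have R: "(\<Sum>j\<in>(UNIV - {k, k'}) \<times> UNIV. inner_L2 (rest_part N k k' j) (rest_part N k k' j)) =
     q * (if N = 0 then (\<Sum>m\<in>UNIV - {k, k'}. r m) + (p - 2) * (q - 2) else q * ((\<Sum>m\<in>UNIV - {k, k'}. r m) - (p - 2)))"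
  proof -
    have "(\<Sum>j\<in>(UNIV - {k, k'}) \<times> UNIV. inner_L2 (rest_part N k k' j) (rest_part N k k' j)) =
       (\<Sum>m\<in>UNIV - {k, k'}. \<Sum>b\<in>UNIV. inner_L2 (rest_part N k k' (m, b)) (rest_part N k k' (m, b)))"
      by (simp add: sum.cartesian_product split_beta)
    also have "\<dots> = (\<Sum>m\<in>UNIV - {k, k'}. \<Sum>l\<in>UNIV. \<Sum>l'\<in>UNIV. if N = 0 \<and> l \<noteq> l' then 1 else \<beta> (m, l) - 1)"
      unfolding sum_UNIV_prod using norm_rest_part[OF kk'] by (intro sum.cong refl) auto
    also have "\<dots> = (\<Sum>m\<in>UNIV - {k, k'}. q * (if N = 0 then r m + (q - 2) else q * (r m - 1)))"
    proof (intro sum.cong refl)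
      fix m
      show "(\<Sum>l\<in>UNIV. \<Sum>l'\<in>UNIV. if N = 0 \<and> l \<noteq> l' then 1 else \<beta> (m, l) - 1) = q * (if N = 0 then r m + (q - 2) else q * (r m - 1))"
      proof (cases "N = 0")
        case True
        have "(\<Sum>l\<in>UNIV. \<Sum>l'\<in>UNIV. if N = 0 \<and> l \<noteq> l' then 1 else \<beta> (m, l) - 1) =
          (\<Sum>l\<in>UNIV. \<Sum>l'\<in>(UNIV :: 'q set). 1 + kron l l' * (\<beta> (m, l) - 2))"
          using True by (intro sum.cong refl) (auto simp: kron_def)
        also have "\<dots> = q * q + (q * r m - 2 * q)"
          using row[of \<beta> m] by (simp add: sum.distrib sum_distrib_right[symmetric] sum_subtractf q_def r_def)
        finally show ?thesis using True by (simp add: algebra_simps)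
      next
        case False
        then show ?thesis using row[of \<beta> m] by (simp add: sum_distrib_left[symmetric] sum_subtractf q_def[symmetric] r_def algebra_simps)
      qed
    qed
    also have "\<dots> = q * (\<Sum>m\<in>UNIV - {k, k'}. if N = 0 then r m + (q - 2) else q * (r m - 1))"
      by (simp add: sum_distrib_left)
    also have "(\<Sum>m\<in>UNIV - {k, k'}. if N = 0 then r m + (q - 2) else q * (r m - 1)) =
        (if N = 0 then (\<Sum>m\<in>UNIV - {k, k'}. r m) + (p - 2) * (q - 2) else q * ((\<Sum>m\<in>UNIV - {k, k'}. r m) - (p - 2)))"
      using card[of "q - 2"] card[of 1] by (simp add: sum.distrib sum_subtractf sum_distrib_left[symmetric])
    finally show ?thesis .
  qed
  define S where "S = (\<Sum>m\<in>UNIV - {k, k'}. r m)"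
  define num where "num = row_mean cube_var k + row_mean cube_var k' - (r k)\<^sup>2
      + 2 * (row_mean (\<lambda>i. \<beta> i * \<beta> (k', snd i)) k - r k * r k') + (q - 1) * r k + (q - 7) * r k'
      + (if N = 0 then S + p * q - 2 * p - 4 * q + 15 else q * S - p * q + 11)"
  have "inner_L2 (num_infl N k k') (num_infl N k k') = q * num"
    unfolding norm_num_infl[OF kk'] D C[OF kk'] C[OF kk'[symmetric]] R S_def[symmetric] num_def
    by (simp add: algebra_simps power2_eq_square)
  then have E: "expectation (\<lambda>x. (num_infl N k k' (Z x))\<^sup>2) = q * num"
    by (simp add: inner_L2_def power2_eq_square)
  have "expectation (\<lambda>x. (gamma_infl N k k' (Z x))\<^sup>2) = expectation (\<lambda>x. (num_infl N k k' (Z x))\<^sup>2) / (q * (r k - r k'))\<^sup>2"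
    unfolding gamma_infl_offdiag[OF assms] by (simp add: power_divide q_def r_def)
  also have "\<dots> = num / (q * (r k - r k')\<^sup>2)"
    unfolding E using q by (simp add: power2_eq_square)
  finally show ?thesis unfolding num_def S_def r_def q_def p_def .
qed

text \<open>Only the inverse square root contributes: a multiple of the sum of the centered squares
  in row k, which are orthogonal and have second moment \<beta> - 1.\<close>

lemma gamma_infl_diag_norm:
  "expectation (\<lambda>x. (gamma_infl N k k (Z x))\<^sup>2) = (row_mean \<beta> k - 1) / (4 * real CARD('q))"
proof -
  have bp: "(\<lambda>A. base i s (entry i A)) = basis_prod ((\<lambda>_. 0)(i := s))" for i s
    by (simp add: fun_eq_iff basis_prod_upd basis_prod_0 del: fun_upd_apply)
  have p: "pure {(k, l)} (\<lambda>A. base (k, l) 2 (entry (k, l) A))" for l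
    unfolding bp by (auto intro!: pure.basis split: if_splits)
  have n: "inner_L2 (\<lambda>A. base (k, l) 2 (entry (k, l) A)) (\<lambda>A. base (k, l) 2 (entry (k, l) A)) = \<beta> (k, l) - 1" for l
    unfolding bp by (simp add: inner_basis_prod_upd inner_basis_prod_0)
  have "gamma_infl N k k A = (- 1 / (2 * real CARD('q))) * (\<Sum>l\<in>UNIV. base (k, l) 2 (entry (k, l) A))" for A
    by (simp add: gamma_infl_def row_infl_def base_2 power2_eq_square)
  then have "expectation (\<lambda>x. (gamma_infl N k k (Z x))\<^sup>2) = (1 / (4 * (real CARD('q))\<^sup>2)) *
     inner_L2 (\<lambda>A. \<Sum>l\<in>UNIV. base (k, l) 2 (entry (k, l) A)) (\<lambda>A. \<Sum>l\<in>UNIV. base (k, l) 2 (entry (k, l) A))"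
    by (simp add: inner_L2_def power_mult_distrib power_divide power2_eq_square)
  also have "inner_L2 (\<lambda>A. \<Sum>l\<in>UNIV. base (k, l) 2 (entry (k, l) A)) (\<lambda>A. \<Sum>l\<in>UNIV. base (k, l) 2 (entry (k, l) A))
     = (\<Sum>l\<in>UNIV. \<beta> (k, l) - 1)"
    by (subst norm_pure_sum[OF _ p]) (auto simp: inj_on_def n[simplified])
  also have "\<dots> = real CARD('q) * (row_mean \<beta> k - 1)"
    using sum_row[of \<beta> k] by (simp add: sum_subtractf algebra_simps)
  finally show ?thesis by (simp add: power2_eq_square)
qed

end

section \<open>Eigenvectors and the estimate\<close>

text \<open>Writing the eigenvalue as the Rayleigh quotient of a unit row makes it a polynomial in
  the entries of B and U, so that its limit follows from theirs and no eigenvalue has to be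
  chosen.\<close>

lemma orthogonal_eigenvectors_rows:
  fixes W :: "real^'n^'n"
  assumes W: "orthogonal_matrix W" and ev: "eigenvector B (column j W)"
  defines "U \<equiv> transpose W"
  shows "(\<Sum>m\<in>UNIV. (U $ j $ m)\<^sup>2) = 1"
    and "(\<Sum>m\<in>UNIV. B $ k $ m * U $ j $ m) = (\<Sum>i\<in>UNIV. U $ j $ i * (\<Sum>m\<in>UNIV. B $ i $ m * U $ j $ m)) * U $ j $ k"
proof -
  have "(transpose W ** W) $ j $ j = mat 1 $ j $ j" using W by (simp add: orthogonal_matrix_def)
  then show unit: "(\<Sum>m\<in>UNIV. (U $ j $ m)\<^sup>2) = 1"
    by (simp add: matrix_matrix_mult_def transpose_def U_def mat_def power2_eq_square)
  obtain c where c: "B *v column j W = c *\<^sub>R column j W" using ev by (auto simp: eigenvector_def)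
  have B: "(\<Sum>m\<in>UNIV. B $ k $ m * U $ j $ m) = c * U $ j $ k" for k
    using arg_cong[OF c, of "\<lambda>v. v $ k"] by (simp add: matrix_vector_mult_def column_def U_def transpose_def)
  have "(\<Sum>i\<in>UNIV. U $ j $ i * (\<Sum>m\<in>UNIV. B $ i $ m * U $ j $ m)) = c * (\<Sum>m\<in>UNIV. (U $ j $ m)\<^sup>2)"
    unfolding B by (simp add: sum_distrib_left power2_eq_square mult_ac)
  then show "(\<Sum>m\<in>UNIV. B $ k $ m * U $ j $ m) = (\<Sum>i\<in>UNIV. U $ j $ i * (\<Sum>m\<in>UNIV. B $ i $ m * U $ j $ m)) * U $ j $ k"
    using unit B by simp
qed

lemma sum_kron_remove: "(\<Sum>m\<in>UNIV - {k}. f m * kron j m) = (if j = k then 0 else f j)"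
  for f :: "'i::finite \<Rightarrow> real"
proof (cases "j = k")
  case False
  have "(\<Sum>m\<in>UNIV. f m * kron j m) = f k * kron j k + (\<Sum>m\<in>UNIV - {k}. f m * kron j m)"
    by (simp add: sum.remove del: sum_kron)
  then show ?thesis using False by (simp add: kron_def[of j k])
qed (auto simp: kron_def)

context iid_sample
begin

text \<open>For \<open>j \<noteq> k\<close> the eigenvalue equation reads
  \<open>(\<Lambda>\<^sub>j - B\<^sub>k\<^sub>k) U\<^sub>j\<^sub>k = \<Sum>\<^sub>m\<^sub>\<noteq>\<^sub>k B\<^sub>k\<^sub>m U\<^sub>j\<^sub>m\<close>, where every summand except \<open>m = j\<close> is a product
  of an \<open>O\<^sub>P (n\<^sup>-\<^sup>1\<^sup>/\<^sup>2)\<close> and an \<open>o\<^sub>P (1)\<close> term.\<close>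

lemma asym_linear_eigenvectors:
  fixes B U :: "nat \<times> 'a \<Rightarrow> real^'n^'n" and ev :: "'n \<Rightarrow> real"
  assumes B: "\<And>i j. asym_linear (\<lambda>w. B w $ i $ j) (kron i j * ev i) (b i j)"
    and U: "\<And>i j. ((\<lambda>w. U w $ i $ j) \<longlongrightarrow> kron i j) (in_prob M)"
    and distinct: "\<And>i j. i \<noteq> j \<Longrightarrow> ev i \<noteq> ev j"
    and unit: "\<forall>\<^sub>F w in in_prob M. \<forall>j. (\<Sum>m\<in>UNIV. (U w $ j $ m)\<^sup>2) = 1"
    and eigen: "\<forall>\<^sub>F w in in_prob M. \<forall>j k. (\<Sum>m\<in>UNIV. B w $ k $ m * U w $ j $ m) = \<Lambda> j w * U w $ j $ k"
    and \<Lambda>: "\<And>j w. \<Lambda> j w = (\<Sum>i\<in>UNIV. U w $ j $ i * (\<Sum>m\<in>UNIV. B w $ i $ m * U w $ j $ m))"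
  shows "asym_linear (\<lambda>w. U w $ j $ k) (kron j k) (\<lambda>A. if j = k then 0 else b k j A / (ev j - ev k))"
proof -
  have Blim: "((\<lambda>w. B w $ i $ j) \<longlongrightarrow> kron i j * ev i) (in_prob M)" for i j
    by (rule asym_linear_tendsto[OF B])
  have \<Lambda>_lim: "((\<lambda>w. \<Lambda> j w) \<longlongrightarrow> ev j) (in_prob M)" for j
  proof -
    have "((\<lambda>w. \<Lambda> j w) \<longlongrightarrow> (\<Sum>i\<in>UNIV. kron j i * (\<Sum>m\<in>UNIV. kron i m * ev i * kron j m))) (in_prob M)"
      unfolding \<Lambda> by (intro tendsto_sum tendsto_mult U Blim)
    then show ?thesis by (simp add: kron_def[of j j])
  qed
  have off: "asym_linear (\<lambda>w. U w $ j $ k) 0 (\<lambda>A. b k j A / (ev j - ev k))" if jk: "j \<noteq> k" for j k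
  proof -
    define s where "s w = (\<Sum>m\<in>UNIV - {k}. B w $ k $ m * U w $ j $ m)" for w
    define d where "d = ev j - ev k"
    have d: "d \<noteq> 0" using distinct[OF jk] by (simp add: d_def)
    \<comment> \<open>Off the diagonal the limit of B is 0, so the entry itself, not only its
      deviation, is O_P(1 / sqrt n).\<close>
    have tB: "tight_seq M (\<lambda>w. sqrt (fst w) * B w $ k $ m)" if "m \<noteq> k" for m
      using asym_linear_tight[OF B[of k m]] that by (simp add: kron_def)
    have den: "((\<lambda>w. \<Lambda> j w - B w $ k $ k) \<longlongrightarrow> d) (in_prob M)"
      using tendsto_diff[OF \<Lambda>_lim[of j] Blim[of k k]] by (simp add: d_def kron_def)
    then have inv: "((\<lambda>w. 1 / (\<Lambda> j w - B w $ k $ k)) \<longlongrightarrow> 1 / d) (in_prob M)"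
      using d by (intro tendsto_divide tendsto_const)
    have "((\<lambda>w. \<Sum>m\<in>UNIV - {k}. (sqrt (fst w) * B w $ k $ m) * (U w $ j $ m - kron j m)) \<longlongrightarrow> 0) (in_prob M)"
      by (intro tendsto_null_sum tight_mult_tendsto_0 tB LIM_zero U) auto
    moreover have "(\<Sum>m\<in>UNIV - {k}. (sqrt (fst w) * B w $ k $ m) * (U w $ j $ m - kron j m)) = sqrt (fst w) * (s w - B w $ k $ j)"
      for w :: "nat \<times> 'a"
      using jk sum_kron_remove[of "\<lambda>m. B w $ k $ m" j k]
      by (simp add: s_def right_diff_distrib sum_subtractf sum_distrib_left[symmetric] mult.assoc)
    ultimately have h: "((\<lambda>w. sqrt (fst w) * (s w - B w $ k $ j)) \<longlongrightarrow> 0) (in_prob M)" by simp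
    \<comment> \<open>The error of U_jk against B_kj / d is split in two: the error of the sum s
      over the random denominator, and B_kj times the error of the reciprocal denominator.\<close>
    have 1: "((\<lambda>w. 1 / (\<Lambda> j w - B w $ k $ k) * (sqrt (fst w) * (s w - B w $ k $ j))) \<longlongrightarrow> 1 / d * 0) (in_prob M)"
      by (rule tendsto_mult[OF inv h])
    have 2: "((\<lambda>w. (sqrt (fst w) * B w $ k $ j) * (1 / (\<Lambda> j w - B w $ k $ k) - 1 / d)) \<longlongrightarrow> 0) (in_prob M)"
      by (intro tight_mult_tendsto_0 tB LIM_zero inv) (use jk in auto)
    have nz: "\<forall>\<^sub>F w in in_prob M. \<Lambda> j w - B w $ k $ k \<noteq> 0"
      using tendsto_imp_eventually_ne[OF den d] .
    have "((\<lambda>w. sqrt (fst w) * (U w $ j $ k - 1 / d * B w $ k $ j)) \<longlongrightarrow> 0) (in_prob M)"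
    proof (rule Lim_transform_eventually)
      show "((\<lambda>w. 1 / (\<Lambda> j w - B w $ k $ k) * (sqrt (fst w) * (s w - B w $ k $ j))
          + (sqrt (fst w) * B w $ k $ j) * (1 / (\<Lambda> j w - B w $ k $ k) - 1 / d)) \<longlongrightarrow> 0) (in_prob M)"
        using tendsto_add[OF 1 2] by simp
      show "\<forall>\<^sub>F w in in_prob M. 1 / (\<Lambda> j w - B w $ k $ k) * (sqrt (fst w) * (s w - B w $ k $ j))
          + (sqrt (fst w) * B w $ k $ j) * (1 / (\<Lambda> j w - B w $ k $ k) - 1 / d) = sqrt (fst w) * (U w $ j $ k - 1 / d * B w $ k $ j)"
        using eigen nz
      proof eventually_elim
        case (elim w)
        have "(\<Sum>m\<in>UNIV. B w $ k $ m * U w $ j $ m) = B w $ k $ k * U w $ j $ k + s w"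
          by (simp add: s_def sum.remove)
        then have "s w = (\<Lambda> j w - B w $ k $ k) * U w $ j $ k" using elim(1) by (simp add: algebra_simps)
        then have "U w $ j $ k = 1 / (\<Lambda> j w - B w $ k $ k) * s w" using elim(2) by simp
        then show ?case by (simp only:) (simp add: algebra_simps)
      qed
    qed
    moreover have "asym_linear (\<lambda>w. 1 / d * B w $ k $ j) (1 / d * (kron k j * ev k)) (\<lambda>A. 1 / d * b k j A)"
      by (intro asym_linear_cmult B)
    ultimately show ?thesis
      using asym_linear_close jk by (fastforce simp: d_def kron_def)
  qed
  show ?thesis
  proof (cases "j = k")
    case False
    then show ?thesis using off[OF False] by (simp add: kron_def)
  next
    case True
    \<comment> \<open>Unit length gives (U_jj - 1) (U_jj + 1) = minus the sum of the squared
      off-diagonal entries, which is of second order; the factor U_jj + 1 tends to 2 and can be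
      divided out.\<close>
    have den: "((\<lambda>w. U w $ j $ j + 1) \<longlongrightarrow> 2) (in_prob M)"
      using tendsto_add[OF U[of j j] tendsto_const[of 1]] by (simp add: kron_def)
    have nz: "\<forall>\<^sub>F w in in_prob M. U w $ j $ j + 1 \<noteq> 0"
      using tendsto_imp_eventually_ne[OF den] by simp
    have sq: "((\<lambda>w. \<Sum>m\<in>UNIV - {j}. (sqrt (fst w) * (U w $ j $ m - 0)) * U w $ j $ m) \<longlongrightarrow> 0) (in_prob M)"
    proof (intro tendsto_null_sum tight_mult_tendsto_0)
      fix m assume "m \<in> UNIV - {j}"
      then have "j \<noteq> m" by auto
      from asym_linear_tight[OF off[OF this]] asym_linear_tendsto[OF off[OF this]]
      show "tight_seq M (\<lambda>w. sqrt (fst w) * (U w $ j $ m - 0))" "((\<lambda>w. U w $ j $ m) \<longlongrightarrow> 0) (in_prob M)" .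
    qed
    have "((\<lambda>w. sqrt (fst w) * (U w $ j $ j - 1)) \<longlongrightarrow> 0) (in_prob M)"
    proof (rule Lim_transform_eventually)
      show "((\<lambda>w. - (\<Sum>m\<in>UNIV - {j}. (sqrt (fst w) * (U w $ j $ m - 0)) * U w $ j $ m) / (U w $ j $ j + 1)) \<longlongrightarrow> 0) (in_prob M)"
        using tendsto_divide[OF tendsto_minus[OF sq] den] by simp
      show "\<forall>\<^sub>F w in in_prob M. - (\<Sum>m\<in>UNIV - {j}. (sqrt (fst w) * (U w $ j $ m - 0)) * U w $ j $ m) / (U w $ j $ j + 1) =
          sqrt (fst w) * (U w $ j $ j - 1)"
        using unit nz
      proof eventually_elim
        case (elim w)
        have "(\<Sum>m\<in>UNIV - {j}. (sqrt (fst w) * (U w $ j $ m - 0)) * U w $ j $ m) = sqrt (fst w) * (\<Sum>m\<in>UNIV - {j}. (U w $ j $ m)\<^sup>2)"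
          by (simp add: sum_distrib_left power2_eq_square mult.assoc)
        also have "(\<Sum>m\<in>UNIV - {j}. (U w $ j $ m)\<^sup>2) = 1 - (U w $ j $ j)\<^sup>2"
          using elim(1) sum.remove[of UNIV j "\<lambda>m. (U w $ j $ m)\<^sup>2"] by simp
        also have "\<dots> = - ((U w $ j $ j - 1) * (U w $ j $ j + 1))" by (simp add: power2_eq_square algebra_simps)
        finally show ?case using elim(2) by simp
      qed
    qed
    then show ?thesis using True by (auto simp: asym_linear_def kron_def avg_0)
  qed
qed

end

section \<open>Influence function of the left MFOBI estimate\<close>

context independent_entries
begin

lemma asym_linear_estimate:
  assumes \<Gamma>_measurable: "\<And>n. \<Gamma> n \<in> borel_measurable M"
    and \<Gamma>_estimate: "\<And>n. AE x in M. pos_def (S_L (sample x) n) \<and> pos_def (S_R (sample x) n)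
        \<longrightarrow> left_mfobi_estimate N (sample x) n (\<Gamma> n x)"
    and \<Gamma>_consistent: "conv_in_prob M \<Gamma> (mat 1)"
    and distinct: "inj (row_mean \<beta>)"
  shows "asym_linear (\<lambda>w. \<Gamma> (fst w) (snd w) $ k $ k') (kron k k') (gamma_infl N k k')"
proof -
  define R where "R w = inv_sqrt (SL w)" for w
  define G where "G w = \<Gamma> (fst w) (snd w)" for w
  \<comment> \<open>U is obtained from the estimate by undoing R instead of being taken from a
    \<open>W\<close>; it is thus defined for every sample and converges because \<Gamma>
    does.\<close>
  define U where "U w = G w ** (R w ** SL w)" for w
  define \<Lambda> where "\<Lambda> j w = (\<Sum>i\<in>UNIV. U w $ j $ i * (\<Sum>m\<in>UNIV. BL N w $ i $ m * U w $ j $ m))" for j w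
  have Glim: "((\<lambda>w. G w $ i $ j) \<longlongrightarrow> kron i j) (in_prob M)" for i j
  proof -
    have "(G \<longlongrightarrow> mat 1) (in_prob M)"
      using tendsto_in_probI[OF \<Gamma>_consistent \<Gamma>_measurable] by (simp add: G_def[abs_def])
    then have "((\<lambda>w. G w $ i $ j) \<longlongrightarrow> mat 1 $ i $ j) (in_prob M)" by (intro tendsto_vec_nth)
    then show ?thesis by (simp add: mat_def kron_def)
  qed
  have est: "\<forall>\<^sub>F w in in_prob M. pos_def (SL w) \<and> pos_def (SR w) \<longrightarrow> left_mfobi_estimate N (sample (snd w)) (fst w) (G w)"
    unfolding G_def by (rule eventually_in_prob_AE[where P="\<lambda>n x. pos_def (S_L (sample x) n) \<and> pos_def (S_R (sample x) n)
        \<longrightarrow> left_mfobi_estimate N (sample x) n (\<Gamma> n x)"]) (rule \<Gamma>_estimate)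
  \<comment> \<open>With both covariance matrices within 1/4 of the identity they are positive
    definite, so the assumption on the estimate provides a \<open>W\<close>, and R R S = 1
    identifies U with its transpose.\<close>
  have good: "\<forall>\<^sub>F w in in_prob M. \<exists>W. orthogonal_matrix W \<and> (\<forall>j. eigenvector (BL N w) (column j W)) \<and>
      U w = transpose W \<and> G w = U w ** R w"
    using est SL_near SR_near
  proof eventually_elim
    case (elim w)
    have "left_mfobi_estimate N (sample (snd w)) (fst w) (G w)"
      using elim(1) inv_sqrt_near_one(1)[OF SL_symmetric elim(2)] inv_sqrt_near_one(1)[OF SR_symmetric elim(3)]
      by simp
    then obtain W where W: "orthogonal_matrix W" "\<And>j. eigenvector (BL N w) (column j W)" "G w = transpose W ** R w"
      by (auto simp: left_mfobi_estimate_def R_def)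
    have "U w = transpose W ** (R w ** (R w ** SL w))"
      by (simp add: U_def W(3) matrix_mul_assoc)
    also have "R w ** (R w ** SL w) = mat 1"
      unfolding R_def by (rule inv_sqrt_near_one(2)[OF SL_symmetric elim(2)])
    finally have "U w = transpose W" by simp
    then show ?case using W by auto
  qed
  have Rlin: "asym_linear (\<lambda>w. R w $ i $ j) (kron i j) (\<lambda>A. - (1/2) * row_infl i j A)" for i j
    unfolding R_def by (rule asym_linear_RL)
  have Ulim: "((\<lambda>w. U w $ i $ j) \<longlongrightarrow> kron i j) (in_prob M)" for i j
  proof -
    have "((\<lambda>w. \<Sum>a\<in>UNIV. G w $ i $ a * (\<Sum>b\<in>UNIV. R w $ a $ b * SL w $ b $ j)) \<longlongrightarrow>
        (\<Sum>a\<in>UNIV. kron i a * (\<Sum>b\<in>UNIV. kron a b * kron b j))) (in_prob M)"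
      by (intro tendsto_sum tendsto_mult Glim asym_linear_tendsto[OF Rlin] asym_linear_tendsto[OF asym_linear_SL])
    then show ?thesis by (simp add: U_def matrix_matrix_mult_def)
  qed
  have Ulin: "asym_linear (\<lambda>w. U w $ j $ k) (kron j k) (\<lambda>A. if j = k then 0 else B_infl N k j A / (eig N j - eig N k))" for j k
  proof (rule asym_linear_eigenvectors)
    show "asym_linear (\<lambda>w. BL N w $ i $ j) (kron i j * eig N i) (B_infl N i j)" for i j
      using asym_linear_BL[of N i j] by (simp add: B_mean_eq)
    show "eig N i \<noteq> eig N j" if "i \<noteq> j" for i j
      using that injD[OF distinct, of i j] by (auto simp: eig_def)
    show "\<forall>\<^sub>F w in in_prob M. \<forall>j. (\<Sum>m\<in>UNIV. (U w $ j $ m)\<^sup>2) = 1"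
      using good
    proof eventually_elim
      case (elim w)
      then show ?case using orthogonal_eigenvectors_rows(1) by metis
    qed
    show "\<forall>\<^sub>F w in in_prob M. \<forall>j k. (\<Sum>m\<in>UNIV. BL N w $ k $ m * U w $ j $ m) = \<Lambda> j w * U w $ j $ k"
      using good
    proof eventually_elim
      case (elim w)
      then obtain W where W: "orthogonal_matrix W" "\<And>j. eigenvector (BL N w) (column j W)" "U w = transpose W" by blast
      show ?case
        using orthogonal_eigenvectors_rows(2)[OF W(1) W(2)] unfolding \<Lambda>_def W(3) by blast
    qed
    show "((\<lambda>w. U w $ i $ j) \<longlongrightarrow> kron i j) (in_prob M)" for i j by (rule Ulim)
  qed (simp add: \<Lambda>_def)
  have "asym_linear (\<lambda>w. \<Sum>m\<in>UNIV. U w $ k $ m * R w $ m $ k') (\<Sum>m\<in>UNIV. kron k m * kron m k')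
      (\<lambda>A. \<Sum>m\<in>UNIV. kron k m * (- (1/2) * row_infl m k' A) + kron m k' * (if k = m then 0 else B_infl N m k A / (eig N k - eig N m)))"
    by (intro asym_linear_sum asym_linear_mult Ulin Rlin)
  then show ?thesis
  proof (rule asym_linear_eq)
    show "\<forall>\<^sub>F w in in_prob M. \<Gamma> (fst w) (snd w) $ k $ k' = (\<Sum>m\<in>UNIV. U w $ k $ m * R w $ m $ k')"
      using good
    proof eventually_elim
      case (elim w)
      then have "G w = U w ** R w" by blast
      then show ?case by (simp add: G_def matrix_matrix_mult_def)
    qed
    show "(\<Sum>m\<in>UNIV. kron k m * (- (1/2) * row_infl m k' A) + kron m k' * (if k = m then 0 else B_infl N m k A / (eig N k - eig N m))) =
      gamma_infl N k k' A" for A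
      unfolding sum.distrib sum_kron gamma_infl_def by simp
  qed simp
qed

end

theorem corollary6p3p1:
  fixes M :: "'a measure"
    and Z :: "'a \<Rightarrow> real^'q^'p"
    and Zs X :: "nat \<Rightarrow> 'a \<Rightarrow> real^'q^'p"
    and \<Omega>\<^sub>L :: "real^'p^'p" and \<Omega>\<^sub>R :: "real^'q^'q"
    and N :: nat
    and \<Gamma> :: "nat \<Rightarrow> 'a \<Rightarrow> real^'p^'p"
  defines "\<beta> \<equiv> fourth_moment M Z"
    and "\<omega> \<equiv> var_cube M Z"
    and "p \<equiv> real CARD('p)" and "q \<equiv> real CARD('q)"
  assumes M: "prob_space M"
    and Z: "Z \<in> borel_measurable M"
    and sample_indep: "prob_space.indep_vars M (\<lambda>_. borel) Zs UNIV"
    and sample_distr: "\<And>i. distr M borel (Zs i) = distr M borel Z"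
    and eighth_moments: "\<And>k l. integrable M (\<lambda>x. (Z x $ k $ l) ^ 8)"
    and components_indep:
      "prob_space.indep_vars M (\<lambda>_. borel) (\<lambda>(k, l) x. Z x $ k $ l) (UNIV :: ('p \<times> 'q) set)"
    and mean_zero: "\<And>k l. prob_space.expectation M (\<lambda>x. Z x $ k $ l) = 0"
    and var_one: "\<And>k l. prob_space.variance M (\<lambda>x. Z x $ k $ l) = 1"
    and rows_distinct: "inj (row_avg \<beta>)"
    and cols_distinct: "inj (col_avg \<beta>)"
    and X: "\<And>i x. X i x = \<Omega>\<^sub>L ** Zs i x ** transpose \<Omega>\<^sub>R"
    and \<Omega>: "\<Omega>\<^sub>L = mat 1" "\<Omega>\<^sub>R = mat 1"
    and N: "N \<in> {0, 1}"
    and \<Gamma>_measurable: "\<And>n. \<Gamma> n \<in> borel_measurable M"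
    and \<Gamma>_estimate: "\<And>n. AE x in M. pos_def (S_L (\<lambda>i. X i x) n) \<and> pos_def (S_R (\<lambda>i. X i x) n)
        \<longrightarrow> left_mfobi_estimate N (\<lambda>i. X i x) n (\<Gamma> n x)"
    and \<Gamma>_consistent: "conv_in_prob M \<Gamma> (mat 1)"
  shows "\<exists>\<mu> C. multivariate_normal 0 C \<mu> \<and>
      weak_limit (\<lambda>n. distr M borel (\<lambda>x. sqrt (real n) *\<^sub>R vec_mat (\<Gamma> n x - mat 1))) \<mu> \<and>
      (\<forall>k. prob_space.variance \<mu> (\<lambda>v. v $ (k, k)) = (row_avg \<beta> k - 1) / (4 * q)) \<and>
      (\<forall>k k'. k \<noteq> k' \<longrightarrow>
        (let c = (if N = 0
                  then (\<Sum>m\<in>UNIV - {k, k'}. row_avg \<beta> m) + p * q - 2 * p - 4 * q + 15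
                  else q * (\<Sum>m\<in>UNIV - {k, k'}. row_avg \<beta> m) - p * q + 11)
         in prob_space.variance \<mu> (\<lambda>v. v $ (k, k')) =
            (row_avg \<omega> k + row_avg \<omega> k' - (row_avg \<beta> k)\<^sup>2 + 2 * row_cov \<beta> k k'
              + (q - 1) * row_avg \<beta> k + (q - 7) * row_avg \<beta> k' + c)
            / (q * (row_avg \<beta> k - row_avg \<beta> k')\<^sup>2)))"
proof -
  interpret P: prob_space M by fact
  have X_eq: "X = Zs" using X \<Omega> by (simp add: fun_eq_iff transpose_mat)
  have "P.indep_vars (\<lambda>_. borel) (\<lambda>i x. entry i (Z x)) UNIV"
  proof -
    have "(\<lambda>(k, l) x. Z x $ k $ l) = (\<lambda>i x. entry i (Z x))" by (auto simp: fun_eq_iff)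
    then show ?thesis using components_indep by simp
  qed
  moreover have "P.expectation (\<lambda>x. (entry i (Z x))\<^sup>2) = 1" for i
    using var_one[of "fst i" "snd i"] mean_zero[of "fst i" "snd i"] by simp
  ultimately interpret S: independent_entries M Z Zs
    by unfold_locales (use Z sample_indep sample_distr eighth_moments mean_zero in auto)
  have int: "integrable M (\<lambda>x. entry i (Z x) ^ k)" if "k \<le> 8" for i k
    by (rule S.entry_power_integrable[OF that])
  have beta: "S.moment (k, l) 4 = \<beta> k l" for k l
    by (simp add: S.moment_def \<beta>_def fourth_moment_def)
  have omega: "S.moment (k, l) 6 - (S.moment (k, l) 3)\<^sup>2 = \<omega> k l" for k l
  proof -
    have "P.variance (\<lambda>x. (Z x $ k $ l) ^ 3) = P.expectation (\<lambda>x. ((Z x $ k $ l) ^ 3)\<^sup>2) - (P.expectation (\<lambda>x. (Z x $ k $ l) ^ 3))\<^sup>2"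
      using int[of 3 "(k, l)"] int[of 6 "(k, l)"] by (intro P.variance_eq) (simp_all flip: power_mult)
    then show ?thesis by (simp add: S.moment_def \<omega>_def var_cube_def flip: power_mult)
  qed
  have row_beta: "S.row_mean (\<lambda>i. S.moment i 4) = row_avg \<beta>"
    by (simp add: fun_eq_iff S.row_mean_def row_avg_def beta)
  have row_omega: "S.row_mean (\<lambda>i. S.moment i 6 - (S.moment i 3)\<^sup>2) = row_avg \<omega>"
    by (simp add: fun_eq_iff S.row_mean_def row_avg_def omega)
  have cov: "S.row_mean (\<lambda>i. S.moment i 4 * S.moment (k', snd i) 4) k - row_avg \<beta> k * row_avg \<beta> k' = row_cov \<beta> k k'" for k k'
    by (simp add: S.row_mean_def row_cov_def beta)
  define V where "V n x = vec_mat (\<Gamma> n x)" for n x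
  have nth: "vec_mat A $ i = A $ fst i $ snd i" for A :: "real^'p^'p" and i by (simp add: vec_mat_def)
  have V: "V n \<in> borel_measurable M" for n
  proof -
    have "vec_mat \<in> borel_measurable (borel :: (real^'p^'p) measure)"
      unfolding vec_mat_def by (intro borel_measurable_continuous_onI continuous_on_vec_lambda continuous_intros)
    from measurable_compose[OF \<Gamma>_measurable this] show ?thesis by (simp add: V_def[abs_def])
  qed
  have lin: "S.asym_linear (\<lambda>\<omega>. V (fst \<omega>) (snd \<omega>) $ i) (vec_mat (mat 1) $ i) (S.gamma_infl N (fst i) (snd i))" for i
  proof -
    have "vec_mat (mat 1) $ i = kron (fst i) (snd i)" by (simp add: nth mat_def kron_def)
    then show ?thesis
      unfolding V_def nth
      using S.asym_linear_estimate[OF \<Gamma>_measurable \<Gamma>_estimate[unfolded X_eq] \<Gamma>_consistent, unfolded row_beta, OF rows_distinct]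
      by (simp add: nth)
  qed
  obtain \<mu> C where \<mu>: "multivariate_normal 0 C \<mu>"
    "weak_limit (\<lambda>n. distr M borel (\<lambda>x. sqrt (real n) *\<^sub>R (V n x - vec_mat (mat 1)))) \<mu>"
    "\<And>i. prob_space.variance \<mu> (\<lambda>v. v $ i) = P.expectation (\<lambda>x. (S.gamma_infl N (fst i) (snd i) (Z x))\<^sup>2)"
    by (rule S.asym_linear_normal[OF V lin]) (rule that)
  have "V n x - vec_mat (mat 1) = vec_mat (\<Gamma> n x - mat 1)" for n x
    by (simp add: vec_eq_iff V_def nth)
  then have "weak_limit (\<lambda>n. distr M borel (\<lambda>x. sqrt (real n) *\<^sub>R vec_mat (\<Gamma> n x - mat 1))) \<mu>"
    using \<mu>(2) by simp
  moreover have "prob_space.variance \<mu> (\<lambda>v. v $ (k, k)) = (row_avg \<beta> k - 1) / (4 * q)" for k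
    unfolding \<mu>(3) using S.gamma_infl_diag_norm[of N k] by (simp add: row_beta q_def)
  moreover have "(let c = (if N = 0
                  then (\<Sum>m\<in>UNIV - {k, k'}. row_avg \<beta> m) + p * q - 2 * p - 4 * q + 15
                  else q * (\<Sum>m\<in>UNIV - {k, k'}. row_avg \<beta> m) - p * q + 11)
         in prob_space.variance \<mu> (\<lambda>v. v $ (k, k')) =
            (row_avg \<omega> k + row_avg \<omega> k' - (row_avg \<beta> k)\<^sup>2 + 2 * row_cov \<beta> k k'
              + (q - 1) * row_avg \<beta> k + (q - 7) * row_avg \<beta> k' + c)
            / (q * (row_avg \<beta> k - row_avg \<beta> k')\<^sup>2))" if "k \<noteq> k'" for k k'
  proof -
    have "row_avg \<beta> k \<noteq> row_avg \<beta> k'" using rows_distinct that by (auto dest: injD)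
    from S.gamma_infl_offdiag_norm[of k k' N, unfolded row_beta row_omega cov, OF that this]
    show ?thesis unfolding \<mu>(3) Let_def p_def q_def by simp
  qed
  ultimately show ?thesis using \<mu>(1) by blast
qed

end
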